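(* Let $G$ be a locally compact, compactly generated group and $Z$ a closed, central subgroup. Endow $G$ with a word length with respect to a compact generating subset and let $Z$ be endowed with the restriction of this word length. Given a nonprincipal ultrafilter $\omega$ on the set of positive integers, assume that $\mathrm{Cone}_\omega(Z)$ is ultrametric. Then the sequence $$1\to\pi_1(\mathrm{Cone}_\omega(G))\to\pi_1(\mathrm{Cone}_\omega(G/Z))\stackrel{\tilde{\mu}}{\longrightarrow}\mathrm{Cone}_\omega(Z)\to 1$$ is a Lipschitz-exact sequence of metric groups.
   Context: Asymptotic cone: for a metric space $(X,d)$ with base-point $x_0$ and a nonprincipal ultrafilter $\omega$ on the set of positive integers, let $\mathrm{Precone}(X)$ be the set of sequences $(x_n)$ in $X$ with $\limsup_n d(x_n,x_0)/n<\infty$, with pseudo-distance $d_\omega(x,y)=\lim_\omega \frac1n d(x_n,y_n)$; $\mathrm{Cone}_\omega(X)$ is the metric space obtained by identifying points at pseudo-distance $0$. For groups the base-point is the class of the constant sequence $1$. Since $Z$ is abelian, $\mathrm{Cone}_\omega(Z)$ is a group (termwise operations) with a bi-invariant distance. It acts freely on $\mathrm{Cone}_\omega(G)$ by termwise multiplication, and $\mathrm{Cone}_\omega(G/Z)$ is identified with the set of orbits; $G/Z$ has the word metric with respect to the image of the compact generating subset of $G$. $\mathrm{Cone}_\omega(Z)$ is identified with the orbit of the base-point in $\mathrm{Cone}_\omega(G)$. Pseudo-metric on $\pi_1$: for a metric space $X$ with base-point $x_0$ and closed ball $B(\varepsilon)$ of radius $\varepsilon$ around $x_0$, let $L_{B(\varepsilon)}$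 be the set of elements of $\pi_1(X,x_0)$ that can be represented by a finite product $\prod_{i=1}^k c_i\gamma_ic_i^{-1}$ where $c_i,\gamma_i$ are loops based at $x_0$ and each $\gamma_i$ has image in $B(\varepsilon)$ (it is a normal subgroup). The pseudo-distance of $\gamma\in\pi_1(X,x_0)$ to the identity is $\inf\{\varepsilon>0:\gamma\in L_{B(\varepsilon)}\}$; this defines a bi-invariant (ultrametric) pseudo-distance on $\pi_1(X,x_0)$. The maps: the first map is induced by the natural projection $\mathrm{Cone}_\omega(G)\to\mathrm{Cone}_\omega(G/Z)$. Under the assumption that $\mathrm{Cone}_\omega(Z)$ is ultrametric, every based loop $u:[0,1]\to\mathrm{Cone}_\omega(G/Z)$ has a unique continuous lift $\varphi(u):[0,1]\to\mathrm{Cone}_\omega(G)$ starting at the base-point; $\tilde{\mu}$ maps the homotopy class of $u$ to the endpoint $\varphi(u)(1)\in\mathrm{Cone}_\omega(Z)$ (this depends only on the class of $u$). Lipschitz-exactness: a metric group is a group endowed with a left-invariant pseudometric. An exact sequence $1\to N\stackrel{\iota}{\to}H\stackrel{q}{\to}Q\to1$ of metric groups is Lipschitz-exact if $\iota$ is Lipschitz and there exist constants $C,C'>0$ such that $C\,d(g,\mathrm{Ker}(q))\le d(1,q(g))\le C'\,d(g,\mathrm{Ker}(q))$ for all $g\in H$. *)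

theory Defs
  imports "HOL-Analysis.Analysis" "HOL-Algebra.Coset" "HOL-Algebra.Generated_Groups"
begin

section \<open>Topological groups and word metrics\<close>

definition topological_group :: "('a, 'b) monoid_scheme \<Rightarrow> 'a topology \<Rightarrow> bool" where
  "topological_group G T \<longleftrightarrow>
     group G \<and> topspace T = carrier G \<and>
     continuous_map (prod_topology T T) T (\<lambda>(x, y). x \<otimes>\<^bsub>G\<^esub> y) \<and>
     continuous_map T T (\<lambda>x. inv\<^bsub>G\<^esub> x)"

text \<open>As usual, a locally compact group is understood to be Hausdorff.\<close>

definition locally_compact_group :: "('a, 'b) monoid_scheme \<Rightarrow> 'a topology \<Rightarrow> bool" where
  "locally_compact_group G T \<longleftrightarrow>
     topological_group G T \<and> Hausdorff_space T \<and> locally_compact_space T"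

text \<open>The generating set \<open>S\<close> is not assumed symmetric: words are in \<open>S\<close> and its inverses.\<close>

definition word_length :: "('a, 'b) monoid_scheme \<Rightarrow> 'a set \<Rightarrow> 'a \<Rightarrow> nat" where
  "word_length G S g =
     (LEAST n. \<exists>xs. length xs = n \<and> set xs \<subseteq> S \<union> m_inv G ` S \<and>
                    foldr (\<otimes>\<^bsub>G\<^esub>) xs \<one>\<^bsub>G\<^esub> = g)"

definition word_dist :: "('a, 'b) monoid_scheme \<Rightarrow> 'a set \<Rightarrow> 'a \<Rightarrow> 'a \<Rightarrow> real" where
  "word_dist G S g h = real (word_length G S (inv\<^bsub>G\<^esub> g \<otimes>\<^bsub>G\<^esub> h))"


section \<open>Asymptotic cones\<close>

text \<open>
  Sequences and ultrafilters live on \<open>nat\<close>; an ultrafilter on the positive integers is one on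
  \<open>nat\<close> that contains the set of positive integers, so the term of index 0 of a sequence is
  irrelevant.
\<close>

definition nonprincipal_ultrafilter :: "nat filter \<Rightarrow> bool" where
  "nonprincipal_ultrafilter \<omega> \<longleftrightarrow>
     \<omega> \<noteq> bot \<and>
     (\<forall>P. eventually P \<omega> \<or> eventually (\<lambda>n. \<not> P n) \<omega>) \<and>
     eventually (\<lambda>n. n > 0) \<omega> \<and>
     (\<forall>m. \<not> eventually (\<lambda>n. n = m) \<omega>)"

definition precone :: "'a set \<Rightarrow> ('a \<Rightarrow> 'a \<Rightarrow> real) \<Rightarrow> 'a \<Rightarrow> (nat \<Rightarrow> 'a) set" where
  "precone X d x0 =
     {x. (\<forall>n. x n \<in> X) \<and> limsup (\<lambda>n. ereal (d (x n) x0 / real n)) < \<infinity>}"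

definition precone_dist ::
  "nat filter \<Rightarrow> ('a \<Rightarrow> 'a \<Rightarrow> real) \<Rightarrow> (nat \<Rightarrow> 'a) \<Rightarrow> (nat \<Rightarrow> 'a) \<Rightarrow> real" where
  "precone_dist \<omega> d x y = Lim \<omega> (\<lambda>n. d (x n) (y n) / real n)"

definition cone_class ::
  "nat filter \<Rightarrow> 'a set \<Rightarrow> ('a \<Rightarrow> 'a \<Rightarrow> real) \<Rightarrow> 'a \<Rightarrow> (nat \<Rightarrow> 'a) \<Rightarrow> (nat \<Rightarrow> 'a) set" where
  "cone_class \<omega> X d x0 x = {y \<in> precone X d x0. precone_dist \<omega> d x y = 0}"

definition asymp_cone ::
  "nat filter \<Rightarrow> 'a set \<Rightarrow> ('a \<Rightarrow> 'a \<Rightarrow> real) \<Rightarrow> 'a \<Rightarrow> (nat \<Rightarrow> 'a) set set" where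
  "asymp_cone \<omega> X d x0 = cone_class \<omega> X d x0 ` precone X d x0"

text \<open>
  The pseudo-distance of representatives does not depend on their choice. The value 0 off the
  cone makes the function symmetric and nonnegative everywhere, as \<open>Metric_space\<close> demands.
\<close>

definition cone_dist ::
  "nat filter \<Rightarrow> 'a set \<Rightarrow> ('a \<Rightarrow> 'a \<Rightarrow> real) \<Rightarrow> 'a \<Rightarrow>
   (nat \<Rightarrow> 'a) set \<Rightarrow> (nat \<Rightarrow> 'a) set \<Rightarrow> real" where
  "cone_dist \<omega> X d x0 A B =
     (if A \<in> asymp_cone \<omega> X d x0 \<and> B \<in> asymp_cone \<omega> X d x0
      then THE r. \<exists>x\<in>A. \<exists>y\<in>B. r = precone_dist \<omega> d x y else 0)"

definition cone_base ::
  "nat filter \<Rightarrow> 'a set \<Rightarrow> ('a \<Rightarrow> 'a \<Rightarrow> real) \<Rightarrow> 'a \<Rightarrow> (nat \<Rightarrow> 'a) set" where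
  "cone_base \<omega> X d x0 = cone_class \<omega> X d x0 (\<lambda>n. x0)"

text \<open>
  The map between cones induced by \<open>f\<close> applied termwise, with target the cone of
  \<open>(Y, e, y0)\<close>: the union below is over equal classes.
\<close>

definition cone_map ::
  "nat filter \<Rightarrow> 'b set \<Rightarrow> ('b \<Rightarrow> 'b \<Rightarrow> real) \<Rightarrow> 'b \<Rightarrow> ('a \<Rightarrow> 'b) \<Rightarrow>
   (nat \<Rightarrow> 'a) set \<Rightarrow> (nat \<Rightarrow> 'b) set" where
  "cone_map \<omega> Y e y0 f A = (\<Union>x\<in>A. cone_class \<omega> Y e y0 (f \<circ> x))"

definition cone_group ::
  "nat filter \<Rightarrow> ('a, 'b) monoid_scheme \<Rightarrow> ('a \<Rightarrow> 'a \<Rightarrow> real) \<Rightarrow> (nat \<Rightarrow> 'a) set monoid" where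
  "cone_group \<omega> H d =
     \<lparr>carrier = asymp_cone \<omega> (carrier H) d \<one>\<^bsub>H\<^esub>,
      mult = (\<lambda>A B. \<Union>x\<in>A. \<Union>y\<in>B. cone_class \<omega> (carrier H) d \<one>\<^bsub>H\<^esub> (\<lambda>n. x n \<otimes>\<^bsub>H\<^esub> y n)),
      one = cone_base \<omega> (carrier H) d \<one>\<^bsub>H\<^esub>\<rparr>"

definition ultrametric_on :: "'a set \<Rightarrow> ('a \<Rightarrow> 'a \<Rightarrow> real) \<Rightarrow> bool" where
  "ultrametric_on X d \<longleftrightarrow> (\<forall>x\<in>X. \<forall>y\<in>X. \<forall>z\<in>X. d x z \<le> max (d x y) (d y z))"


section \<open>Fundamental groups and their pseudo-metric\<close>

text \<open>
  Paths are functions on the reals of which only the restriction to \<open>{0..1}\<close> matters. The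
  library's \<open>joinpaths\<close> needs a type of class \<open>topological_space\<close>, hence \<open>path_concat\<close>.
\<close>

definition path_concat :: "(real \<Rightarrow> 'a) \<Rightarrow> (real \<Rightarrow> 'a) \<Rightarrow> real \<Rightarrow> 'a" where
  "path_concat p q = (\<lambda>t. if t \<le> 1/2 then p (2 * t) else q (2 * t - 1))"

definition based_loops :: "'a topology \<Rightarrow> 'a \<Rightarrow> (real \<Rightarrow> 'a) set" where
  "based_loops X x0 = {p. pathin X p \<and> p 0 = x0 \<and> p 1 = x0}"

definition loop_class :: "'a topology \<Rightarrow> 'a \<Rightarrow> (real \<Rightarrow> 'a) \<Rightarrow> (real \<Rightarrow> 'a) set" where
  "loop_class X x0 p =
     {q. homotopic_with (\<lambda>h. h 0 = x0 \<and> h 1 = x0) (top_of_set {0..1}) X p q}"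

definition pi1 :: "'a topology \<Rightarrow> 'a \<Rightarrow> (real \<Rightarrow> 'a) set monoid" where
  "pi1 X x0 =
     \<lparr>carrier = loop_class X x0 ` based_loops X x0,
      mult = (\<lambda>A B. \<Union>p\<in>A. \<Union>q\<in>B. loop_class X x0 (path_concat p q)),
      one = loop_class X x0 (\<lambda>t. x0)\<rparr>"

definition pi1_map ::
  "'b topology \<Rightarrow> 'b \<Rightarrow> ('a \<Rightarrow> 'b) \<Rightarrow> (real \<Rightarrow> 'a) set \<Rightarrow> (real \<Rightarrow> 'b) set" where
  "pi1_map Y y0 f A = (\<Union>p\<in>A. loop_class Y y0 (f \<circ> p))"

abbreviation metric_pi1 :: "'a set \<Rightarrow> ('a \<Rightarrow> 'a \<Rightarrow> real) \<Rightarrow> 'a \<Rightarrow> (real \<Rightarrow> 'a) set monoid" where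
  "metric_pi1 M d x0 \<equiv> pi1 (Metric_space.mtopology M d) x0"

text \<open>The subgroup of products of conjugates of loops with image in the closed ball.\<close>

definition pi1_ball_subgroup ::
  "'a set \<Rightarrow> ('a \<Rightarrow> 'a \<Rightarrow> real) \<Rightarrow> 'a \<Rightarrow> real \<Rightarrow> (real \<Rightarrow> 'a) set set" where
  "pi1_ball_subgroup M d x0 \<epsilon> =
     (let X = Metric_space.mtopology M d; P = pi1 X x0 in
      {foldr (\<otimes>\<^bsub>P\<^esub>)
         (map (\<lambda>(c, \<gamma>). loop_class X x0 c \<otimes>\<^bsub>P\<^esub> loop_class X x0 \<gamma> \<otimes>\<^bsub>P\<^esub> inv\<^bsub>P\<^esub> (loop_class X x0 c)) ps)
         \<one>\<^bsub>P\<^esub> | ps.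
       \<forall>(c, \<gamma>) \<in> set ps. c \<in> based_loops X x0 \<and> \<gamma> \<in> based_loops X x0 \<and>
                          \<gamma> ` {0..1} \<subseteq> Metric_space.mcball M d x0 \<epsilon>})"

definition pi1_length ::
  "'a set \<Rightarrow> ('a \<Rightarrow> 'a \<Rightarrow> real) \<Rightarrow> 'a \<Rightarrow> (real \<Rightarrow> 'a) set \<Rightarrow> real" where
  "pi1_length M d x0 g = Inf {\<epsilon>. \<epsilon> > 0 \<and> g \<in> pi1_ball_subgroup M d x0 \<epsilon>}"

definition pi1_dist ::
  "'a set \<Rightarrow> ('a \<Rightarrow> 'a \<Rightarrow> real) \<Rightarrow> 'a \<Rightarrow> (real \<Rightarrow> 'a) set \<Rightarrow> (real \<Rightarrow> 'a) set \<Rightarrow> real" where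
  "pi1_dist M d x0 g h =
     (let P = metric_pi1 M d x0 in pi1_length M d x0 (inv\<^bsub>P\<^esub> g \<otimes>\<^bsub>P\<^esub> h))"


section \<open>Lipschitz-exact sequences of metric groups\<close>

definition metric_group :: "('a, 'b) monoid_scheme \<Rightarrow> ('a \<Rightarrow> 'a \<Rightarrow> real) \<Rightarrow> bool" where
  "metric_group G d \<longleftrightarrow>
     group G \<and>
     (\<forall>x\<in>carrier G. d x x = 0) \<and>
     (\<forall>x\<in>carrier G. \<forall>y\<in>carrier G. 0 \<le> d x y \<and> d x y = d y x) \<and>
     (\<forall>x\<in>carrier G. \<forall>y\<in>carrier G. \<forall>z\<in>carrier G. d x z \<le> d x y + d y z) \<and>
     (\<forall>g\<in>carrier G. \<forall>x\<in>carrier G. \<forall>y\<in>carrier G. d (g \<otimes>\<^bsub>G\<^esub> x) (g \<otimes>\<^bsub>G\<^esub> y) = d x y)"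

definition short_exact ::
  "('a, 'm) monoid_scheme \<Rightarrow> ('b, 'n) monoid_scheme \<Rightarrow> ('c, 'p) monoid_scheme \<Rightarrow>
   ('a \<Rightarrow> 'b) \<Rightarrow> ('b \<Rightarrow> 'c) \<Rightarrow> bool" where
  "short_exact N H Q i q \<longleftrightarrow>
     i \<in> mon N H \<and> q \<in> epi H Q \<and> i ` carrier N = kernel H Q q"

definition Lipschitz_exact ::
  "('a, 'm) monoid_scheme \<Rightarrow> ('a \<Rightarrow> 'a \<Rightarrow> real) \<Rightarrow>
   ('b, 'n) monoid_scheme \<Rightarrow> ('b \<Rightarrow> 'b \<Rightarrow> real) \<Rightarrow>
   ('c, 'p) monoid_scheme \<Rightarrow> ('c \<Rightarrow> 'c \<Rightarrow> real) \<Rightarrow>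
   ('a \<Rightarrow> 'b) \<Rightarrow> ('b \<Rightarrow> 'c) \<Rightarrow> bool" where
  "Lipschitz_exact N dN H dH Q dQ i q \<longleftrightarrow>
     metric_group N dN \<and> metric_group H dH \<and> metric_group Q dQ \<and>
     short_exact N H Q i q \<and>
     (\<exists>L\<ge>0. \<forall>x\<in>carrier N. \<forall>y\<in>carrier N. dH (i x) (i y) \<le> L * dN x y) \<and>
     (\<exists>C>0. \<exists>C'>0. \<forall>g\<in>carrier H.
        C * (INF k\<in>kernel H Q q. dH g k) \<le> dQ \<one>\<^bsub>Q\<^esub> (q g) \<and>
        dQ \<one>\<^bsub>Q\<^esub> (q g) \<le> C' * (INF k\<in>kernel H Q q. dH g k))"


section \<open>The cones of \<open>G\<close>, \<open>G/Z\<close> and \<open>Z\<close>, and the maps between them\<close>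

definition word_cone ::
  "nat filter \<Rightarrow> ('a, 'b) monoid_scheme \<Rightarrow> 'a set \<Rightarrow> (nat \<Rightarrow> 'a) set set" where
  "word_cone \<omega> G S = asymp_cone \<omega> (carrier G) (word_dist G S) \<one>\<^bsub>G\<^esub>"

definition word_cone_dist ::
  "nat filter \<Rightarrow> ('a, 'b) monoid_scheme \<Rightarrow> 'a set \<Rightarrow>
   (nat \<Rightarrow> 'a) set \<Rightarrow> (nat \<Rightarrow> 'a) set \<Rightarrow> real" where
  "word_cone_dist \<omega> G S = cone_dist \<omega> (carrier G) (word_dist G S) \<one>\<^bsub>G\<^esub>"

definition word_cone_base ::
  "nat filter \<Rightarrow> ('a, 'b) monoid_scheme \<Rightarrow> 'a set \<Rightarrow> (nat \<Rightarrow> 'a) set" where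
  "word_cone_base \<omega> G S = cone_base \<omega> (carrier G) (word_dist G S) \<one>\<^bsub>G\<^esub>"

definition word_cone_top ::
  "nat filter \<Rightarrow> ('a, 'b) monoid_scheme \<Rightarrow> 'a set \<Rightarrow> (nat \<Rightarrow> 'a) set topology" where
  "word_cone_top \<omega> G S = Metric_space.mtopology (word_cone \<omega> G S) (word_cone_dist \<omega> G S)"

definition quot_gens :: "('a, 'b) monoid_scheme \<Rightarrow> 'a set \<Rightarrow> 'a set \<Rightarrow> 'a set set" where
  "quot_gens G Z S = (\<lambda>s. Z #>\<^bsub>G\<^esub> s) ` S"

definition cone_proj ::
  "nat filter \<Rightarrow> ('a, 'b) monoid_scheme \<Rightarrow> 'a set \<Rightarrow> 'a set \<Rightarrow>
   (nat \<Rightarrow> 'a) set \<Rightarrow> (nat \<Rightarrow> 'a set) set" where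
  "cone_proj \<omega> G Z S =
     cone_map \<omega> (carrier (G Mod Z)) (word_dist (G Mod Z) (quot_gens G Z S)) \<one>\<^bsub>G Mod Z\<^esub>
       (\<lambda>g. Z #>\<^bsub>G\<^esub> g)"

text \<open>
  Identifies the cone of \<open>Z\<close> with the orbit of the base-point in the cone of \<open>G\<close>.
\<close>

definition cone_incl ::
  "nat filter \<Rightarrow> ('a, 'b) monoid_scheme \<Rightarrow> 'a set \<Rightarrow> (nat \<Rightarrow> 'a) set \<Rightarrow> (nat \<Rightarrow> 'a) set" where
  "cone_incl \<omega> G S = cone_map \<omega> (carrier G) (word_dist G S) \<one>\<^bsub>G\<^esub> (\<lambda>z. z)"

definition is_lift ::
  "nat filter \<Rightarrow> ('a, 'b) monoid_scheme \<Rightarrow> 'a set \<Rightarrow> 'a set \<Rightarrow>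
   (real \<Rightarrow> (nat \<Rightarrow> 'a set) set) \<Rightarrow> (real \<Rightarrow> (nat \<Rightarrow> 'a) set) \<Rightarrow> bool" where
  "is_lift \<omega> G Z S u v \<longleftrightarrow>
     pathin (word_cone_top \<omega> G S) v \<and> v 0 = word_cone_base \<omega> G S \<and>
     (\<forall>t\<in>{0..1}. cone_proj \<omega> G Z S (v t) = u t)"

text \<open>
  The point of the cone of \<open>Z\<close> at which the lifts of the loops of a class all end.
\<close>

definition mu_tilde ::
  "nat filter \<Rightarrow> ('a, 'b) monoid_scheme \<Rightarrow> 'a set \<Rightarrow> 'a set \<Rightarrow>
   (real \<Rightarrow> (nat \<Rightarrow> 'a set) set) set \<Rightarrow> (nat \<Rightarrow> 'a) set" where
  "mu_tilde \<omega> G Z S A =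
     (THE z. z \<in> asymp_cone \<omega> Z (word_dist G S) \<one>\<^bsub>G\<^esub> \<and>
             (\<exists>u\<in>A. \<exists>v. is_lift \<omega> G Z S u v \<and> v 1 = cone_incl \<omega> G S z))"

end

theory Submission
  imports Defs
begin

text \<open>
  Write \<open>X\<close>, \<open>Y\<close> and \<open>A\<close> for the asymptotic cones of \<open>G\<close>, \<open>G/Z\<close> and \<open>Z\<close>. The group \<open>A\<close> is abelian,
  its metric is invariant and ultrametric, and it acts freely on \<open>X\<close> so that every orbit map
  \<open>a \<mapsto> a x\<close> is an isometric embedding. The projection \<open>p : X \<rightarrow> Y\<close> has the orbits as fibres, and
  every point of \<open>Y\<close> has a lift as close to a given \<open>x\<close> as it is to \<open>p x\<close>. The theorem is
  a statement about this situation (\<open>Lipschitz_exact_fundamental_groups\<close> in the locale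
  \<open>ultrametric_quotient\<close>).

  \<^emph>\<open>Closeness.\<close> The heart is \<open>coarse_paths_close\<close>. Let \<open>v\<close> and \<open>w\<close> be two paths in \<open>X\<close> whose
  projections stay within \<open>\<delta>\<close> of each other. Then \<open>v t\<close> is within \<open>\<delta>\<close> of some \<open>a\<^sub>t (w t)\<close>, and for
  nearby \<open>s\<close> and \<open>t\<close> the elements \<open>a\<^sub>s\<close> and \<open>a\<^sub>t\<close> differ by little more than \<open>2\<delta>\<close>. In an ultrametric
  space small steps never add up, so if \<open>v\<close> and \<open>w\<close> start together all \<open>a\<^sub>t\<close> stay within about
  \<open>2\<delta>\<close> of the identity: \<open>v\<close> and \<open>w\<close> are uniformly within \<open>3\<delta>\<close>. This holds up to \<open>2\<epsilon>\<close> for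
  discontinuous paths with jumps of size \<open>\<epsilon>\<close>.

  \<^emph>\<open>Lifting.\<close> Taking \<open>\<delta> = 0\<close>, lifts of a path are unique. A path is lifted with jumps \<open>\<epsilon>\<close> by
  subdividing it and lifting one point after the other; by closeness these coarse lifts form
  a Cauchy sequence as \<open>\<epsilon>\<close> tends to \<open>0\<close>, and \<open>X\<close> is complete (\<open>lift_exists\<close>). Closeness also shows
  that the lifts of the stages of a homotopy depend continuously on the stage, and that
  a path inside a fibre is constant, so the end of the lift only depends on the class of the loop
  (\<open>homotopy_lift_exists\<close>). Exactness follows from this as in covering theory, surjectivity of the
  endpoint map \<open>\<mu>\<close> from geodesics of \<open>X\<close>.

  \<^emph>\<open>Metrics.\<close> A loop in the ball of radius \<open>\<epsilon>\<close> lifts to a path that ends within \<open>3\<epsilon>\<close> of its start.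
  As \<open>A\<close> is abelian and ultrametric, products of conjugates of such loops obey the same bound,
  which gives \<open>d 1 (\<mu> g) \<le> 3 d g k\<close> for every \<open>k\<close> in the kernel. Conversely, the geodesic of \<open>X\<close> from
  the base-point to \<open>\<mu> g\<close> projects to a loop \<open>c\<close> in the ball of radius \<open>d 1 (\<mu> g)\<close> with
  \<open>\<mu> c = \<mu> g\<close>, so \<open>g c\<^sup>-\<^sup>1\<close> is an element of the kernel at distance at most \<open>d 1 (\<mu> g)\<close> from \<open>g\<close>.

  The cones fit the locale because lengths in \<open>G/Z\<close> are minimal lengths over cosets, words of
  \<open>G/Z\<close> being liftable letter by letter; cones are complete by a diagonal argument, and prefixes
  of shortest words converge to geodesics.
\<close>


section \<open>The fundamental group of a topology\<close>

abbreviation loop_homotopic where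
  "loop_homotopic X x0 \<equiv> homotopic_with (\<lambda>h. h 0 = x0 \<and> h 1 = x0) (top_of_set {0..1::real}) X"

text \<open>
  Products of classes are unions over all representatives; such a union collapses to a single
  class as soon as the product does not depend on the representatives.
\<close>

lemma UN2_eq_const:
  assumes "a \<in> A" "b \<in> B" "\<And>x y. \<lbrakk>x \<in> A; y \<in> B\<rbrakk> \<Longrightarrow> f x y = c"
  shows "(\<Union>x\<in>A. \<Union>y\<in>B. f x y) = c"
proof (rule SUP_eq_const)
  show "A \<noteq> {}"
    using assms(1) by blast
  show "(\<Union>y\<in>B. f x y) = c" if "x \<in> A" for x
    using assms(2) by (intro SUP_eq_const assms(3)[OF that]) blast
qed

lemma continuous_map_top_of_setI:
  "\<lbrakk>continuous_on A f; f \<in> A \<rightarrow> B\<rbrakk> \<Longrightarrow> continuous_map (top_of_set A) (top_of_set B) f"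
  by (simp add: continuous_map_in_subtopology image_subset_iff_funcset)

text \<open>
  A homotopy of loops needs only its values on the unit square, while \<open>homotopic_with\<close> prescribes
  those of its first and last stage on all reals.
\<close>

lemma loop_homotopicI:
  fixes h :: "real \<times> real \<Rightarrow> 'a"
  assumes "continuous_map (top_of_set ({0..1} \<times> {0..1})) X h"
    and "\<And>t. t \<in> {0..1} \<Longrightarrow> h (0, t) = p t" "\<And>t. t \<in> {0..1} \<Longrightarrow> h (1, t) = q t"
    and "\<And>s. s \<in> {0..1} \<Longrightarrow> h (s, 0) = x0" "\<And>s. s \<in> {0..1} \<Longrightarrow> h (s, 1) = x0"
  shows "loop_homotopic X x0 p q"
proof -
  have "(\<exists>h :: real \<times> real \<Rightarrow> 'a. continuous_map (prod_topology (top_of_set {0..1}) (top_of_set {0..1})) X h \<and>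
     (\<forall>x \<in> topspace (top_of_set {0..1}). h (0,x) = p x) \<and>
     (\<forall>x \<in> topspace (top_of_set {0..1}). h (1,x) = q x) \<and>
     (\<forall>t \<in> {0..1}. h (t, 0) = x0 \<and> h (t, 1) = x0))"
    using assms by (intro exI[of _ h]) auto
  then show ?thesis
    by (subst homotopic_with) auto
qed

lemma loop_homotopicE:
  fixes X :: "'a topology"
  assumes "loop_homotopic X x0 p q"
  obtains h :: "real \<times> real \<Rightarrow> 'a" where "continuous_map (top_of_set ({0..1} \<times> {0..1})) X h"
    and "\<And>t. h (0, t) = p t" "\<And>t. h (1, t) = q t"
    and "\<And>s. s \<in> {0..1} \<Longrightarrow> h (s, 0) = x0" "\<And>s. s \<in> {0..1} \<Longrightarrow> h (s, 1) = x0"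
  using assms unfolding homotopic_with_def prod_topology_subtopology_eu by blast

lemma loop_homotopic_refl: "p \<in> based_loops X x0 \<Longrightarrow> loop_homotopic X x0 p p"
  by (simp add: based_loops_def pathin_def)

lemma based_loops_cong:
  assumes "p \<in> based_loops X x0" "\<And>t. t \<in> {0..1} \<Longrightarrow> q t = p t"
  shows "loop_homotopic X x0 p q"
  using assms by (intro homotopic_with_equal) (auto simp: based_loops_def pathin_def)

lemma mem_loop_class: "q \<in> loop_class X x0 p \<longleftrightarrow> loop_homotopic X x0 p q"
  by (simp add: loop_class_def)

lemma loop_class_eq_iff:
  assumes "p \<in> based_loops X x0"
  shows "loop_class X x0 p = loop_class X x0 q \<longleftrightarrow> loop_homotopic X x0 p q"
proof
  assume "loop_class X x0 p = loop_class X x0 q"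
  moreover have "p \<in> loop_class X x0 p"
    using loop_homotopic_refl[OF assms] by (simp only: mem_loop_class)
  ultimately have "p \<in> loop_class X x0 q"
    by simp
  then show "loop_homotopic X x0 p q"
    by (simp add: mem_loop_class homotopic_with_sym)
next
  assume pq: "loop_homotopic X x0 p q"
  show "loop_class X x0 p = loop_class X x0 q"
    unfolding loop_class_def using homotopic_with_trans pq homotopic_with_symD by blast
qed

text \<open>
  Associativity, unit and inverse laws of the fundamental group are all changes of parameter, and
  \<open>[0, 1]\<close> is convex: the straight line between two parametrizations with common endpoints stays
  inside the domain of the loop.
\<close>

lemma loop_homotopic_reparametrize:
  assumes p: "pathin X p"
    and \<phi>: "continuous_on {0..1} \<phi>" "\<phi> \<in> {0..1} \<rightarrow> {0..1}"
    and \<psi>: "continuous_on {0..1} \<psi>" "\<psi> \<in> {0..1} \<rightarrow> {0..1}"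
    and ends: "\<phi> 0 = \<psi> 0" "\<phi> 1 = \<psi> 1" "p (\<phi> 0) = x0" "p (\<phi> 1) = x0"
  shows "loop_homotopic X x0 (p \<circ> \<phi>) (p \<circ> \<psi>)"
proof (rule loop_homotopicI)
  let ?k = "\<lambda>(s, t). (1 - s) * \<phi> t + s * \<psi> t"
  have cs: "continuous_on ({0..1::real} \<times> {0..1}) (\<lambda>z. \<theta> (snd z))" if "continuous_on {0..1} \<theta>" for \<theta> :: "real \<Rightarrow> real"
    by (rule continuous_on_compose2[OF that]) (auto intro: continuous_intros)
  have "continuous_map (top_of_set ({0..1} \<times> {0..1})) (top_of_set {0..1}) ?k"
  proof (rule continuous_map_top_of_setI)
    show "continuous_on ({0..1} \<times> {0..1}) ?k"
      unfolding case_prod_beta by (intro continuous_intros cs \<phi> \<psi>)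
    have "(1 - s) * \<phi> t + s * \<psi> t \<in> {0..1}" if "s \<in> {0..1}" "t \<in> {0..1}" for s t
      using convexD[of "{0..1::real}" "\<phi> t" "\<psi> t" "1 - s" s] \<phi>(2) \<psi>(2) that
      by (simp add: Pi_iff)
    then show "?k \<in> {0..1} \<times> {0..1} \<rightarrow> {0..1}"
      by auto
  qed
  then show "continuous_map (top_of_set ({0..1} \<times> {0..1})) X (p \<circ> ?k)"
    using p continuous_map_compose unfolding pathin_def by blast
qed (use ends in \<open>auto simp: algebra_simps\<close>)

lemma pathin_path_concat:
  assumes "pathin X p" "pathin X q" "p 1 = q 0"
  shows "pathin X (path_concat p q)"
  unfolding pathin_def path_concat_def
proof (rule continuous_map_cases_le)
  have sub: "subtopology (top_of_set {0..1}) {x. x \<in> topspace (top_of_set {0..1}) \<and> P x} = top_of_set {x\<in>{0..1::real}. P x}" for P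
    by (auto simp: subtopology_subtopology intro!: arg_cong[where f = top_of_set])
  show "continuous_map (subtopology (top_of_set {0..1}) {x \<in> topspace (top_of_set {0..1}). x \<le> 1/2}) X (\<lambda>t. p (2 * t))"
    unfolding sub using assms(1) unfolding pathin_def
    by (rule continuous_map_compose[where g = p, unfolded o_def, rotated])
       (auto intro!: continuous_map_top_of_setI continuous_intros)
  show "continuous_map (subtopology (top_of_set {0..1}) {x \<in> topspace (top_of_set {0..1}). 1/2 \<le> x}) X (\<lambda>t. q (2 * t - 1))"
    unfolding sub using assms(2) unfolding pathin_def
    by (rule continuous_map_compose[where g = q, unfolded o_def, rotated])
       (auto intro!: continuous_map_top_of_setI continuous_intros)
qed (use assms(3) in \<open>auto intro: continuous_intros simp del: eq_divide_eq_numeral1\<close>)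

lemma path_concat_ends [simp]: "path_concat p q 0 = p 0" "path_concat p q 1 = q 1"
  by (auto simp: path_concat_def)

lemma based_loops_path_concat:
  "\<lbrakk>p \<in> based_loops X x0; q \<in> based_loops X x0\<rbrakk> \<Longrightarrow> path_concat p q \<in> based_loops X x0"
  by (auto simp: based_loops_def intro: pathin_path_concat)

lemma loop_homotopic_path_concat:
  fixes X :: "'a topology"
  assumes "loop_homotopic X x0 p p'" "loop_homotopic X x0 q q'"
  shows "loop_homotopic X x0 (path_concat p q) (path_concat p' q')"
proof -
  obtain h :: "real \<times> real \<Rightarrow> 'a" where h: "continuous_map (top_of_set ({0..1} \<times> {0..1})) X h"
    "\<And>t. h (0, t) = p t" "\<And>t. h (1, t) = p' t"
    "\<And>s. s \<in> {0..1} \<Longrightarrow> h (s, 0) = x0" "\<And>s. s \<in> {0..1} \<Longrightarrow> h (s, 1) = x0"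
    by (rule loop_homotopicE[OF assms(1)]) (rule that)
  obtain k :: "real \<times> real \<Rightarrow> 'a" where k: "continuous_map (top_of_set ({0..1} \<times> {0..1})) X k"
    "\<And>t. k (0, t) = q t" "\<And>t. k (1, t) = q' t"
    "\<And>s. s \<in> {0..1} \<Longrightarrow> k (s, 0) = x0" "\<And>s. s \<in> {0..1} \<Longrightarrow> k (s, 1) = x0"
    by (rule loop_homotopicE[OF assms(2)]) (rule that)
  let ?Q = "{0..1::real} \<times> {0..1::real}"
  let ?H = "\<lambda>z. if snd z \<le> 1/2 then h (fst z, 2 * snd z) else k (fst z, 2 * snd z - 1)"
  have sub: "subtopology (top_of_set ?Q) {x. x \<in> topspace (top_of_set ?Q) \<and> P x} = top_of_set {x\<in>?Q. P x}" for P
    by (auto simp: subtopology_subtopology intro!: arg_cong[where f = top_of_set])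
  have "continuous_map (top_of_set ?Q) X ?H"
  proof (rule continuous_map_cases_le)
    show "continuous_map (subtopology (top_of_set ?Q) {x \<in> topspace (top_of_set ?Q). snd x \<le> 1/2}) X (\<lambda>z. h (fst z, 2 * snd z))"
      unfolding sub using h(1)
      by (rule continuous_map_compose[where g = h, unfolded o_def, rotated])
         (auto intro!: continuous_map_top_of_setI continuous_intros)
    show "continuous_map (subtopology (top_of_set ?Q) {x \<in> topspace (top_of_set ?Q). 1/2 \<le> snd x}) X (\<lambda>z. k (fst z, 2 * snd z - 1))"
      unfolding sub using k(1)
      by (rule continuous_map_compose[where g = k, unfolded o_def, rotated])
         (auto intro!: continuous_map_top_of_setI continuous_intros)
  qed (auto intro!: continuous_intros simp: h k simp del: eq_divide_eq_numeral1)
  then show ?thesis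
    by (rule loop_homotopicI) (auto simp: h k path_concat_def)
qed

lemma pathin_reverse: "pathin X p \<Longrightarrow> pathin X (\<lambda>t. p (1 - t))"
  unfolding pathin_def
  by (rule continuous_map_compose[where g = p, unfolded o_def, rotated])
     (auto intro!: continuous_map_top_of_setI continuous_intros)

lemma based_loops_reverse: "p \<in> based_loops X x0 \<Longrightarrow> (\<lambda>t. p (1 - t)) \<in> based_loops X x0"
  by (auto simp: based_loops_def intro: pathin_reverse)

lemma based_loops_const: "x0 \<in> topspace X \<Longrightarrow> (\<lambda>t. x0) \<in> based_loops X x0"
  by (auto simp: based_loops_def pathin_def)

lemma loop_homotopic_assoc:
  assumes "p \<in> based_loops X x0" "q \<in> based_loops X x0" "r \<in> based_loops X x0"
  shows "loop_homotopic X x0 (path_concat (path_concat p q) r) (path_concat p (path_concat q r))"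
proof -
  let ?w = "path_concat p (path_concat q r)"
  \<comment> \<open>The breakpoints 1/4 and 1/2 of the left bracketing go to the breakpoints 1/2 and 3/4 of the
    right one.\<close>
  let ?\<phi> = "\<lambda>t::real. if t \<le> 1/4 then 2 * t else if t \<le> 1/2 then t + 1/4 else t / 2 + 1/2"
  have w: "?w \<in> based_loops X x0"
    by (intro based_loops_path_concat assms)
  have "continuous_on {0..1} ?\<phi>"
    by (intro continuous_on_cases_le continuous_intros) auto
  then have "loop_homotopic X x0 (?w \<circ> ?\<phi>) (?w \<circ> (\<lambda>t. t))"
    using w by (intro loop_homotopic_reparametrize) (auto simp: based_loops_def)
  moreover have "?w \<circ> ?\<phi> = path_concat (path_concat p q) r"
    by (auto simp: path_concat_def fun_eq_iff algebra_simps)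
  ultimately show ?thesis
    by (simp add: o_def)
qed

lemma loop_homotopic_const_left:
  assumes "p \<in> based_loops X x0"
  shows "loop_homotopic X x0 (path_concat (\<lambda>t. x0) p) p"
proof -
  have "loop_homotopic X x0 (p \<circ> (\<lambda>t. max 0 (2 * t - 1))) (p \<circ> (\<lambda>t. t))"
    using assms by (intro loop_homotopic_reparametrize continuous_intros) (auto simp: based_loops_def)
  moreover have "p \<circ> (\<lambda>t. max 0 (2 * t - 1)) = path_concat (\<lambda>t. x0) p"
    using assms by (auto simp: path_concat_def fun_eq_iff based_loops_def max_def intro!: arg_cong[where f = p])
  ultimately show ?thesis
    by (simp add: o_def)
qed

lemma loop_homotopic_reverse:
  assumes "p \<in> based_loops X x0"
  shows "loop_homotopic X x0 (path_concat (\<lambda>t. p (1 - t)) p) (\<lambda>t. x0)"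
proof -
  have "loop_homotopic X x0 (p \<circ> (\<lambda>t. \<bar>2 * t - 1\<bar>)) (p \<circ> (\<lambda>t. 1))"
    using assms by (intro loop_homotopic_reparametrize continuous_intros) (auto simp: based_loops_def)
  moreover have "p \<circ> (\<lambda>t. \<bar>2 * t - 1\<bar>) = path_concat (\<lambda>t. p (1 - t)) p"
    using assms by (auto simp: path_concat_def fun_eq_iff based_loops_def abs_if intro!: arg_cong[where f = p])
  ultimately show ?thesis
    using assms by (simp add: o_def based_loops_def)
qed

lemma carrier_pi1: "carrier (pi1 X x0) = loop_class X x0 ` based_loops X x0"
  by (simp add: pi1_def)

lemma one_pi1: "\<one>\<^bsub>pi1 X x0\<^esub> = loop_class X x0 (\<lambda>t. x0)"
  by (simp add: pi1_def)

lemma mult_pi1: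
  assumes "p \<in> based_loops X x0" "q \<in> based_loops X x0"
  shows "loop_class X x0 p \<otimes>\<^bsub>pi1 X x0\<^esub> loop_class X x0 q = loop_class X x0 (path_concat p q)"
proof -
  have *: "loop_class X x0 (path_concat p' q') = loop_class X x0 (path_concat p q)"
    if "loop_homotopic X x0 p p'" "loop_homotopic X x0 q q'" for p' q'
    using loop_class_eq_iff[OF based_loops_path_concat[OF assms]] loop_homotopic_path_concat[OF that]
    by blast
  have "p \<in> loop_class X x0 p" "q \<in> loop_class X x0 q"
    using assms by (simp_all only: mem_loop_class loop_homotopic_refl)
  then show ?thesis
    unfolding pi1_def monoid.simps by (rule UN2_eq_const) (rule *; simp only: mem_loop_class)
qed

theorem group_pi1:
  assumes "x0 \<in> topspace X"
  shows "group (pi1 X x0)"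
proof (rule groupI)
  note bl = based_loops_path_concat based_loops_const[OF assms] based_loops_reverse
  show "\<one>\<^bsub>pi1 X x0\<^esub> \<in> carrier (pi1 X x0)"
    by (auto simp: carrier_pi1 one_pi1 bl)
  fix a b c
  assume a: "a \<in> carrier (pi1 X x0)"
  then obtain p where p: "p \<in> based_loops X x0" "a = loop_class X x0 p"
    by (auto simp: carrier_pi1)
  show "\<one>\<^bsub>pi1 X x0\<^esub> \<otimes>\<^bsub>pi1 X x0\<^esub> a = a"
    using p by (simp add: one_pi1 mult_pi1 bl loop_class_eq_iff loop_homotopic_const_left)
  show "\<exists>y\<in>carrier (pi1 X x0). y \<otimes>\<^bsub>pi1 X x0\<^esub> a = \<one>\<^bsub>pi1 X x0\<^esub>"
    using p by (intro bexI[of _ "loop_class X x0 (\<lambda>t. p (1 - t))"])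
      (auto simp: one_pi1 mult_pi1 bl loop_class_eq_iff loop_homotopic_reverse carrier_pi1)
  assume "b \<in> carrier (pi1 X x0)"
  then obtain q where q: "q \<in> based_loops X x0" "b = loop_class X x0 q"
    by (auto simp: carrier_pi1)
  show "a \<otimes>\<^bsub>pi1 X x0\<^esub> b \<in> carrier (pi1 X x0)"
    using p q by (auto simp: mult_pi1 bl carrier_pi1)
  assume "c \<in> carrier (pi1 X x0)"
  then obtain r where r: "r \<in> based_loops X x0" "c = loop_class X x0 r"
    by (auto simp: carrier_pi1)
  show "a \<otimes>\<^bsub>pi1 X x0\<^esub> b \<otimes>\<^bsub>pi1 X x0\<^esub> c = a \<otimes>\<^bsub>pi1 X x0\<^esub> (b \<otimes>\<^bsub>pi1 X x0\<^esub> c)"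
    using p q r by (simp add: mult_pi1 bl loop_class_eq_iff loop_homotopic_assoc)
qed

lemma inv_pi1:
  assumes "p \<in> based_loops X x0" "x0 \<in> topspace X"
  shows "inv\<^bsub>pi1 X x0\<^esub> (loop_class X x0 p) = loop_class X x0 (\<lambda>t. p (1 - t))"
proof -
  interpret group "pi1 X x0"
    by (rule group_pi1[OF assms(2)])
  show ?thesis
    using assms
    by (intro inv_equality)
      (auto simp: one_pi1 mult_pi1 based_loops_path_concat based_loops_reverse loop_class_eq_iff loop_homotopic_reverse carrier_pi1)
qed

lemma based_loops_compose:
  assumes "continuous_map X Y f" "p \<in> based_loops X x0"
  shows "f \<circ> p \<in> based_loops Y (f x0)"
  using assms by (auto simp: based_loops_def pathin_def intro: continuous_map_compose)

lemma loop_homotopic_compose: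
  assumes "continuous_map X Y f" "loop_homotopic X x0 p q"
  shows "loop_homotopic Y (f x0) (f \<circ> p) (f \<circ> q)"
  using assms(2,1) by (rule homotopic_with_compose_continuous_map_left) auto

lemma pi1_map_class:
  assumes "continuous_map X Y f" "p \<in> based_loops X x0" "f x0 = y0"
  shows "pi1_map Y y0 f (loop_class X x0 p) = loop_class Y y0 (f \<circ> p)"
proof -
  have *: "loop_class Y y0 (f \<circ> q) = loop_class Y y0 (f \<circ> p)" if "loop_homotopic X x0 p q" for q
    using loop_class_eq_iff[OF based_loops_compose[OF assms(1,2)]] loop_homotopic_compose[OF assms(1) that]
    unfolding assms(3) by blast
  have "p \<in> loop_class X x0 p"
    using assms by (simp only: mem_loop_class loop_homotopic_refl)
  then have "loop_class X x0 p \<noteq> {}"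
    by blast
  then show ?thesis
    unfolding pi1_map_def by (rule SUP_eq_const) (rule *; simp only: mem_loop_class)
qed

lemma pi1_map_hom:
  assumes "continuous_map X Y f" "f x0 = y0"
  shows "pi1_map Y y0 f \<in> hom (pi1 X x0) (pi1 Y y0)"
proof (rule homI)
  note bl = based_loops_path_concat based_loops_compose[OF assms(1), of _ x0, unfolded assms(2)]
  fix a assume "a \<in> carrier (pi1 X x0)"
  then obtain p where p: "p \<in> based_loops X x0" "a = loop_class X x0 p"
    by (auto simp: carrier_pi1)
  show "pi1_map Y y0 f a \<in> carrier (pi1 Y y0)"
    using p by (auto simp: pi1_map_class[OF assms(1) _ assms(2)] carrier_pi1 bl)
  fix b assume "b \<in> carrier (pi1 X x0)"
  then obtain q where q: "q \<in> based_loops X x0" "b = loop_class X x0 q"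
    by (auto simp: carrier_pi1)
  have "f \<circ> path_concat p q = path_concat (f \<circ> p) (f \<circ> q)"
    by (auto simp: path_concat_def)
  then show "pi1_map Y y0 f (a \<otimes>\<^bsub>pi1 X x0\<^esub> b) = pi1_map Y y0 f a \<otimes>\<^bsub>pi1 Y y0\<^esub> pi1_map Y y0 f b"
    using p q by (simp add: pi1_map_class[OF assms(1) _ assms(2)] mult_pi1 bl)
qed

section \<open>Metric spaces and the pseudo-metric on the fundamental group\<close>

text \<open>
  The Heine--Cantor theorem. Every path and every homotopy below is handled through this uniform
  modulus of continuity, since lifts are built on finite subdivisions.
\<close>

lemma continuous_map_compact_metric_iff:
  fixes K :: "'k::metric_space set"
  assumes "Metric_space M d" "compact K"
  shows "continuous_map (top_of_set K) (Metric_space.mtopology M d) f \<longleftrightarrow>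
    f \<in> K \<rightarrow> M \<and> (\<forall>\<epsilon>>0. \<exists>\<delta>>0. \<forall>x\<in>K. \<forall>y\<in>K. dist x y < \<delta> \<longrightarrow> d (f x) (f y) < \<epsilon>)"
proof -
  interpret Metric_space M d by fact
  let ?K = "submetric euclidean_metric K"
  have K: "mtopology_of ?K = top_of_set K"
    by (simp add: mtopology_of_submetric)
  have "compact_space (top_of_set K)"
    using assms(2) by (simp add: compact_space_subtopology)
  then have "continuous_map (top_of_set K) mtopology f \<longleftrightarrow> uniformly_continuous_map ?K (metric (M,d)) f"
    using continuous_eq_uniformly_continuous_map[of ?K "metric (M,d)" f] K
    by (simp add: mtopology_of_def)
  also have "\<dots> \<longleftrightarrow> f \<in> K \<rightarrow> M \<and> (\<forall>\<epsilon>>0. \<exists>\<delta>>0. \<forall>x\<in>K. \<forall>y\<in>K. dist x y < \<delta> \<longrightarrow> d (f x) (f y) < \<epsilon>)"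
    by (auto simp: uniformly_continuous_map_def commute dist_commute)
  finally show ?thesis .
qed

context Metric_space
begin

lemma pathin_iff:
  "pathin mtopology p \<longleftrightarrow> p \<in> {0..1} \<rightarrow> M \<and>
    (\<forall>\<epsilon>>0. \<exists>\<delta>>0. \<forall>s\<in>{0..1}. \<forall>t\<in>{0..1}. \<bar>s - t\<bar> < \<delta> \<longrightarrow> d (p s) (p t) < \<epsilon>)"
  unfolding pathin_def by (simp add: continuous_map_compact_metric_iff[OF Metric_space_axioms] dist_real_def)

context
  fixes x0 assumes base: "x0 \<in> M"
begin

abbreviation "pi1M \<equiv> metric_pi1 M d x0"

interpretation P: group pi1M
  by (rule group_pi1) (simp add: base)

definition ball_conjugates :: "real \<Rightarrow> (real \<Rightarrow> 'a) set set" where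
  "ball_conjugates \<epsilon> = {loop_class mtopology x0 c \<otimes>\<^bsub>pi1M\<^esub> loop_class mtopology x0 \<gamma> \<otimes>\<^bsub>pi1M\<^esub> inv\<^bsub>pi1M\<^esub> loop_class mtopology x0 c | c \<gamma>.
     c \<in> based_loops mtopology x0 \<and> \<gamma> \<in> based_loops mtopology x0 \<and> \<gamma> ` {0..1} \<subseteq> mcball x0 \<epsilon>}"

lemma ball_conjugates_carrier: "ball_conjugates \<epsilon> \<subseteq> carrier pi1M"
  by (auto simp: ball_conjugates_def carrier_pi1[symmetric] intro!: P.m_closed P.inv_closed) (auto simp: carrier_pi1)

text \<open>
  A conjugate of a loop in the ball is inverted by reversing that loop, which stays in the ball.
  Hence the subgroup generated by these conjugates consists of their products alone.
\<close>

lemma ball_conjugates_inv: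
  assumes "h \<in> ball_conjugates \<epsilon>" shows "inv\<^bsub>pi1M\<^esub> h \<in> ball_conjugates \<epsilon>"
proof -
  obtain c \<gamma> where h: "h = loop_class mtopology x0 c \<otimes>\<^bsub>pi1M\<^esub> loop_class mtopology x0 \<gamma> \<otimes>\<^bsub>pi1M\<^esub> inv\<^bsub>pi1M\<^esub> loop_class mtopology x0 c"
    and c: "c \<in> based_loops mtopology x0" and \<gamma>: "\<gamma> \<in> based_loops mtopology x0" "\<gamma> ` {0..1} \<subseteq> mcball x0 \<epsilon>"
    using assms by (auto simp: ball_conjugates_def)
  have carr: "loop_class mtopology x0 c \<in> carrier pi1M" "loop_class mtopology x0 \<gamma> \<in> carrier pi1M"
    using c \<gamma> by (auto simp: carrier_pi1)
  have "inv\<^bsub>pi1M\<^esub> h = loop_class mtopology x0 c \<otimes>\<^bsub>pi1M\<^esub> inv\<^bsub>pi1M\<^esub> loop_class mtopology x0 \<gamma> \<otimes>\<^bsub>pi1M\<^esub> inv\<^bsub>pi1M\<^esub> loop_class mtopology x0 c"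
    unfolding h using carr by (simp add: P.inv_mult_group P.m_assoc)
  also have "inv\<^bsub>pi1M\<^esub> loop_class mtopology x0 \<gamma> = loop_class mtopology x0 (\<lambda>t. \<gamma> (1 - t))"
    using \<gamma>(1) base by (simp add: inv_pi1)
  finally have inv: "inv\<^bsub>pi1M\<^esub> h = loop_class mtopology x0 c \<otimes>\<^bsub>pi1M\<^esub> loop_class mtopology x0 (\<lambda>t. \<gamma> (1 - t)) \<otimes>\<^bsub>pi1M\<^esub> inv\<^bsub>pi1M\<^esub> loop_class mtopology x0 c" .
  have "(\<lambda>t. \<gamma> (1 - t)) ` {0..1} \<subseteq> mcball x0 \<epsilon>"
  proof (rule image_subsetI)
    fix t :: real assume "t \<in> {0..1}"
    then have "1 - t \<in> {0..1}"
      by simp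
    then show "\<gamma> (1 - t) \<in> mcball x0 \<epsilon>"
      using \<gamma>(2) by blast
  qed
  then show ?thesis
    unfolding ball_conjugates_def inv using c based_loops_reverse[OF \<gamma>(1)] by blast
qed

lemma pi1_ball_subgroup_eq_generate:
  "pi1_ball_subgroup M d x0 \<epsilon> = generate pi1M (ball_conjugates \<epsilon>)"
proof -
  let ?c = "\<lambda>(c, \<gamma>). loop_class mtopology x0 c \<otimes>\<^bsub>pi1M\<^esub> loop_class mtopology x0 \<gamma> \<otimes>\<^bsub>pi1M\<^esub> inv\<^bsub>pi1M\<^esub> loop_class mtopology x0 c"
  let ?L = "\<lambda>ps. \<forall>(c, \<gamma>)\<in>set ps. c \<in> based_loops mtopology x0 \<and> \<gamma> \<in> based_loops mtopology x0 \<and> \<gamma> ` {0..1} \<subseteq> mcball x0 \<epsilon>"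
  let ?f = "\<lambda>ps. foldr (\<otimes>\<^bsub>pi1M\<^esub>) (map ?c ps) \<one>\<^bsub>pi1M\<^esub>"
  have L: "pi1_ball_subgroup M d x0 \<epsilon> = {?f ps | ps. ?L ps}"
    by (simp add: pi1_ball_subgroup_def Let_def)
  have c: "?c cg \<in> ball_conjugates \<epsilon>" if "?L [cg]" for cg
    using that unfolding ball_conjugates_def by fastforce
  have 1: "?f ps \<in> generate pi1M (ball_conjugates \<epsilon>)" if "?L ps" for ps
    using that
  proof (induction ps)
    case (Cons cg ps)
    then show ?case
      using generate.eng[OF generate.incl[OF c], of cg "?f ps"] by auto
  qed (auto intro: generate.one)
  have 2: "\<exists>ps. g = ?f ps \<and> ?L ps" if "g \<in> generate pi1M (ball_conjugates \<epsilon>)" for g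
    using that
  proof (induction rule: generate.induct)
    case one
    show ?case by (intro exI[of _ "[]"]) auto
  next
    case (incl h)
    then obtain cg where cg: "?L [cg]" "h = ?c cg"
      unfolding ball_conjugates_def by fastforce
    moreover have "?c cg \<in> carrier pi1M"
      using c[OF cg(1)] ball_conjugates_carrier by blast
    ultimately have "h = ?f [cg] \<and> ?L [cg]"
      by simp
    then show ?case
      by blast
  next
    case (inv h)
    then have "inv\<^bsub>pi1M\<^esub> h \<in> ball_conjugates \<epsilon>"
      by (rule ball_conjugates_inv)
    then obtain cg where cg: "?L [cg]" "inv\<^bsub>pi1M\<^esub> h = ?c cg"
      unfolding ball_conjugates_def by fastforce
    moreover have "?c cg \<in> carrier pi1M"
      using c[OF cg(1)] ball_conjugates_carrier by blast
    ultimately have "inv\<^bsub>pi1M\<^esub> h = ?f [cg] \<and> ?L [cg]"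
      by simp
    then show ?case
      by blast
  next
    case (eng h1 h2)
    then obtain ps qs where ps: "h1 = ?f ps" "?L ps" and qs: "h2 = ?f qs" "?L qs"
      by blast
    have carr: "?f ps \<in> carrier pi1M" if "?L ps" for ps
      using 1[OF that] P.generate_in_carrier[OF ball_conjugates_carrier] by blast
    have app: "?f (ps @ qs) = ?f ps \<otimes>\<^bsub>pi1M\<^esub> ?f qs"
      using ps(2)
    proof (induction ps)
      case Nil
      then show ?case using carr[OF qs(2)] by simp
    next
      case (Cons cg ps)
      then have "?c cg \<in> carrier pi1M" "?f ps \<in> carrier pi1M"
        using c[of cg] ball_conjugates_carrier carr[of ps] by auto
      then show ?case using Cons carr[OF qs(2)] by (simp add: P.m_assoc)
    qed
    have "?L (ps @ qs)"
      using ps(2) qs(2) by (simp only: set_append ball_Un)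
    then show ?case
      unfolding ps(1) qs(1) by (intro exI[of _ "ps @ qs"] conjI app[symmetric])
  qed
  show ?thesis
    unfolding L
  proof (intro subset_antisym subsetI)
    fix g assume "g \<in> {?f ps | ps. ?L ps}"
    then obtain ps where ps: "g = ?f ps" "?L ps"
      unfolding mem_Collect_eq by (elim exE conjE) (rule that)
    show "g \<in> generate pi1M (ball_conjugates \<epsilon>)"
      unfolding ps(1) by (rule 1[OF ps(2)])
  qed (unfold mem_Collect_eq, rule 2)
qed

lemma subgroup_pi1_ball_subgroup: "subgroup (pi1_ball_subgroup M d x0 \<epsilon>) pi1M"
  unfolding pi1_ball_subgroup_eq_generate by (rule P.generate_is_subgroup[OF ball_conjugates_carrier])

lemma loop_class_in_pi1_ball_subgroup:
  assumes "\<gamma> \<in> based_loops mtopology x0" "\<gamma> ` {0..1} \<subseteq> mcball x0 \<epsilon>"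
  shows "loop_class mtopology x0 \<gamma> \<in> pi1_ball_subgroup M d x0 \<epsilon>"
proof -
  have "loop_class mtopology x0 \<gamma> \<in> carrier pi1M"
    using assms by (auto simp: carrier_pi1)
  then have "loop_class mtopology x0 \<gamma> = loop_class mtopology x0 (\<lambda>t. x0) \<otimes>\<^bsub>pi1M\<^esub> loop_class mtopology x0 \<gamma> \<otimes>\<^bsub>pi1M\<^esub> inv\<^bsub>pi1M\<^esub> loop_class mtopology x0 (\<lambda>t. x0)"
    by (simp add: one_pi1[symmetric])
  moreover have "(\<lambda>t. x0) \<in> based_loops mtopology x0"
    by (simp add: base based_loops_const)
  ultimately show ?thesis
    unfolding pi1_ball_subgroup_eq_generate using assms
    by (intro generate.incl) (auto simp: ball_conjugates_def)
qed

lemma pi1_ball_subgroup_mono: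
  assumes "\<epsilon> \<le> \<delta>" shows "pi1_ball_subgroup M d x0 \<epsilon> \<subseteq> pi1_ball_subgroup M d x0 \<delta>"
proof -
  have "ball_conjugates \<epsilon> \<subseteq> ball_conjugates \<delta>"
    unfolding ball_conjugates_def using mcball_subset_concentric[OF assms] by blast
  then show ?thesis
    unfolding pi1_ball_subgroup_eq_generate by (rule P.mono_generate)
qed

text \<open>
  A loop has compact image, so it lies in some ball. Thus the infimum that defines the length
  ranges over a nonempty set, and lengths are not default values.
\<close>

lemma pi1_ball_subgroup_exhausts:
  assumes "g \<in> carrier pi1M" obtains \<epsilon> where "\<epsilon> > 0" "g \<in> pi1_ball_subgroup M d x0 \<epsilon>"
proof -
  obtain \<gamma> where \<gamma>: "\<gamma> \<in> based_loops mtopology x0" "g = loop_class mtopology x0 \<gamma>"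
    using assms by (auto simp: carrier_pi1)
  have "compactin mtopology (\<gamma> ` {0..1})"
    using \<gamma>(1) by (intro image_compactin[of "top_of_set {0..1}"]) (auto simp: based_loops_def pathin_def compactin_subtopology)
  then have "mbounded (\<gamma> ` {0..1})"
    by (rule compactin_imp_mbounded)
  then obtain R where R: "R > 0" "\<And>s t. \<lbrakk>s \<in> {0..1}; t \<in> {0..1}\<rbrakk> \<Longrightarrow> d (\<gamma> s) (\<gamma> t) \<le> R" "\<gamma> ` {0..1} \<subseteq> M"
    unfolding mbounded_alt_pos by blast
  then have "\<gamma> ` {0..1} \<subseteq> mcball x0 R"
    using R(2)[of 0] \<gamma>(1) base by (auto simp: based_loops_def)
  then show ?thesis
    using loop_class_in_pi1_ball_subgroup[OF \<gamma>(1)] R(1) \<gamma>(2) that by blast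
qed

lemma pi1_length_nonneg:
  assumes "g \<in> carrier pi1M" shows "0 \<le> pi1_length M d x0 g"
  unfolding pi1_length_def using pi1_ball_subgroup_exhausts[OF assms] by (intro cInf_greatest) auto

lemma pi1_length_le:
  assumes "g \<in> pi1_ball_subgroup M d x0 \<epsilon>" "0 < \<epsilon>" shows "pi1_length M d x0 g \<le> \<epsilon>"
  unfolding pi1_length_def using assms by (intro cInf_lower bdd_belowI[of _ 0]) auto

lemma pi1_length_less:
  assumes "g \<in> carrier pi1M" "pi1_length M d x0 g < \<epsilon>" shows "g \<in> pi1_ball_subgroup M d x0 \<epsilon>"
proof -
  obtain \<delta> where "\<delta> < \<epsilon>" "g \<in> pi1_ball_subgroup M d x0 \<delta>"
    using assms pi1_ball_subgroup_exhausts[OF assms(1)] unfolding pi1_length_def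
    by (subst (asm) cInf_less_iff) (auto intro: bdd_belowI[of _ 0])
  then show ?thesis
    using pi1_ball_subgroup_mono[of \<delta> \<epsilon>] by auto
qed

text \<open>
  The length is ultrametric because the subgroups grow with the radius: two elements lie in
  a common one as soon as the radius exceeds both lengths.
\<close>

lemma pi1_length_mult:
  assumes "g \<in> carrier pi1M" "h \<in> carrier pi1M"
  shows "pi1_length M d x0 (g \<otimes>\<^bsub>pi1M\<^esub> h) \<le> max (pi1_length M d x0 g) (pi1_length M d x0 h)"
proof (rule dense_ge)
  fix \<epsilon> assume \<epsilon>: "max (pi1_length M d x0 g) (pi1_length M d x0 h) < \<epsilon>"
  then have "g \<otimes>\<^bsub>pi1M\<^esub> h \<in> pi1_ball_subgroup M d x0 \<epsilon>"
    using assms by (intro subgroup.m_closed[OF subgroup_pi1_ball_subgroup] pi1_length_less) auto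
  then show "pi1_length M d x0 (g \<otimes>\<^bsub>pi1M\<^esub> h) \<le> \<epsilon>"
    using \<epsilon> pi1_length_nonneg[OF assms(1)] by (intro pi1_length_le) auto
qed

lemma pi1_length_inv:
  assumes "g \<in> carrier pi1M"
  shows "pi1_length M d x0 (inv\<^bsub>pi1M\<^esub> g) = pi1_length M d x0 g"
proof -
  have "inv\<^bsub>pi1M\<^esub> g \<in> pi1_ball_subgroup M d x0 \<epsilon> \<longleftrightarrow> g \<in> pi1_ball_subgroup M d x0 \<epsilon>" for \<epsilon>
    using subgroup.m_inv_closed[OF subgroup_pi1_ball_subgroup] assms by (metis P.inv_inv)
  then show ?thesis
    by (simp add: pi1_length_def)
qed

lemma pi1_length_one: "pi1_length M d x0 \<one>\<^bsub>pi1M\<^esub> = 0"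
proof (rule antisym)
  show "pi1_length M d x0 \<one>\<^bsub>pi1M\<^esub> \<le> 0"
    by (rule dense_ge) (intro pi1_length_le subgroup.one_closed[OF subgroup_pi1_ball_subgroup])
qed (simp add: pi1_length_nonneg)

lemma pi1_dist_eq: "pi1_dist M d x0 g h = pi1_length M d x0 (inv\<^bsub>pi1M\<^esub> g \<otimes>\<^bsub>pi1M\<^esub> h)"
  by (simp add: pi1_dist_def Let_def)

lemma metric_group_pi1: "metric_group pi1M (pi1_dist M d x0)"
  unfolding metric_group_def
proof (intro conjI ballI)
  show "group pi1M" by (rule P.is_group)
  fix x y z assume x: "x \<in> carrier pi1M" and y: "y \<in> carrier pi1M"
  show "pi1_dist M d x0 x x = 0"
    using x by (simp add: pi1_dist_eq pi1_length_one)
  show "0 \<le> pi1_dist M d x0 x y"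
    using x y by (simp add: pi1_dist_eq pi1_length_nonneg)
  show "pi1_dist M d x0 x y = pi1_dist M d x0 y x"
    using x y pi1_length_inv[of "inv\<^bsub>pi1M\<^esub> x \<otimes>\<^bsub>pi1M\<^esub> y"] by (simp add: pi1_dist_eq P.inv_mult_group)
  assume z: "z \<in> carrier pi1M"
  have "inv\<^bsub>pi1M\<^esub> x \<otimes>\<^bsub>pi1M\<^esub> z = (inv\<^bsub>pi1M\<^esub> x \<otimes>\<^bsub>pi1M\<^esub> y) \<otimes>\<^bsub>pi1M\<^esub> (inv\<^bsub>pi1M\<^esub> y \<otimes>\<^bsub>pi1M\<^esub> z)"
    using x y z by (simp add: P.m_assoc P.inv_solve_left' flip: P.m_assoc[of y "inv\<^bsub>pi1M\<^esub> y"])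
  then show "pi1_dist M d x0 x z \<le> pi1_dist M d x0 x y + pi1_dist M d x0 y z"
    using pi1_length_mult[of "inv\<^bsub>pi1M\<^esub> x \<otimes>\<^bsub>pi1M\<^esub> y" "inv\<^bsub>pi1M\<^esub> y \<otimes>\<^bsub>pi1M\<^esub> z"]
      pi1_length_nonneg[of "inv\<^bsub>pi1M\<^esub> x \<otimes>\<^bsub>pi1M\<^esub> y"] pi1_length_nonneg[of "inv\<^bsub>pi1M\<^esub> y \<otimes>\<^bsub>pi1M\<^esub> z"] x y z
    by (simp add: pi1_dist_eq)
next
  fix g x y assume "g \<in> carrier pi1M" "x \<in> carrier pi1M" "y \<in> carrier pi1M"
  moreover from this have "inv\<^bsub>pi1M\<^esub> (g \<otimes>\<^bsub>pi1M\<^esub> x) \<otimes>\<^bsub>pi1M\<^esub> (g \<otimes>\<^bsub>pi1M\<^esub> y) = inv\<^bsub>pi1M\<^esub> x \<otimes>\<^bsub>pi1M\<^esub> y"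
    by (simp add: P.inv_mult_group P.m_assoc flip: P.m_assoc[of "inv\<^bsub>pi1M\<^esub> g" g])
  ultimately show "pi1_dist M d x0 (g \<otimes>\<^bsub>pi1M\<^esub> x) (g \<otimes>\<^bsub>pi1M\<^esub> y) = pi1_dist M d x0 x y"
    by (simp add: pi1_dist_eq)
qed

end

end

section \<open>Quotients by ultrametric abelian groups\<close>

text \<open>
  The setting of a metric space \<open>X\<close> with a free action of an ultrametric abelian group \<open>A\<close> and
  quotient \<open>p : X \<rightarrow> Y\<close>. The metric of \<open>Y\<close> is the distance of orbits, and \<open>p_lift\<close> demands that this
  distance is attained from every starting point. Completeness of \<open>X\<close> is there for the existence
  of lifts, and \<open>geodesic\<close> for loops with prescribed endpoint of the lift and controlled size.
\<close>

locale ultrametric_quotient =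
  X: Metric_space X dX + Y: Metric_space Y dY + A: comm_group A
  for X :: "'x set" and dX and Y :: "'y set" and dY and A :: "('a, 'm) monoid_scheme" (structure) +
  fixes dA :: "'a \<Rightarrow> 'a \<Rightarrow> real" and act :: "'a \<Rightarrow> 'x \<Rightarrow> 'x" and p :: "'x \<Rightarrow> 'y" and x0 :: 'x
  assumes base: "x0 \<in> X"
    and complete: "X.mcomplete"
    and ultrametric: "ultrametric_on (carrier A) dA"
    and act_closed: "\<lbrakk>a \<in> carrier A; x \<in> X\<rbrakk> \<Longrightarrow> act a x \<in> X"
    and act_one: "x \<in> X \<Longrightarrow> act \<one> x = x"
    and act_mult: "\<lbrakk>a \<in> carrier A; b \<in> carrier A; x \<in> X\<rbrakk> \<Longrightarrow> act (a \<otimes> b) x = act a (act b x)"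
    and act_isometry: "\<lbrakk>a \<in> carrier A; x \<in> X; y \<in> X\<rbrakk> \<Longrightarrow> dX (act a x) (act a y) = dX x y"
    and act_dist: "\<lbrakk>a \<in> carrier A; b \<in> carrier A; x \<in> X\<rbrakk> \<Longrightarrow> dX (act a x) (act b x) = dA a b"
    and act_free: "\<lbrakk>a \<in> carrier A; b \<in> carrier A; act a x0 = act b x0\<rbrakk> \<Longrightarrow> a = b"
    and p_closed: "x \<in> X \<Longrightarrow> p x \<in> Y"
    and p_dist: "\<lbrakk>x \<in> X; y \<in> X\<rbrakk> \<Longrightarrow> dY (p x) (p y) \<le> dX x y"
    and p_lift: "\<lbrakk>x \<in> X; z \<in> Y\<rbrakk> \<Longrightarrow> \<exists>x'\<in>X. p x' = z \<and> dX x x' = dY (p x) z"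
    and p_act: "\<lbrakk>a \<in> carrier A; x \<in> X\<rbrakk> \<Longrightarrow> p (act a x) = p x"
    and p_fibre: "\<lbrakk>x \<in> X; y \<in> X; p x = p y\<rbrakk> \<Longrightarrow> \<exists>a\<in>carrier A. y = act a x"
    and geodesic: "x \<in> X \<Longrightarrow> \<exists>v. pathin X.mtopology v \<and> v 0 = x0 \<and> v 1 = x \<and> v ` {0..1} \<subseteq> X.mcball x0 (dX x0 x)"
begin

lemma dA_ultra: "\<lbrakk>a \<in> carrier A; b \<in> carrier A; c \<in> carrier A\<rbrakk> \<Longrightarrow> dA a c \<le> max (dA a b) (dA b c)"
  using ultrametric by (auto simp: ultrametric_on_def)

lemma dA_nonneg: "\<lbrakk>a \<in> carrier A; b \<in> carrier A\<rbrakk> \<Longrightarrow> 0 \<le> dA a b"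
  using act_dist[OF _ _ base] X.nonneg by metis

lemma dA_commute: "\<lbrakk>a \<in> carrier A; b \<in> carrier A\<rbrakk> \<Longrightarrow> dA a b = dA b a"
  using act_dist[OF _ _ base] X.commute by metis

lemma dA_refl: "a \<in> carrier A \<Longrightarrow> dA a a = 0"
  using act_dist[OF _ _ base, of a a] by (simp add: act_closed base)

lemma dA_left_invariant:
  assumes "c \<in> carrier A" "a \<in> carrier A" "b \<in> carrier A"
  shows "dA (c \<otimes> a) (c \<otimes> b) = dA a b"
  using act_dist[of "c \<otimes> a" "c \<otimes> b" x0] act_dist[of a b x0] assms base
  by (simp add: act_mult act_isometry act_closed)

lemma dA_one_mult:
  assumes "a \<in> carrier A" "b \<in> carrier A" shows "dA \<one> (a \<otimes> b) \<le> max (dA \<one> a) (dA \<one> b)"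
  using dA_ultra[of \<one> a "a \<otimes> b"] dA_left_invariant[of a \<one> b] assms by simp

lemma dA_one_inv:
  assumes "a \<in> carrier A" shows "dA \<one> (inv a) = dA \<one> a"
  using dA_left_invariant[of a \<one> "inv a"] dA_commute[of a \<one>] assms by simp

lemma dA_one_eq_0:
  assumes "a \<in> carrier A" "dA \<one> a = 0" shows "a = \<one>"
proof -
  have "dX (act \<one> x0) (act a x0) = 0"
    using assms act_dist[OF _ _ base] by simp
  then have "act \<one> x0 = act a x0"
    using assms by (simp add: act_closed base)
  then show ?thesis
    using act_free assms by blast
qed

lemma metric_group_A: "metric_group A dA"
proof -
  have "dA x z \<le> dA x y + dA y z" if "x \<in> carrier A" "y \<in> carrier A" "z \<in> carrier A" for x y z
    using dA_ultra[OF that] dA_nonneg that by (smt (verit))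
  then show ?thesis
    unfolding metric_group_def
    by (auto simp: dA_refl dA_nonneg dA_left_invariant A.is_group intro: dA_commute)
qed

lemma p_dist_act: "\<lbrakk>x \<in> X; y \<in> X\<rbrakk> \<Longrightarrow> \<exists>a\<in>carrier A. dX x (act a y) = dY (p x) (p y)"
  using p_lift[of x "p y"] p_fibre p_closed by metis


subsection \<open>Lifting paths\<close>

text \<open>
  Paths that are continuous only up to jumps of size \<open>\<epsilon>\<close>. Such lifts can be written down by hand,
  and true lifts are obtained as their limits.
\<close>

definition coarse_path :: "real \<Rightarrow> (real \<Rightarrow> 'x) \<Rightarrow> bool" where
  "coarse_path \<epsilon> v \<longleftrightarrow> v \<in> {0..1} \<rightarrow> X \<and>
     (\<exists>\<delta>>0. \<forall>s\<in>{0..1}. \<forall>t\<in>{0..1}. \<bar>s - t\<bar> < \<delta> \<longrightarrow> dX (v s) (v t) \<le> \<epsilon>)"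

lemma coarse_path_mono: "\<lbrakk>coarse_path \<epsilon> v; \<epsilon> \<le> \<epsilon>'\<rbrakk> \<Longrightarrow> coarse_path \<epsilon>' v"
  unfolding coarse_path_def by (meson order_trans)

lemma pathin_iff_coarse_path: "pathin X.mtopology v \<longleftrightarrow> (\<forall>\<epsilon>>0. coarse_path \<epsilon> v)"
proof
  assume "pathin X.mtopology v"
  then show "\<forall>\<epsilon>>0. coarse_path \<epsilon> v"
    unfolding X.pathin_iff coarse_path_def by (meson less_imp_le)
next
  assume v: "\<forall>\<epsilon>>0. coarse_path \<epsilon> v"
  have "\<exists>\<delta>>0. \<forall>s\<in>{0..1}. \<forall>t\<in>{0..1}. \<bar>s - t\<bar> < \<delta> \<longrightarrow> dX (v s) (v t) < \<epsilon>" if "\<epsilon> > 0" for \<epsilon>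
  proof -
    obtain \<delta> where "\<delta> > 0" "\<And>s t. \<lbrakk>s \<in> {0..1}; t \<in> {0..1}; \<bar>s - t\<bar> < \<delta>\<rbrakk> \<Longrightarrow> dX (v s) (v t) \<le> \<epsilon> / 2"
      using v \<open>\<epsilon> > 0\<close> unfolding coarse_path_def by (metis half_gt_zero)
    moreover have "\<epsilon> / 2 < \<epsilon>"
      using \<open>\<epsilon> > 0\<close> by simp
    ultimately show ?thesis
      using le_less_trans by blast
  qed
  then show "pathin X.mtopology v"
    unfolding X.pathin_iff using v by (auto simp: coarse_path_def intro: zero_less_one)
qed

text \<open>
  In an ultrametric space, a chain of steps of length at most \<open>R\<close> never leaves the ball of radius
  \<open>R\<close> around its start, and any point of the interval is reached in finitely many short steps.
\<close>

lemma ultrametric_chain: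
  assumes a: "\<And>t. t \<in> {0..1} \<Longrightarrow> a t \<in> carrier A" and "\<delta> > 0"
    and jump: "\<And>s t. \<lbrakk>s \<in> {0..1}; t \<in> {0..1}; \<bar>s - t\<bar> < \<delta>\<rbrakk> \<Longrightarrow> dA (a s) (a t) \<le> R"
    and t: "t \<in> {0..1::real}"
  shows "dA (a 0) (a t) \<le> R"
proof -
  obtain n :: nat where n: "n > 0" "1 / n < \<delta>"
    using \<open>\<delta> > 0\<close> nat_approx_posE by (metis of_nat_Suc zero_less_Suc)
  define \<tau> where "\<tau> i = t * (real i / n)" for i
  have \<tau>: "\<tau> i \<in> {0..1}" if "i \<le> n" for i
    using t n that mult_mono[of t 1 "real i" "real n"] by (auto simp: \<tau>_def divide_le_eq)
  have "dA (a 0) (a (\<tau> i)) \<le> R" if "i \<le> n" for i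
    using that
  proof (induction i)
    case 0
    then show ?case using jump[of 0 0] \<open>\<delta> > 0\<close> by (simp add: \<tau>_def)
  next
    case (Suc i)
    have "\<tau> i - \<tau> (Suc i) = - t / n"
      using n by (simp add: \<tau>_def divide_simps) (simp add: algebra_simps)
    then have "\<bar>\<tau> i - \<tau> (Suc i)\<bar> \<le> 1 / n"
      using t n by (simp add: divide_right_mono)
    then have "dA (a (\<tau> i)) (a (\<tau> (Suc i))) \<le> R"
      using n Suc.prems by (intro jump \<tau>) auto
    moreover have "dA (a 0) (a (\<tau> i)) \<le> R"
      using Suc by simp
    moreover have "dA (a 0) (a (\<tau> (Suc i))) \<le> max (dA (a 0) (a (\<tau> i))) (dA (a (\<tau> i)) (a (\<tau> (Suc i))))"
      using Suc.prems by (intro dA_ultra a \<tau>) auto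
    ultimately show ?case by linarith
  qed
  from this[of n] show ?thesis
    using n by (simp add: \<tau>_def)
qed

text \<open>
  Choose \<open>a t\<close> in \<open>A\<close> that moves \<open>w t\<close> to within \<open>\<delta>\<close> of \<open>v t\<close>. Comparing two nearby times costs \<open>\<delta>\<close>
  twice and a jump of \<open>v\<close> and of \<open>w\<close>, so the steps of \<open>a\<close> are at most \<open>2\<delta> + 2\<epsilon>\<close>; by
  \<open>ultrametric_chain\<close> they do not accumulate.
\<close>

lemma coarse_paths_close:
  assumes v: "coarse_path \<epsilon> v" and w: "coarse_path \<epsilon> w" and "0 \<le> \<epsilon>"
    and close: "\<And>t. t \<in> {0..1} \<Longrightarrow> dY (p (v t)) (p (w t)) \<le> \<delta>"
    and start: "dX (v 0) (w 0) \<le> \<delta>" and t: "t \<in> {0..1}"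
  shows "dX (v t) (w t) \<le> 3 * \<delta> + 2 * \<epsilon>"
proof -
  obtain \<eta>1 where \<eta>1: "\<eta>1 > 0" "\<And>s t. \<lbrakk>s \<in> {0..1}; t \<in> {0..1}; \<bar>s - t\<bar> < \<eta>1\<rbrakk> \<Longrightarrow> dX (v s) (v t) \<le> \<epsilon>"
    using v by (auto simp: coarse_path_def)
  obtain \<eta>2 where \<eta>2: "\<eta>2 > 0" "\<And>s t. \<lbrakk>s \<in> {0..1}; t \<in> {0..1}; \<bar>s - t\<bar> < \<eta>2\<rbrakk> \<Longrightarrow> dX (w s) (w t) \<le> \<epsilon>"
    using w by (auto simp: coarse_path_def)
  have vX: "v t \<in> X" and wX: "w t \<in> X" if "t \<in> {0..1}" for t
    using v w that by (auto simp: coarse_path_def)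
  have "\<exists>a\<in>carrier A. dX (v t) (act a (w t)) \<le> \<delta>" if "t \<in> {0..1}" for t
    using p_dist_act[OF vX wX] close that by metis
  then obtain a where a: "\<And>t. t \<in> {0..1} \<Longrightarrow> a t \<in> carrier A"
    and va: "\<And>t. t \<in> {0..1} \<Longrightarrow> dX (v t) (act (a t) (w t)) \<le> \<delta>"
    by metis
  have "dA (a 0) (a t) \<le> 2 * \<delta> + 2 * \<epsilon>"
  proof (rule ultrametric_chain[of _ "min \<eta>1 \<eta>2"])
    fix s t :: real assume s: "s \<in> {0..1}" and t: "t \<in> {0..1}" and st: "\<bar>s - t\<bar> < min \<eta>1 \<eta>2"
    have "dA (a s) (a t) = dX (act (a s) (w s)) (act (a t) (w s))"
      using a s t wX by (simp add: act_dist)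
    also have "\<dots> \<le> dX (act (a s) (w s)) (v s) + dX (v s) (v t) + dX (v t) (act (a t) (w t))
        + dX (act (a t) (w t)) (act (a t) (w s))"
      using X.triangle a s t vX wX act_closed by (smt (verit))
    also have "\<dots> = dX (v s) (act (a s) (w s)) + dX (v s) (v t) + dX (v t) (act (a t) (w t)) + dX (w s) (w t)"
      using a s t wX by (simp add: act_isometry X.commute)
    also have "\<dots> \<le> \<delta> + \<epsilon> + \<delta> + \<epsilon>"
      using st by (intro add_mono va \<eta>1 \<eta>2 s t) auto
    finally show "dA (a s) (a t) \<le> 2 * \<delta> + 2 * \<epsilon>" by simp
  qed (use \<eta>1 \<eta>2 a t in auto)
  moreover have "dA \<one> (a 0) \<le> 2 * \<delta> + 2 * \<epsilon>"
  proof -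
    have "dA \<one> (a 0) = dX (w 0) (act (a 0) (w 0))"
      using act_dist[of \<one> "a 0" "w 0"] a[of 0] wX[of 0] by (simp add: act_one)
    also have "\<dots> \<le> dX (v 0) (w 0) + dX (v 0) (act (a 0) (w 0))"
      using X.triangle[of "w 0" "v 0" "act (a 0) (w 0)"] a[of 0] wX[of 0] vX[of 0] by (simp add: X.commute act_closed)
    also have "\<dots> \<le> 2 * \<delta>"
      using va[of 0] start by simp
    finally show ?thesis using \<open>0 \<le> \<epsilon>\<close> by simp
  qed
  moreover have "dA \<one> (a t) \<le> max (dA \<one> (a 0)) (dA (a 0) (a t))"
    using a t by (intro dA_ultra) auto
  moreover have "dX (v t) (w t) \<le> dX (v t) (act (a t) (w t)) + dA \<one> (a t)"
    using X.triangle[of "v t" "act (a t) (w t)" "w t"] act_dist[of \<one> "a t" "w t"] a[OF t] vX[OF t] wX[OF t]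
    by (simp add: act_one act_closed X.commute)
  ultimately show ?thesis
    using va[OF t] by linarith
qed

lemma paths_close:
  assumes v: "pathin X.mtopology v" and w: "pathin X.mtopology w"
    and close: "\<And>t. t \<in> {0..1} \<Longrightarrow> dY (p (v t)) (p (w t)) \<le> \<delta>"
    and start: "dX (v 0) (w 0) \<le> \<delta>" and t: "t \<in> {0..1}"
  shows "dX (v t) (w t) \<le> 3 * \<delta>"
proof (rule field_le_epsilon)
  fix e :: real assume "e > 0"
  then show "dX (v t) (w t) \<le> 3 * \<delta> + e"
    using coarse_paths_close[of "e / 2" v w \<delta> t] assms by (auto simp: pathin_iff_coarse_path)
qed

definition lift :: "(real \<Rightarrow> 'y) \<Rightarrow> (real \<Rightarrow> 'x) \<Rightarrow> bool" where
  "lift u v \<longleftrightarrow> pathin X.mtopology v \<and> v 0 = x0 \<and> (\<forall>t\<in>{0..1}. p (v t) = u t)"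

lemma lifts_close:
  assumes "lift u v" "lift u' v'" "\<And>t. t \<in> {0..1} \<Longrightarrow> dY (u t) (u' t) \<le> \<delta>" "t \<in> {0..1}"
  shows "dX (v t) (v' t) \<le> 3 * \<delta>"
proof (rule paths_close)
  show "dX (v 0) (v' 0) \<le> \<delta>"
    using assms(1,2) base Y.nonneg[of "u 0" "u' 0"] order_trans[OF Y.nonneg assms(3)[of 0]] by (simp add: lift_def)
qed (use assms in \<open>auto simp: lift_def\<close>)

lemma lift_in_X: "\<lbrakk>lift u v; t \<in> {0..1}\<rbrakk> \<Longrightarrow> v t \<in> X"
  by (auto simp: lift_def X.pathin_iff)

lemma lift_unique:
  assumes "lift u v" "lift u v'" "t \<in> {0..1}" shows "v t = v' t"
proof -
  have "dY (u s) (u s) \<le> 0" if "s \<in> {0..1}" for s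
    using p_closed[OF lift_in_X[OF assms(1) that]] assms(1) that by (simp add: lift_def)
  then have "dX (v t) (v' t) \<le> 0"
    using lifts_close[OF assms(1,2) _ assms(3), of 0] by simp
  then show ?thesis
    using lift_in_X assms X.nonneg[of "v t" "v' t"] by simp
qed

text \<open>
  A fibre is an isometric copy of \<open>A\<close>, so it is totally disconnected: the path and the constant path
  at its start have the same projection.
\<close>

lemma path_in_fibre_const:
  assumes w: "pathin X.mtopology w" and fibre: "\<And>s. s \<in> {0..1} \<Longrightarrow> p (w s) = y" and t: "t \<in> {0..1}"
  shows "w t = w 0"
proof -
  have wX: "w s \<in> X" if "s \<in> {0..1}" for s
    using w that by (auto simp: X.pathin_iff)
  have "y \<in> Y"
    using p_closed[OF wX[of 0]] fibre[of 0] by simp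
  then have "dX (w t) (w 0) \<le> 3 * 0"
    using wX fibre by (intro paths_close[OF w _ _ _ t]) (auto simp: pathin_const)
  then show ?thesis
    using wX[OF t] wX[of 0] X.nonneg[of "w t" "w 0"] by simp
qed

text \<open>
  Lift the points of a fine subdivision one after the other, each as close as possible to the
  previous one, and every other point as close as possible to the lift of the last subdivision
  point before it.
\<close>

lemma coarse_lift_exists:
  assumes u: "pathin Y.mtopology u" and u0: "u 0 = p x0" and "\<epsilon> > 0"
  shows "\<exists>v. coarse_path \<epsilon> v \<and> v 0 = x0 \<and> (\<forall>t\<in>{0..1}. p (v t) = u t)"
proof -
  \<comment> \<open>Two points at distance less than a mesh are joined through the lifts of their subdivision
    points, that is by three steps.\<close>
  define \<eta> where "\<eta> = \<epsilon> / 3"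
  have "\<eta> > 0" using \<open>\<epsilon> > 0\<close> by (simp add: \<eta>_def)
  have uY: "u t \<in> Y" if "t \<in> {0..1}" for t
    using u that by (auto simp: Y.pathin_iff)
  obtain \<delta> where \<delta>: "\<delta> > 0" "\<And>s t. \<lbrakk>s \<in> {0..1}; t \<in> {0..1}; \<bar>s - t\<bar> < \<delta>\<rbrakk> \<Longrightarrow> dY (u s) (u t) < \<eta>"
    using u \<open>\<eta> > 0\<close> unfolding Y.pathin_iff by metis
  obtain n :: nat where n: "n > 0" "1 / n < \<delta>"
    using \<open>\<delta> > 0\<close> nat_approx_posE by (metis of_nat_Suc zero_less_Suc)
  \<comment> \<open>The recursion runs over all naturals; from index \<open>n\<close> on it stays above the end of the path.\<close>
  define \<tau> where "\<tau> i = min 1 (real i / n)" for i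
  have \<tau>: "\<tau> i \<in> {0..1}" for i
    by (auto simp: \<tau>_def)
  have "\<bar>\<tau> i - \<tau> (Suc i)\<bar> < \<delta>" for i
  proof -
    have "real (Suc i) / n = real i / n + 1 / n"
      by (simp add: add_divide_distrib)
    moreover have *: "\<bar>min 1 a - min 1 (a + c)\<bar> \<le> c" if "c \<ge> 0" for a c :: real
      using that by (auto simp: min_def)
    ultimately have "\<bar>\<tau> i - \<tau> (Suc i)\<bar> \<le> 1 / n"
      using *[of "1 / n" "real i / n"] by (simp add: \<tau>_def del: min_add_distrib_left)
    then show ?thesis
      using n by simp
  qed
  then have step: "dY (u (\<tau> i)) (u (\<tau> (Suc i))) \<le> \<eta>" for i
    using \<delta>(2) \<tau> by (simp add: less_imp_le)
  have "\<exists>f. \<forall>i. (f i \<in> X \<and> p (f i) = u (\<tau> i) \<and> (i = 0 \<longrightarrow> f i = x0)) \<and> dX (f i) (f (Suc i)) \<le> \<eta>"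
  proof (rule dependent_nat_choice)
    show "\<exists>x. x \<in> X \<and> p x = u (\<tau> 0) \<and> (0 = 0 \<longrightarrow> x = x0)"
      using base u0 by (auto simp: \<tau>_def)
    fix x i assume "x \<in> X \<and> p x = u (\<tau> i) \<and> (i = 0 \<longrightarrow> x = x0)"
    then show "\<exists>y. (y \<in> X \<and> p y = u (\<tau> (Suc i)) \<and> (Suc i = 0 \<longrightarrow> y = x0)) \<and> dX x y \<le> \<eta>"
      using p_lift[of x "u (\<tau> (Suc i))"] uY[OF \<tau>] step[of i] by auto
  qed
  then obtain f where f: "\<And>i. f i \<in> X" "\<And>i. p (f i) = u (\<tau> i)" "f 0 = x0" "\<And>i. dX (f i) (f (Suc i)) \<le> \<eta>"
    by blast
  define k where "k t = nat \<lfloor>t * n\<rfloor>" for t :: real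
  have k: "real (k t) \<le> t * n" "t * n < real (k t) + 1" if "t \<in> {0..1}" for t
    using that by (simp_all add: k_def)
  have k\<tau>: "\<bar>\<tau> (k t) - t\<bar> < \<delta>" if "t \<in> {0..1}" for t
  proof -
    have "real (k t) / n \<le> t" "t < real (k t) / n + 1 / n"
      using k[OF that] n by (auto simp: field_simps)
    moreover have "t \<le> 1" using that by simp
    ultimately have "\<tau> (k t) = real (k t) / n" "\<bar>real (k t) / n - t\<bar> < \<delta>"
      using n by (auto simp: \<tau>_def)
    then show ?thesis by simp
  qed
  have "\<exists>x\<in>X. p x = u t \<and> dX (f (k t)) x = dY (u (\<tau> (k t))) (u t)" if "t \<in> {0..1}" for t
    using p_lift[OF f(1) uY[OF that]] f(2) by simp
  then obtain v where v: "\<And>t. t \<in> {0..1} \<Longrightarrow> v t \<in> X" "\<And>t. t \<in> {0..1} \<Longrightarrow> p (v t) = u t"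
    "\<And>t. t \<in> {0..1} \<Longrightarrow> dX (f (k t)) (v t) = dY (u (\<tau> (k t))) (u t)"
    by metis
  have fv: "dX (f (k t)) (v t) \<le> \<eta>" if "t \<in> {0..1}" for t
    using v(3)[OF that] \<delta>(2)[OF \<tau> that k\<tau>[OF that]] by simp
  have "dX (v s) (v t) \<le> \<epsilon>" if s: "s \<in> {0..1}" and t: "t \<in> {0..1}" and st: "\<bar>s - t\<bar> < 1 / n" for s t
  proof -
    have "s * n < t * n + 1" "t * n < s * n + 1"
      using st n by (auto simp: abs_less_iff field_simps)
    then have "real (k s) < real (k t) + 2" "real (k t) < real (k s) + 2"
      using k[OF s] k[OF t] by linarith+
    then have "k s = k t \<or> k s = Suc (k t) \<or> k t = Suc (k s)"
      by linarith
    then have "dX (f (k s)) (f (k t)) \<le> \<eta>"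
      using f(1) f(4)[of "k t"] f(4)[of "k s"] \<open>\<eta> > 0\<close> by (auto simp: X.commute)
    then show ?thesis
      using fv[OF s] fv[OF t] X.triangle[of "v s" "f (k s)" "v t"] X.triangle[of "f (k s)" "f (k t)" "v t"]
        X.commute[of "v s" "f (k s)"] v(1) f(1) s t by (simp add: \<eta>_def)
  qed
  moreover have "v 0 = x0"
    using v(1)[of 0] v(3)[of 0] f(1,3) uY[of 0] base by (simp add: k_def \<tau>_def)
  ultimately show ?thesis
    using v n unfolding coarse_path_def by (intro exI[of _ v]) (auto intro!: exI[of _ "1 / real n"])
qed

text \<open>
  Coarse lifts with jumps \<open>e k\<close> tending to \<open>0\<close> have equal projections, so they are uniformly
  \<open>2 e k\<close>-close to all later ones. The uniform limit has no jumps.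
\<close>

theorem lift_exists:
  assumes u: "pathin Y.mtopology u" and u0: "u 0 = p x0"
  shows "\<exists>v. lift u v"
proof -
  define e where "e k = 1 / real (Suc k)" for k
  have e: "e k > 0" "j \<ge> k \<Longrightarrow> e j \<le> e k" for j k
    by (auto simp: e_def field_simps)
  have e_small: "\<exists>k. e k < \<epsilon>" if "\<epsilon> > 0" for \<epsilon>
    using nat_approx_posE[OF that] unfolding e_def by metis
  have "\<forall>k. \<exists>v. coarse_path (e k) v \<and> v 0 = x0 \<and> (\<forall>t\<in>{0..1}. p (v t) = u t)"
    using coarse_lift_exists[OF u u0 e(1)] by blast
  then obtain V where V: "\<And>k. coarse_path (e k) (V k)" "\<And>k. V k 0 = x0" "\<And>k t. t \<in> {0..1} \<Longrightarrow> p (V k t) = u t"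
    by metis
  have VX: "V k t \<in> X" if "t \<in> {0..1}" for k t
    using V(1)[of k] that by (auto simp: coarse_path_def)
  have uY: "u t \<in> Y" if "t \<in> {0..1}" for t
    using u that by (auto simp: Y.pathin_iff)
  have cauchy: "dX (V j t) (V k t) \<le> 2 * e k" if t: "t \<in> {0..1}" and "j \<ge> k" for j k t
  proof -
    have "dX (V j t) (V k t) \<le> 3 * 0 + 2 * e k"
      using e \<open>j \<ge> k\<close> V VX uY base t
      by (intro coarse_paths_close coarse_path_mono[OF V(1)[of j]]) (auto simp: less_imp_le)
    then show ?thesis by simp
  qed
  have "\<exists>x\<in>X. \<forall>k. dX (V k t) x \<le> 2 * e k" if t: "t \<in> {0..1}" for t
  proof -
    have "X.MCauchy (\<lambda>k. V k t)"
      unfolding X.MCauchy_def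
    proof (intro conjI allI impI)
      fix \<epsilon> :: real assume "\<epsilon> > 0"
      then obtain N where N: "e N < \<epsilon> / 4"
        using e_small[of "\<epsilon> / 4"] by auto
      have "dX (V i t) (V j t) < \<epsilon>" if "N \<le> i" "N \<le> j" for i j
        using X.triangle[of "V i t" "V N t" "V j t"] cauchy[OF t that(1)] cauchy[OF t that(2)] N VX[OF t] e(1)[of N]
          X.commute[of "V N t" "V j t"] by simp
      then show "\<exists>N. \<forall>i j. N \<le> i \<longrightarrow> N \<le> j \<longrightarrow> dX (V i t) (V j t) < \<epsilon>" by blast
    qed (use VX t in auto)
    then obtain x where x: "x \<in> X" "\<And>\<epsilon>. \<epsilon> > 0 \<Longrightarrow> \<exists>N. \<forall>n\<ge>N. V n t \<in> X \<and> dX (V n t) x < \<epsilon>"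
      using complete unfolding X.mcomplete_def X.limit_metric_sequentially by blast
    have "dX (V k t) x \<le> 2 * e k" for k
    proof (rule field_le_epsilon)
      fix \<epsilon> :: real assume "\<epsilon> > 0"
      then obtain N where N: "\<And>n. n \<ge> N \<Longrightarrow> dX (V n t) x < \<epsilon>"
        using x(2) by blast
      show "dX (V k t) x \<le> 2 * e k + \<epsilon>"
        using X.triangle[of "V k t" "V (max N k) t" x] VX[OF t] x(1) N[of "max N k"] cauchy[OF t, of k "max N k"]
          X.commute[of "V k t" "V (max N k) t"] by simp
    qed
    then show ?thesis using x(1) by blast
  qed
  then obtain v where v: "\<And>t. t \<in> {0..1} \<Longrightarrow> v t \<in> X" "\<And>t k. t \<in> {0..1} \<Longrightarrow> dX (V k t) (v t) \<le> 2 * e k"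
    by metis
  have eq: "x = y" if "x \<in> X" "y \<in> X" "\<And>k. dX x y \<le> 2 * e k" for x y
  proof -
    have "dX x y \<le> 0"
    proof (rule field_le_epsilon)
      fix \<epsilon> :: real assume "\<epsilon> > 0"
      then obtain k where "e k < \<epsilon> / 2"
        using e_small[of "\<epsilon> / 2"] by auto
      then show "dX x y \<le> 0 + \<epsilon>"
        using that(3)[of k] by simp
    qed
    then show ?thesis
      using that X.nonneg[of x y] by simp
  qed
  have "coarse_path \<epsilon> v" if "\<epsilon> > 0" for \<epsilon>
  proof -
    obtain k where k: "e k < \<epsilon> / 5"
      using e_small[of "\<epsilon> / 5"] \<open>\<epsilon> > 0\<close> by auto
    obtain \<delta> where \<delta>: "\<delta> > 0" "\<And>s t. \<lbrakk>s \<in> {0..1}; t \<in> {0..1}; \<bar>s - t\<bar> < \<delta>\<rbrakk> \<Longrightarrow> dX (V k s) (V k t) \<le> e k"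
      using V(1)[of k] unfolding coarse_path_def by blast
    have "dX (v s) (v t) \<le> \<epsilon>" if s: "s \<in> {0..1}" and t: "t \<in> {0..1}" and "\<bar>s - t\<bar> < \<delta>" for s t
      using \<delta>(2)[OF that] v(2)[OF s, of k] v(2)[OF t, of k] k X.commute[of "v s" "V k s"]
        X.triangle[of "v s" "V k s" "v t"] X.triangle[of "V k s" "V k t" "v t"]
        VX[OF s, of k] VX[OF t, of k] v(1)[OF s] v(1)[OF t]
      by simp
    then show ?thesis
      unfolding coarse_path_def using v(1) \<delta>(1) by blast
  qed
  moreover have "v 0 = x0"
    using eq[of x0 "v 0"] base v(1)[of 0] v(2)[of 0] V(2) by simp
  moreover have "p (v t) = u t" if t: "t \<in> {0..1}" for t
  proof -
    obtain x where x: "x \<in> X" "p x = u t" "dX (v t) x = dY (p (v t)) (u t)"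
      using p_lift[OF v(1)[OF t] uY[OF t]] by blast
    have "dX (v t) x \<le> 2 * e k" for k
      using x(3) p_dist[OF VX[OF t] v(1)[OF t], of k] V(3)[OF t, of k] v(2)[OF t, of k] Y.commute[of "p (v t)" "u t"]
      by simp
    then show ?thesis
      using eq[OF v(1)[OF t] x(1)] x(2) by simp
  qed
  ultimately show ?thesis
    unfolding lift_def pathin_iff_coarse_path by blast
qed

lemma continuous_map_p: "continuous_map X.mtopology Y.mtopology p"
proof -
  have "\<exists>U. openin X.mtopology U \<and> x \<in> U \<and> (\<forall>y\<in>U. p y \<in> Y.mball (p x) \<epsilon>)" if "x \<in> X" "\<epsilon> > 0" for x \<epsilon>
  proof (intro exI[of _ "X.mball x \<epsilon>"] conjI ballI)
    fix y assume "y \<in> X.mball x \<epsilon>"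
    then show "p y \<in> Y.mball (p x) \<epsilon>"
      using p_dist[of x y] p_closed by auto
  qed (use that in auto)
  then show ?thesis
    unfolding Y.continuous_map_to_metric by simp
qed

lemma lift_path: "\<lbrakk>pathin X.mtopology v; v 0 = x0\<rbrakk> \<Longrightarrow> lift (p \<circ> v) v"
  by (simp add: lift_def)

text \<open>
  Lifts of uniformly close paths are uniformly close, so the lifts of the stages of a homotopy
  depend continuously on the stage, and together form a lift of the homotopy.
\<close>

lemma homotopy_lift:
  fixes h :: "real \<times> real \<Rightarrow> 'y" and V :: "real \<Rightarrow> real \<Rightarrow> 'x"
  assumes h: "continuous_map (top_of_set ({0..1} \<times> {0..1})) Y.mtopology h"
    and V: "\<And>s. s \<in> {0..1} \<Longrightarrow> lift (\<lambda>t. h (s, t)) (V s)"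
  shows "continuous_map (top_of_set ({0..1} \<times> {0..1})) X.mtopology (\<lambda>(s, t). V s t)"
proof -
  let ?Q = "{0..1::real} \<times> {0..1::real}"
  have Q: "compact ?Q"
    by (intro compact_Times) auto
  have h': "\<exists>\<delta>>0. \<forall>x\<in>?Q. \<forall>y\<in>?Q. dist x y < \<delta> \<longrightarrow> dY (h x) (h y) < \<epsilon>" if "\<epsilon> > 0" for \<epsilon>
    using h that unfolding continuous_map_compact_metric_iff[OF Y.Metric_space_axioms Q] by blast
  have VX: "V s t \<in> X" if "s \<in> {0..1}" "t \<in> {0..1}" for s t
    using lift_in_X[OF V] that by blast
  have "\<exists>U. openin (top_of_set ?Q) U \<and> x \<in> U \<and> (\<forall>y\<in>U. (\<lambda>(s, t). V s t) y \<in> X.mball ((\<lambda>(s, t). V s t) x) \<epsilon>)"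
    if x: "x \<in> ?Q" and "\<epsilon> > 0" for x \<epsilon>
  proof -
    obtain s t where st: "x = (s, t)" "s \<in> {0..1}" "t \<in> {0..1}"
      using x by auto
    obtain \<delta>1 where \<delta>1: "\<delta>1 > 0" "\<And>x y. \<lbrakk>x \<in> ?Q; y \<in> ?Q; dist x y < \<delta>1\<rbrakk> \<Longrightarrow> dY (h x) (h y) < \<epsilon> / 6"
      using h'[of "\<epsilon> / 6"] \<open>\<epsilon> > 0\<close> by auto
    have "pathin X.mtopology (V s)"
      using V[OF st(2)] by (simp add: lift_def)
    then obtain \<delta>2 where \<delta>2: "\<delta>2 > 0" "\<And>t t'. \<lbrakk>t \<in> {0..1}; t' \<in> {0..1}; \<bar>t - t'\<bar> < \<delta>2\<rbrakk> \<Longrightarrow> dX (V s t) (V s t') < \<epsilon> / 2"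
      unfolding X.pathin_iff using \<open>\<epsilon> > 0\<close> by (metis half_gt_zero)
    let ?U = "?Q \<inter> ball x (min \<delta>1 \<delta>2)"
    have "V s' t' \<in> X.mball (V s t) \<epsilon>" if "(s', t') \<in> ?U" for s' t'
    proof -
      have st': "s' \<in> {0..1}" "t' \<in> {0..1}" and d: "dist (s, t) (s', t') < min \<delta>1 \<delta>2"
        using that by (auto simp: st)
      have "dist s s' < \<delta>1" "dist t t' < \<delta>2"
        using d dist_fst_le[of "(s, t)" "(s', t')"] dist_snd_le[of "(s, t)" "(s', t')"] by auto
      have "dX (V s t') (V s' t') \<le> 3 * (\<epsilon> / 6)"
      proof (rule lifts_close[OF V[OF st(2)] V[OF st'(1)] _ st'(2)])
        fix r :: real assume "r \<in> {0..1}"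
        then show "dY (h (s, r)) (h (s', r)) \<le> \<epsilon> / 6"
          using \<open>dist s s' < \<delta>1\<close> st st' by (intro less_imp_le \<delta>1) (auto simp: dist_Pair_Pair)
      qed
      moreover have "dX (V s t) (V s t') < \<epsilon> / 2"
        using \<open>dist t t' < \<delta>2\<close> st st' by (intro \<delta>2) (auto simp: dist_real_def)
      ultimately show ?thesis
        using X.triangle[of "V s t" "V s t'" "V s' t'"] VX st st' by simp
    qed
    then show ?thesis
      using x \<delta>1(1) \<delta>2(1) by (intro exI[of _ ?U]) (auto simp: st openin_open_Int)
  qed
  then show ?thesis
    unfolding X.continuous_map_to_metric by simp
qed

text \<open>
  The loops of a homotopy are based at one point, so the ends of their lifts move continuously
  within one fibre, which is totally disconnected.
\<close>

lemma homotopy_lift_exists: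
  assumes "loop_homotopic Y.mtopology (p x0) u u'"
  obtains V :: "real \<Rightarrow> real \<Rightarrow> 'x" where "continuous_map (top_of_set ({0..1} \<times> {0..1})) X.mtopology (\<lambda>(s, t). V s t)"
    "lift u (V 0)" "lift u' (V 1)" "\<And>s. s \<in> {0..1} \<Longrightarrow> V s 0 = x0" "\<And>s. s \<in> {0..1} \<Longrightarrow> V s 1 = V 0 1"
proof -
  obtain h :: "real \<times> real \<Rightarrow> 'y" where h: "continuous_map (top_of_set ({0..1} \<times> {0..1})) Y.mtopology h"
    "\<And>t. h (0, t) = u t" "\<And>t. h (1, t) = u' t"
    "\<And>s. s \<in> {0..1} \<Longrightarrow> h (s, 0) = p x0" "\<And>s. s \<in> {0..1} \<Longrightarrow> h (s, 1) = p x0"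
    by (rule loop_homotopicE[OF assms]) (rule that)
  have path: "pathin Y.mtopology (\<lambda>t. h (s, t))" if "s \<in> {0..1}" for s
    unfolding pathin_def using h(1)
    by (rule continuous_map_compose[where g = h, unfolded o_def, rotated])
       (use that in \<open>auto intro!: continuous_map_top_of_setI continuous_intros\<close>)
  have "\<exists>v. lift (\<lambda>t. h (s, t)) v" if "s \<in> {0..1}" for s
    using lift_exists[OF path[OF that]] h(4)[OF that] by blast
  then obtain V where V: "\<And>s. s \<in> {0..1} \<Longrightarrow> lift (\<lambda>t. h (s, t)) (V s)"
    by metis
  have cV: "continuous_map (top_of_set ({0..1} \<times> {0..1})) X.mtopology (\<lambda>(s, t). V s t)"
    by (rule homotopy_lift[OF h(1) V])
  have "continuous_map (top_of_set {0..1}) X.mtopology ((\<lambda>(s, t). V s t) \<circ> (\<lambda>s. (s, 1)))"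
    by (rule continuous_map_compose[OF _ cV]) (auto intro!: continuous_map_top_of_setI continuous_intros)
  then have "pathin X.mtopology (\<lambda>s. V s 1)"
    by (simp add: pathin_def o_def)
  then have "V s 1 = V 0 1" if "s \<in> {0..1}" for s
    using V h(5) that by (intro path_in_fibre_const[where y = "p x0"]) (auto simp: lift_def)
  moreover have "lift u (V 0)" "lift u' (V 1)"
    using V[of 0] V[of 1] by (simp_all add: h)
  moreover have "V s 0 = x0" if "s \<in> {0..1}" for s
    using V[OF that] by (simp add: lift_def)
  ultimately show ?thesis
    using that cV by blast
qed


subsection \<open>The endpoint of the lift\<close>

abbreviation "\<pi>X \<equiv> pi1 X.mtopology x0"
abbreviation "\<pi>Y \<equiv> pi1 Y.mtopology (p x0)"

sublocale \<pi>X: group \<pi>X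
  by (rule group_pi1) (simp add: base)

sublocale \<pi>Y: group \<pi>Y
  by (rule group_pi1) (simp add: base p_closed)

definition \<mu> :: "(real \<Rightarrow> 'y) set \<Rightarrow> 'a" where
  "\<mu> g = (THE z. z \<in> carrier A \<and> (\<exists>u\<in>g. \<exists>v. lift u v \<and> v 1 = act z x0))"

lemma \<mu>_class:
  assumes u: "u \<in> based_loops Y.mtopology (p x0)" and v: "lift u v" and z: "z \<in> carrier A" "v 1 = act z x0"
  shows "\<mu> (loop_class Y.mtopology (p x0) u) = z"
  unfolding \<mu>_def
proof (rule the_equality)
  show "z \<in> carrier A \<and> (\<exists>u\<in>loop_class Y.mtopology (p x0) u. \<exists>v. lift u v \<and> v 1 = act z x0)"
    using v z loop_homotopic_refl[OF u] unfolding loop_class_def by blast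
  fix z' assume "z' \<in> carrier A \<and> (\<exists>u\<in>loop_class Y.mtopology (p x0) u. \<exists>v. lift u v \<and> v 1 = act z' x0)"
  then obtain u' v' where z': "z' \<in> carrier A" "loop_homotopic Y.mtopology (p x0) u u'" "lift u' v'" "v' 1 = act z' x0"
    by (auto simp: mem_loop_class)
  obtain V :: "real \<Rightarrow> real \<Rightarrow> 'x" where V: "lift u (V 0)" "lift u' (V 1)" "\<And>s. s \<in> {0..1} \<Longrightarrow> V s 1 = V 0 1"
    by (rule homotopy_lift_exists[OF z'(2)]) (rule that)
  have "v 1 = v' 1"
    using lift_unique[OF v V(1), of 1] lift_unique[OF z'(3) V(2), of 1] V(3)[of 1] by simp
  then show "z' = z"
    using act_free z z' by simp
qed

lemma loop_lift_exists:
  assumes "u \<in> based_loops Y.mtopology (p x0)"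
  obtains v z where "lift u v" "z \<in> carrier A" "v 1 = act z x0"
proof -
  obtain v where v: "lift u v"
    using lift_exists[of u] assms by (auto simp: based_loops_def)
  then have "p (v 1) = p x0"
    using assms by (simp add: lift_def based_loops_def)
  then show ?thesis
    using p_fibre[of x0 "v 1"] base lift_in_X[OF v, of 1] v that by auto
qed

lemma pathin_act:
  assumes "pathin X.mtopology v" "a \<in> carrier A" shows "pathin X.mtopology (\<lambda>t. act a (v t))"
proof -
  have "v t \<in> X" if "t \<in> {0..1}" for t
    using assms(1) that by (auto simp: X.pathin_iff)
  then show ?thesis
    using assms by (simp add: X.pathin_iff act_isometry act_closed Pi_iff)
qed

text \<open>
  The lift of a product of loops continues the lift of the first factor by the lift of the second
  one, translated to start where the first one ends.
\<close>

lemma \<mu>_hom: "\<mu> \<in> hom \<pi>Y A"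
proof (rule homI)
  fix g assume "g \<in> carrier \<pi>Y"
  then obtain u where u: "u \<in> based_loops Y.mtopology (p x0)" "g = loop_class Y.mtopology (p x0) u"
    by (auto simp: carrier_pi1)
  obtain v a where v: "lift u v" "a \<in> carrier A" "v 1 = act a x0"
    using loop_lift_exists[OF u(1)] .
  have g: "\<mu> g = a"
    unfolding u(2) by (rule \<mu>_class[OF u(1) v])
  then show "\<mu> g \<in> carrier A"
    using v by simp
  fix g' assume "g' \<in> carrier \<pi>Y"
  then obtain u' where u': "u' \<in> based_loops Y.mtopology (p x0)" "g' = loop_class Y.mtopology (p x0) u'"
    by (auto simp: carrier_pi1)
  obtain v' b where v': "lift u' v'" "b \<in> carrier A" "v' 1 = act b x0"
    using loop_lift_exists[OF u'(1)] .
  have "lift (path_concat u u') (path_concat v (\<lambda>t. act a (v' t)))"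
    unfolding lift_def
  proof (intro conjI ballI)
    show "pathin X.mtopology (path_concat v (\<lambda>t. act a (v' t)))"
      using v v' by (intro pathin_path_concat pathin_act) (auto simp: lift_def)
    show "path_concat v (\<lambda>t. act a (v' t)) 0 = x0"
      using v by (simp add: lift_def)
    fix t :: real assume t: "t \<in> {0..1}"
    show "p (path_concat v (\<lambda>t. act a (v' t)) t) = path_concat u u' t"
    proof (cases "t \<le> 1 / 2")
      case True
      then show ?thesis using v t by (simp add: path_concat_def lift_def)
    next
      case False
      then have "2 * t - 1 \<in> {0..1}" using t by auto
      then show ?thesis
        using False v v' lift_in_X[OF v'(1), of "2 * t - 1"] p_act[of a "v' (2 * t - 1)"]
        by (simp add: path_concat_def lift_def)
    qed
  qed
  then have "\<mu> (g \<otimes>\<^bsub>\<pi>Y\<^esub> g') = a \<otimes> b"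
    unfolding u(2) u'(2) mult_pi1[OF u(1) u'(1)]
    using v v' base by (intro \<mu>_class[where v = "path_concat v (\<lambda>t. act a (v' t))"] based_loops_path_concat u u') (auto simp: act_mult)
  moreover have "\<mu> g' = b"
    unfolding u'(2) by (rule \<mu>_class[OF u'(1) v'])
  ultimately show "\<mu> (g \<otimes>\<^bsub>\<pi>Y\<^esub> g') = \<mu> g \<otimes> \<mu> g'"
    using g by simp
qed

sublocale \<mu>: group_hom \<pi>Y A \<mu>
  by unfold_locales (rule \<mu>_hom)

abbreviation "p_star \<equiv> pi1_map Y.mtopology (p x0) p"

lemmas p_star_class = pi1_map_class[OF continuous_map_p _ refl, of _ x0]

sublocale ps: group_hom \<pi>X \<pi>Y p_star
  by unfold_locales (rule pi1_map_hom[OF continuous_map_p refl])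

text \<open>
  A null homotopy of the projection lifts to a homotopy from the loop to the lift of the constant
  loop, which is constant.
\<close>

lemma p_star_inj: "inj_on p_star (carrier \<pi>X)"
proof -
  have "g = \<one>\<^bsub>\<pi>X\<^esub>" if g: "g \<in> carrier \<pi>X" "p_star g = \<one>\<^bsub>\<pi>Y\<^esub>" for g
  proof -
    obtain q where q: "q \<in> based_loops X.mtopology x0" "g = loop_class X.mtopology x0 q"
      using g by (auto simp: carrier_pi1)
    have "loop_homotopic Y.mtopology (p x0) (p \<circ> q) (\<lambda>t. p x0)"
      using g(2) q loop_class_eq_iff[OF based_loops_compose[OF continuous_map_p q(1)]]
      by (simp add: p_star_class one_pi1)
    then obtain V :: "real \<Rightarrow> real \<Rightarrow> 'x" where V: "continuous_map (top_of_set ({0..1} \<times> {0..1})) X.mtopology (\<lambda>(s, t). V s t)"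
      "lift (p \<circ> q) (V 0)" "lift (\<lambda>t. p x0) (V 1)" "\<And>s. s \<in> {0..1} \<Longrightarrow> V s 0 = x0" "\<And>s. s \<in> {0..1} \<Longrightarrow> V s 1 = V 0 1"
      by (rule homotopy_lift_exists) (rule that)
    have V0: "V 0 t = q t" if "t \<in> {0..1}" for t
      using q(1) that by (intro lift_unique[OF V(2) lift_path]) (auto simp: based_loops_def)
    have V1: "V 1 t = x0" if "t \<in> {0..1}" for t
      using base that by (intro lift_unique[OF V(3), of "\<lambda>t. x0"]) (auto simp: lift_def pathin_const)
    have "loop_homotopic X.mtopology x0 q (\<lambda>t. x0)"
      by (rule loop_homotopicI[OF V(1)]) (use V0 V1 V(4,5) V(5)[of 1] q(1) in \<open>auto simp: based_loops_def\<close>)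
    then show ?thesis
      using q loop_class_eq_iff[OF q(1)] by (simp add: one_pi1)
  qed
  then show ?thesis
    unfolding ps.inj_iff_trivial_ker by (auto simp: kernel_def)
qed

text \<open>
  The loops with trivial endpoint are those whose lifts are closed.
\<close>

lemma p_star_image: "p_star ` carrier \<pi>X = kernel \<pi>Y A \<mu>"
proof (intro subset_antisym subsetI)
  fix g assume "g \<in> p_star ` carrier \<pi>X"
  then obtain q where q: "q \<in> based_loops X.mtopology x0" "g = loop_class Y.mtopology (p x0) (p \<circ> q)"
    by (auto simp: carrier_pi1 p_star_class)
  have "\<mu> g = \<one>"
    unfolding q(2) using q(1) base
    by (intro \<mu>_class[where v = q] based_loops_compose[OF continuous_map_p] lift_path) (auto simp: based_loops_def act_one)
  then show "g \<in> kernel \<pi>Y A \<mu>"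
    using q based_loops_compose[OF continuous_map_p q(1)] by (auto simp: kernel_def carrier_pi1)
next
  fix g assume g: "g \<in> kernel \<pi>Y A \<mu>"
  then obtain u where u: "u \<in> based_loops Y.mtopology (p x0)" "g = loop_class Y.mtopology (p x0) u"
    by (auto simp: carrier_pi1 kernel_def)
  obtain v a where v: "lift u v" "a \<in> carrier A" "v 1 = act a x0"
    using loop_lift_exists[OF u(1)] .
  have "a = \<one>"
    using \<mu>_class[OF u(1) v] g u(2) by (simp add: kernel_def)
  then have vl: "v \<in> based_loops X.mtopology x0"
    using v base by (simp add: based_loops_def lift_def act_one)
  have "loop_homotopic Y.mtopology (p x0) u (p \<circ> v)"
    using v(1) by (intro based_loops_cong[OF u(1)]) (simp add: lift_def)
  then have "g = p_star (loop_class X.mtopology x0 v)"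
    using loop_class_eq_iff[OF u(1)] u(2) vl by (simp add: p_star_class)
  then show "g \<in> p_star ` carrier \<pi>X"
    using vl by (auto simp: carrier_pi1)
qed

text \<open>
  A geodesic of \<open>X\<close> between two points of a fibre becomes a loop in \<open>Y\<close>, no longer than the geodesic.
\<close>

lemma geodesic_loop:
  assumes z: "z \<in> carrier A"
  obtains u where "u \<in> based_loops Y.mtopology (p x0)" "u ` {0..1} \<subseteq> Y.mcball (p x0) (dA \<one> z)"
    "\<mu> (loop_class Y.mtopology (p x0) u) = z"
proof -
  obtain v where v: "pathin X.mtopology v" "v 0 = x0" "v 1 = act z x0"
      "v ` {0..1} \<subseteq> X.mcball x0 (dX x0 (act z x0))"
    using geodesic[OF act_closed[OF z base]] by blast
  have d: "dX x0 (act z x0) = dA \<one> z"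
    using act_dist[of \<one> z x0] z base by (simp add: act_one)
  have u: "p \<circ> v \<in> based_loops Y.mtopology (p x0)"
    using v z base p_act[of z x0] continuous_map_p
    by (auto simp: based_loops_def pathin_def intro: continuous_map_compose)
  moreover have "(p \<circ> v) ` {0..1} \<subseteq> Y.mcball (p x0) (dA \<one> z)"
  proof (rule image_subsetI)
    fix t :: real assume "t \<in> {0..1}"
    then have "v t \<in> X.mcball x0 (dA \<one> z)"
      using v(4) unfolding d image_subset_iff by blast
    then show "(p \<circ> v) t \<in> Y.mcball (p x0) (dA \<one> z)"
      using p_dist[of x0 "v t"] p_closed by auto
  qed
  moreover have "\<mu> (loop_class Y.mtopology (p x0) (p \<circ> v)) = z"
    by (rule \<mu>_class[OF u lift_path[OF v(1,2)] z v(3)])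
  ultimately show ?thesis
    using that by blast
qed

lemma \<mu>_surj: "\<mu> ` carrier \<pi>Y = carrier A"
proof (intro subset_antisym subsetI)
  fix z assume "z \<in> carrier A"
  then obtain u where "u \<in> based_loops Y.mtopology (p x0)" "\<mu> (loop_class Y.mtopology (p x0) u) = z"
    by (rule geodesic_loop)
  then show "z \<in> \<mu> ` carrier \<pi>Y"
    by (auto simp: carrier_pi1)
qed auto


subsection \<open>Comparison of the metrics\<close>

lemmas base_Y = p_closed[OF base]

text \<open>
  Compare the lift of the loop with the constant lift of the constant loop.
\<close>

lemma \<mu>_small_loop:
  assumes u: "u \<in> based_loops Y.mtopology (p x0)" and small: "u ` {0..1} \<subseteq> Y.mcball (p x0) \<epsilon>"
  shows "dA \<one> (\<mu> (loop_class Y.mtopology (p x0) u)) \<le> 3 * \<epsilon>"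
proof -
  obtain v a where v: "lift u v" "a \<in> carrier A" "v 1 = act a x0"
    using loop_lift_exists[OF u] .
  have "dY (p x0) (u t) \<le> \<epsilon>" if "t \<in> {0..1}" for t
    using subsetD[OF small imageI[OF that]] by simp
  then have "dX ((\<lambda>t. x0) 1) (v 1) \<le> 3 * \<epsilon>"
    using base by (intro lifts_close[OF _ v(1)]) (auto simp: lift_def pathin_const)
  then show ?thesis
    using \<mu>_class[OF u v] v act_dist[of \<one> a x0] base by (simp add: act_one)
qed

text \<open>
  Conjugation is invisible in the abelian group \<open>A\<close>, and balls around the identity of an
  ultrametric group are subgroups: it suffices to bound \<open>\<mu>\<close> on small loops.
\<close>

lemma \<mu>_ball_subgroup:
  assumes "g \<in> pi1_ball_subgroup Y dY (p x0) \<epsilon>" "\<epsilon> \<ge> 0"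
  shows "dA \<one> (\<mu> g) \<le> 3 * \<epsilon>"
proof -
  let ?H = "{g \<in> carrier \<pi>Y. dA \<one> (\<mu> g) \<le> 3 * \<epsilon>}"
  have "subgroup ?H \<pi>Y"
  proof (rule \<pi>Y.subgroupI)
    show "?H \<noteq> {}"
      using \<open>\<epsilon> \<ge> 0\<close> by (auto intro!: exI[of _ "\<one>\<^bsub>\<pi>Y\<^esub>"] simp: dA_refl)
    show "inv\<^bsub>\<pi>Y\<^esub> g \<in> ?H" if "g \<in> ?H" for g
      using that dA_one_inv by simp
    show "g \<otimes>\<^bsub>\<pi>Y\<^esub> h \<in> ?H" if "g \<in> ?H" "h \<in> ?H" for g h
      using that dA_one_mult[of "\<mu> g" "\<mu> h"] by auto
  qed auto
  moreover have "Y.ball_conjugates (p x0) \<epsilon> \<subseteq> ?H"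
  proof
    fix g assume "g \<in> Y.ball_conjugates (p x0) \<epsilon>"
    then obtain c \<gamma> where g: "g = loop_class Y.mtopology (p x0) c \<otimes>\<^bsub>\<pi>Y\<^esub> loop_class Y.mtopology (p x0) \<gamma>
          \<otimes>\<^bsub>\<pi>Y\<^esub> inv\<^bsub>\<pi>Y\<^esub> loop_class Y.mtopology (p x0) c"
      and c: "loop_class Y.mtopology (p x0) c \<in> carrier \<pi>Y"
      and \<gamma>: "\<gamma> \<in> based_loops Y.mtopology (p x0)" "\<gamma> ` {0..1} \<subseteq> Y.mcball (p x0) \<epsilon>"
      using base_Y by (auto simp: Y.ball_conjugates_def carrier_pi1)
    have \<gamma>c: "loop_class Y.mtopology (p x0) \<gamma> \<in> carrier \<pi>Y"
      using \<gamma> by (auto simp: carrier_pi1)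
    have "\<mu> g = \<mu> (loop_class Y.mtopology (p x0) \<gamma>)"
      unfolding g using c \<gamma>c by (simp add: A.m_comm A.inv_solve_left' A.m_assoc)
    then show "g \<in> ?H"
      using c \<gamma>c g \<mu>_small_loop[OF \<gamma>] by simp
  qed
  ultimately show ?thesis
    using assms(1) \<pi>Y.generate_subgroup_incl unfolding Y.pi1_ball_subgroup_eq_generate[OF base_Y] by blast
qed

lemma \<mu>_le_length:
  assumes "g \<in> carrier \<pi>Y" shows "dA \<one> (\<mu> g) \<le> 3 * pi1_length Y dY (p x0) g"
proof -
  have "dA \<one> (\<mu> g) / 3 \<le> pi1_length Y dY (p x0) g"
  proof (rule dense_ge)
    fix \<epsilon> assume \<epsilon>: "pi1_length Y dY (p x0) g < \<epsilon>"
    then have "g \<in> pi1_ball_subgroup Y dY (p x0) \<epsilon>"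
      using Y.pi1_length_less[OF base_Y assms] by blast
    moreover have "\<epsilon> \<ge> 0"
      using \<epsilon> Y.pi1_length_nonneg[OF base_Y assms] by simp
    ultimately show "dA \<one> (\<mu> g) / 3 \<le> \<epsilon>"
      using \<mu>_ball_subgroup[of g \<epsilon>] by simp
  qed
  then show ?thesis by simp
qed

text \<open>
  Divide \<open>g\<close> by a loop of size \<open>dA \<one> (\<mu> g)\<close> with the same endpoint. If that size is \<open>0\<close> there
  is no ball of positive radius to put the loop into, but then \<open>g\<close> itself lies in the kernel.
\<close>

lemma kernel_close:
  assumes g: "g \<in> carrier \<pi>Y"
  shows "\<exists>k\<in>kernel \<pi>Y A \<mu>. pi1_dist Y dY (p x0) g k \<le> dA \<one> (\<mu> g)"
proof (cases "dA \<one> (\<mu> g) = 0")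
  case True
  then have "\<mu> g = \<one>"
    using dA_one_eq_0 g by simp
  moreover have "pi1_dist Y dY (p x0) g g = 0"
    using Y.metric_group_pi1[OF base_Y] g by (simp add: metric_group_def)
  ultimately show ?thesis
    using g True by (auto simp: kernel_def intro!: bexI[of _ g])
next
  case False
  then have pos: "dA \<one> (\<mu> g) > 0"
    using dA_nonneg[of \<one> "\<mu> g"] g by simp
  obtain u where u: "u \<in> based_loops Y.mtopology (p x0)" "u ` {0..1} \<subseteq> Y.mcball (p x0) (dA \<one> (\<mu> g))"
    "\<mu> (loop_class Y.mtopology (p x0) u) = \<mu> g"
    by (rule geodesic_loop[of "\<mu> g"]) (use g in auto)
  define c where "c = loop_class Y.mtopology (p x0) u"
  have c: "c \<in> carrier \<pi>Y" "\<mu> c = \<mu> g" "c \<in> pi1_ball_subgroup Y dY (p x0) (dA \<one> (\<mu> g))"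
    using u Y.loop_class_in_pi1_ball_subgroup[OF base_Y u(1,2)] by (auto simp: c_def carrier_pi1)
  have "g \<otimes>\<^bsub>\<pi>Y\<^esub> inv\<^bsub>\<pi>Y\<^esub> c \<in> kernel \<pi>Y A \<mu>"
    using g c by (simp add: kernel_def)
  moreover have "pi1_dist Y dY (p x0) g (g \<otimes>\<^bsub>\<pi>Y\<^esub> inv\<^bsub>\<pi>Y\<^esub> c) = pi1_length Y dY (p x0) c"
    using g c Y.pi1_length_inv[OF base_Y c(1)] by (simp add: Y.pi1_dist_eq[OF base_Y] \<pi>Y.inv_solve_left' flip: \<pi>Y.m_assoc)
  ultimately show ?thesis
    using Y.pi1_length_le[OF base_Y c(3) pos] by metis
qed

text \<open>
  Since \<open>p\<close> does not increase distances, it maps conjugates of loops in a ball to such conjugates.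
\<close>

lemma p_star_length:
  assumes g: "g \<in> carrier \<pi>X"
  shows "pi1_length Y dY (p x0) (p_star g) \<le> pi1_length X dX x0 g"
proof (rule dense_ge)
  fix \<epsilon> assume \<epsilon>: "pi1_length X dX x0 g < \<epsilon>"
  let ?L = "pi1_ball_subgroup Y dY (p x0) \<epsilon>"
  let ?H = "{g \<in> carrier \<pi>X. p_star g \<in> ?L}"
  note L = Y.subgroup_pi1_ball_subgroup[OF base_Y, of \<epsilon>]
  have "subgroup ?H \<pi>X"
    by (rule \<pi>X.subgroupI)
      (auto simp: subgroup.one_closed[OF L] subgroup.m_inv_closed[OF L] subgroup.m_closed[OF L] intro!: exI[of _ "\<one>\<^bsub>\<pi>X\<^esub>"])
  moreover have "X.ball_conjugates x0 \<epsilon> \<subseteq> ?H"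
  proof
    fix g assume "g \<in> X.ball_conjugates x0 \<epsilon>"
    then obtain c \<gamma> where g: "g = loop_class X.mtopology x0 c \<otimes>\<^bsub>\<pi>X\<^esub> loop_class X.mtopology x0 \<gamma>
          \<otimes>\<^bsub>\<pi>X\<^esub> inv\<^bsub>\<pi>X\<^esub> loop_class X.mtopology x0 c"
      and c: "c \<in> based_loops X.mtopology x0"
      and \<gamma>: "\<gamma> \<in> based_loops X.mtopology x0" "\<gamma> ` {0..1} \<subseteq> X.mcball x0 \<epsilon>"
      using base by (auto simp: X.ball_conjugates_def)
    have carr: "loop_class X.mtopology x0 c \<in> carrier \<pi>X" "loop_class X.mtopology x0 \<gamma> \<in> carrier \<pi>X"
      using c \<gamma> by (auto simp: carrier_pi1)
    have "(p \<circ> \<gamma>) ` {0..1} \<subseteq> Y.mcball (p x0) \<epsilon>"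
    proof (rule image_subsetI)
      fix t :: real assume "t \<in> {0..1}"
      then have "\<gamma> t \<in> X.mcball x0 \<epsilon>"
        using \<gamma>(2) unfolding image_subset_iff by blast
      then show "(p \<circ> \<gamma>) t \<in> Y.mcball (p x0) \<epsilon>"
        using p_dist[of x0 "\<gamma> t"] p_closed by auto
    qed
    moreover have "p \<circ> c \<in> based_loops Y.mtopology (p x0)" "p \<circ> \<gamma> \<in> based_loops Y.mtopology (p x0)"
      using based_loops_compose[OF continuous_map_p] c \<gamma> by auto
    moreover have "p_star g = loop_class Y.mtopology (p x0) (p \<circ> c) \<otimes>\<^bsub>\<pi>Y\<^esub> loop_class Y.mtopology (p x0) (p \<circ> \<gamma>)
          \<otimes>\<^bsub>\<pi>Y\<^esub> inv\<^bsub>\<pi>Y\<^esub> loop_class Y.mtopology (p x0) (p \<circ> c)"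
      unfolding g using carr c \<gamma> by (simp add: p_star_class)
    ultimately have "p_star g \<in> Y.ball_conjugates (p x0) \<epsilon>"
      unfolding Y.ball_conjugates_def[OF base_Y] by blast
    then show "g \<in> ?H"
      using carr unfolding Y.pi1_ball_subgroup_eq_generate[OF base_Y] g by (auto intro: generate.incl)
  qed
  moreover have "g \<in> pi1_ball_subgroup X dX x0 \<epsilon>"
    using \<epsilon> X.pi1_length_less[OF base g] by blast
  ultimately have "p_star g \<in> ?L"
    using \<pi>X.generate_subgroup_incl unfolding X.pi1_ball_subgroup_eq_generate[OF base] by blast
  moreover have "\<epsilon> > 0"
    using \<epsilon> X.pi1_length_nonneg[OF base g] by simp
  ultimately show "pi1_length Y dY (p x0) (p_star g) \<le> \<epsilon>"
    by (intro Y.pi1_length_le[OF base_Y])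
qed

text \<open>
  For \<open>k\<close> in the kernel, \<open>\<mu>\<close> takes \<open>g\<^sup>-\<^sup>1 k\<close> to the inverse of \<open>\<mu> g\<close>, which has the same distance to
  the identity, so the bound for \<open>\<mu>\<close> by the length is a bound by the distance to the kernel.
\<close>

theorem Lipschitz_exact_fundamental_groups:
  "Lipschitz_exact \<pi>X (pi1_dist X dX x0) \<pi>Y (pi1_dist Y dY (p x0)) A dA p_star \<mu>"
proof -
  let ?K = "kernel \<pi>Y A \<mu>" and ?d = "pi1_dist Y dY (p x0)"
  note mg = Y.metric_group_pi1[OF base_Y]
  have "?d (p_star x) (p_star y) \<le> 1 * pi1_dist X dX x0 x y" if "x \<in> carrier \<pi>X" "y \<in> carrier \<pi>X" for x y
    using p_star_length[of "inv\<^bsub>\<pi>X\<^esub> x \<otimes>\<^bsub>\<pi>X\<^esub> y"] that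
    by (simp add: X.pi1_dist_eq[OF base] Y.pi1_dist_eq[OF base_Y])
  then have lip: "\<exists>L\<ge>0. \<forall>x\<in>carrier \<pi>X. \<forall>y\<in>carrier \<pi>X. ?d (p_star x) (p_star y) \<le> L * pi1_dist X dX x0 x y"
    by (intro exI[of _ 1]) simp
  have "1 * (INF k\<in>?K. ?d g k) \<le> dA \<one> (\<mu> g) \<and> dA \<one> (\<mu> g) \<le> 3 * (INF k\<in>?K. ?d g k)" if g: "g \<in> carrier \<pi>Y" for g
  proof
    obtain k where k: "k \<in> ?K" "?d g k \<le> dA \<one> (\<mu> g)"
      using kernel_close[OF g] by blast
    have "bdd_below (?d g ` ?K)"
      using mg g by (intro bdd_belowI2[of _ 0]) (auto simp: metric_group_def kernel_def)
    then show "1 * (INF k\<in>?K. ?d g k) \<le> dA \<one> (\<mu> g)"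
      using cINF_lower2[where f = "?d g", OF _ k] by simp
    have "dA \<one> (\<mu> g) / 3 \<le> ?d g k" if "k \<in> ?K" for k
    proof -
      have "k \<in> carrier \<pi>Y" "\<mu> k = \<one>"
        using that by (auto simp: kernel_def)
      then have "\<mu> (inv\<^bsub>\<pi>Y\<^esub> g \<otimes>\<^bsub>\<pi>Y\<^esub> k) = inv (\<mu> g)"
        using g by simp
      then show ?thesis
        using \<mu>_le_length[of "inv\<^bsub>\<pi>Y\<^esub> g \<otimes>\<^bsub>\<pi>Y\<^esub> k"] dA_one_inv[of "\<mu> g"] g \<open>k \<in> carrier \<pi>Y\<close>
        by (simp add: Y.pi1_dist_eq[OF base_Y])
    qed
    then have "dA \<one> (\<mu> g) / 3 \<le> (INF k\<in>?K. ?d g k)"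
      using k(1) by (intro cINF_greatest) auto
    then show "dA \<one> (\<mu> g) \<le> 3 * (INF k\<in>?K. ?d g k)"
      by simp
  qed
  then have cmp: "\<exists>C>0. \<exists>C'>0. \<forall>g\<in>carrier \<pi>Y. C * (INF k\<in>?K. ?d g k) \<le> dA \<one> (\<mu> g) \<and> dA \<one> (\<mu> g) \<le> C' * (INF k\<in>?K. ?d g k)"
    by (intro exI[of _ 1] exI[of _ 3] conjI) auto
  show ?thesis
    unfolding Lipschitz_exact_def short_exact_def mon_def epi_def
    using lip cmp X.metric_group_pi1[OF base] mg metric_group_A ps.homh p_star_inj \<mu>_hom \<mu>_surj p_star_image
    by blast
qed

end

section \<open>Asymptotic cones\<close>

text \<open>
  A finite upper limit of real numbers bounds the whole sequence, not only a tail of it. So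
  membership in a precone is a bound that holds at all indices; at index \<open>0\<close> the quotient by
  \<open>real 0\<close> is \<open>0\<close>.
\<close>

lemma limsup_real_finite_iff: "limsup (\<lambda>n. ereal (f n)) < \<infinity> \<longleftrightarrow> (\<exists>C. \<forall>n. f n \<le> C)"
proof
  assume "limsup (\<lambda>n. ereal (f n)) < \<infinity>"
  then obtain r :: real where "limsup (\<lambda>n. ereal (f n)) < r"
    using less_PInf_Ex_of_nat by (metis ereal_less_PInfty less_ereal.simps(1) ereal_dense2)
  then have "eventually (\<lambda>n. ereal (f n) < r) sequentially"
    by (rule Limsup_lessD)
  then obtain N where N: "\<And>n. n \<ge> N \<Longrightarrow> f n < r"
    by (auto simp: eventually_sequentially)
  have "f n \<le> Max (insert r (f ` {..<N}))" for n
  proof (cases "n < N")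
    case True
    then show ?thesis by (intro Max_ge) auto
  next
    case False
    then have "f n \<le> r" using N[of n] by simp
    also have "r \<le> Max (insert r (f ` {..<N}))" by (intro Max_ge) auto
    finally show ?thesis .
  qed
  then show "\<exists>C. \<forall>n. f n \<le> C" by blast
next
  assume "\<exists>C. \<forall>n. f n \<le> C"
  then obtain C where "\<And>n. f n \<le> C" by blast
  then have "limsup (\<lambda>n. ereal (f n)) \<le> ereal C"
    by (intro Limsup_bounded) auto
  also have "\<dots> < \<infinity>" by simp
  finally show "limsup (\<lambda>n. ereal (f n)) < \<infinity>" .
qed

lemma nonprincipal_ultrafilter_le_sequentially:
  assumes "nonprincipal_ultrafilter \<omega>" shows "\<omega> \<le> sequentially"
proof -
  have ne: "eventually (\<lambda>n. n \<noteq> m) \<omega>" for m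
    using assms unfolding nonprincipal_ultrafilter_def by metis
  have "eventually (\<lambda>n. m \<le> n) \<omega>" for m
  proof (induction m)
    case (Suc m)
    then show ?case
      using ne[of m] by eventually_elim auto
  qed auto
  then show ?thesis
    unfolding le_filter_def eventually_sequentially by (metis (mono_tags, lifting) eventually_mono)
qed

text \<open>
  The image filter lives on a compact interval, so it has a cluster point, and an ultrafilter
  converges to its cluster points.
\<close>

lemma ultrafilter_tendsto_bounded:
  fixes f :: "nat \<Rightarrow> real"
  assumes \<omega>: "nonprincipal_ultrafilter \<omega>" and bnd: "\<And>n. \<bar>f n\<bar> \<le> C"
  shows "\<exists>l. (f \<longlongrightarrow> l) \<omega>"
proof -
  have "compact {-C..C}" by simp
  moreover have "filtermap f \<omega> \<noteq> bot"
    using \<omega> by (simp add: nonprincipal_ultrafilter_def filtermap_bot_iff)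
  moreover have "eventually (\<lambda>x. x \<in> {-C..C}) (filtermap f \<omega>)"
    using bnd by (auto simp: eventually_filtermap abs_le_iff minus_le_iff)
  ultimately obtain l where l: "inf (nhds l) (filtermap f \<omega>) \<noteq> bot"
    unfolding compact_filter by blast
  have "eventually (\<lambda>n. f n \<in> U) \<omega>" if U: "open U" "l \<in> U" for U
  proof (rule ccontr)
    assume "\<not> eventually (\<lambda>n. f n \<in> U) \<omega>"
    then have "eventually (\<lambda>n. f n \<notin> U) \<omega>"
      using \<omega> unfolding nonprincipal_ultrafilter_def by blast
    then have "eventually (\<lambda>x. x \<notin> U) (filtermap f \<omega>)"
      by (simp add: eventually_filtermap)
    moreover have "eventually (\<lambda>x. x \<in> U) (nhds l)"
      using U by (auto simp: eventually_nhds)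
    ultimately have "eventually (\<lambda>x. False) (inf (nhds l) (filtermap f \<omega>))"
      unfolding eventually_inf by blast
    then show False
      using l by (simp add: trivial_limit_def)
  qed
  then show ?thesis
    by (auto simp: tendsto_def)
qed

text \<open>
  The axioms of a pseudo-metric are required on \<open>M\<close> only: word metrics are unconstrained outside the
  carrier of the group, where inverses are arbitrary.
\<close>

locale asymptotic_cone =
  fixes \<omega> :: "nat filter" and M :: "'a set" and d :: "'a \<Rightarrow> 'a \<Rightarrow> real" and x0 :: 'a
  assumes ultrafilter: "nonprincipal_ultrafilter \<omega>"
    and base: "x0 \<in> M"
    and nonneg: "\<lbrakk>x \<in> M; y \<in> M\<rbrakk> \<Longrightarrow> 0 \<le> d x y"
    and refl: "x \<in> M \<Longrightarrow> d x x = 0"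
    and commute: "\<lbrakk>x \<in> M; y \<in> M\<rbrakk> \<Longrightarrow> d x y = d y x"
    and triangle: "\<lbrakk>x \<in> M; y \<in> M; z \<in> M\<rbrakk> \<Longrightarrow> d x z \<le> d x y + d y z"
begin

abbreviation "pre \<equiv> precone M d x0"
abbreviation "pd \<equiv> precone_dist \<omega> d"
abbreviation "cls \<equiv> cone_class \<omega> M d x0"
abbreviation "acone \<equiv> asymp_cone \<omega> M d x0"
abbreviation "cd \<equiv> cone_dist \<omega> M d x0"

lemma omega_ne_bot [simp]: "\<omega> \<noteq> bot"
  using ultrafilter by (simp add: nonprincipal_ultrafilter_def)

lemma omega_le: "\<omega> \<le> sequentially"
  by (rule nonprincipal_ultrafilter_le_sequentially[OF ultrafilter])

lemma tendsto_inverse_nat: "((\<lambda>n. 1 / real n) \<longlongrightarrow> 0) \<omega>"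
  by (rule tendsto_mono[OF omega_le lim_1_over_n])

lemma pre_iff: "x \<in> pre \<longleftrightarrow> (\<forall>n. x n \<in> M) \<and> (\<exists>C. \<forall>n. d (x n) x0 / real n \<le> C)"
  unfolding precone_def mem_Collect_eq limsup_real_finite_iff ..

lemma pre_in: "x \<in> pre \<Longrightarrow> x n \<in> M"
  by (simp add: precone_def)

lemma pre_base: "(\<lambda>n. x0) \<in> pre"
  using base by (auto simp: pre_iff refl)

lemma pre_bound:
  assumes "x \<in> pre" "y \<in> pre" shows "\<exists>C. \<forall>n. \<bar>d (x n) (y n) / real n\<bar> \<le> C"
proof -
  obtain C D where CD: "\<And>n. d (x n) x0 / real n \<le> C" "\<And>n. d (y n) x0 / real n \<le> D"
    using assms by (auto simp: pre_iff)
  have "\<bar>d (x n) (y n) / real n\<bar> \<le> C + D" for n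
  proof -
    have "d (x n) (y n) / real n \<le> d (x n) x0 / real n + d (y n) x0 / real n"
      using triangle[of "x n" x0 "y n"] commute[of "y n" x0] base pre_in assms
      by (simp add: add_divide_distrib[symmetric] divide_right_mono)
    then show ?thesis
      using CD[of n] nonneg[of "x n" "y n"] pre_in assms by simp
  qed
  then show ?thesis
    by blast
qed

lemma pd_tendsto:
  assumes "x \<in> pre" "y \<in> pre" shows "((\<lambda>n. d (x n) (y n) / real n) \<longlongrightarrow> pd x y) \<omega>"
proof -
  obtain C where "\<And>n. \<bar>d (x n) (y n) / real n\<bar> \<le> C"
    using pre_bound[OF assms] by blast
  then obtain l where "((\<lambda>n. d (x n) (y n) / real n) \<longlongrightarrow> l) \<omega>"
    using ultrafilter_tendsto_bounded[OF ultrafilter, of "\<lambda>n. d (x n) (y n) / real n" C] by blast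
  then show ?thesis
    unfolding precone_dist_def by (simp add: tendsto_Lim)
qed

lemma pd_le:
  assumes "x \<in> pre" "y \<in> pre" "(f \<longlongrightarrow> l) \<omega>" "eventually (\<lambda>n. d (x n) (y n) / real n \<le> f n) \<omega>"
  shows "pd x y \<le> l"
  by (rule tendsto_le[OF omega_ne_bot assms(3) pd_tendsto[OF assms(1,2)] assms(4)])

lemma pd_nonneg: "\<lbrakk>x \<in> pre; y \<in> pre\<rbrakk> \<Longrightarrow> 0 \<le> pd x y"
  by (rule tendsto_lowerbound[OF pd_tendsto]) (auto simp: nonneg pre_in)

lemma pd_refl: "x \<in> pre \<Longrightarrow> pd x x = 0"
  using pd_tendsto[of x x] by (simp add: refl pre_in tendsto_const_iff)

lemma pd_commute: "\<lbrakk>x \<in> pre; y \<in> pre\<rbrakk> \<Longrightarrow> pd x y = pd y x"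
  unfolding precone_dist_def by (simp add: commute pre_in)

lemma pd_triangle:
  assumes "x \<in> pre" "y \<in> pre" "z \<in> pre" shows "pd x z \<le> pd x y + pd y z"
proof (rule pd_le[OF assms(1,3) tendsto_add[OF pd_tendsto[OF assms(1,2)] pd_tendsto[OF assms(2,3)]]])
  show "eventually (\<lambda>n. d (x n) (z n) / real n \<le> d (x n) (y n) / real n + d (y n) (z n) / real n) \<omega>"
    using triangle pre_in assms by (simp add: add_divide_distrib[symmetric] divide_right_mono)
qed

lemma mem_cls: "y \<in> cls x \<longleftrightarrow> y \<in> pre \<and> pd x y = 0"
  by (simp add: cone_class_def)

lemma cls_self: "x \<in> pre \<Longrightarrow> x \<in> cls x"
  by (simp add: mem_cls pd_refl)

lemma cls_eq_iff:
  assumes "x \<in> pre" "y \<in> pre" shows "cls x = cls y \<longleftrightarrow> pd x y = 0"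
proof
  assume "cls x = cls y"
  then show "pd x y = 0"
    using cls_self[OF assms(2)] mem_cls by blast
next
  assume "pd x y = 0"
  then have "pd x z = 0 \<longleftrightarrow> pd y z = 0" if "z \<in> pre" for z
    using pd_triangle[OF assms(1,2) that] pd_triangle[OF assms(2,1) that] pd_commute[OF assms]
      pd_nonneg[OF assms(1) that] pd_nonneg[OF assms(2) that] by auto
  then show "cls x = cls y"
    by (auto simp: mem_cls)
qed

lemma cls_in_cone: "x \<in> pre \<Longrightarrow> cls x \<in> acone"
  by (simp add: asymp_cone_def)

lemma coneE:
  assumes "A \<in> acone" obtains x where "x \<in> pre" "A = cls x"
  using assms by (auto simp: asymp_cone_def)

lemma cd_cls:
  assumes "x \<in> pre" "y \<in> pre" shows "cd (cls x) (cls y) = pd x y"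
proof -
  have "pd x' y' = pd x y" if "x' \<in> cls x" "y' \<in> cls y" for x' y'
  proof -
    have "x' \<in> pre" "y' \<in> pre" "pd x x' = 0" "pd y y' = 0"
      using that by (auto simp: mem_cls)
    then show ?thesis
      using assms pd_triangle[of x' x y'] pd_triangle[of x y y'] pd_triangle[of x x' y] pd_triangle[of x' y' y]
        pd_commute[of x' x] pd_commute[of y' y] by auto
  qed
  then have "(THE r. \<exists>x'\<in>cls x. \<exists>y'\<in>cls y. r = pd x' y') = pd x y"
    using cls_self assms by (intro the_equality) (blast, metis)
  then show ?thesis
    using assms by (simp add: cone_dist_def cls_in_cone)
qed

lemma Metric_space_cone: "Metric_space acone cd"
proof
  fix A B
  show "0 \<le> cd A B" "cd A B = cd B A"
  proof (atomize (full), cases "A \<in> acone \<and> B \<in> acone")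
    case True
    then show "0 \<le> cd A B \<and> cd A B = cd B A"
      by (metis cd_cls coneE pd_commute pd_nonneg)
  qed (auto simp: cone_dist_def)
  assume A: "A \<in> acone" and B: "B \<in> acone"
  then show "cd A B = 0 \<longleftrightarrow> A = B"
    by (metis cd_cls cls_eq_iff coneE)
  fix D assume D: "D \<in> acone"
  obtain x y z where "x \<in> pre" "A = cls x" "y \<in> pre" "B = cls y" "z \<in> pre" "D = cls z"
    using A B D by (metis coneE)
  then show "cd A D \<le> cd A B + cd B D"
    by (simp add: cd_cls pd_triangle)
qed

sublocale C: Metric_space acone cd
  by (rule Metric_space_cone)

text \<open>
  A diagonal argument: the representatives of the first \<open>m\<close> terms of a Cauchy sequence realize
  their limit distances up to \<open>1 / (m + 1)\<close> for almost all \<open>n\<close>, and at \<open>n\<close> the representative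
  number \<open>m\<close> is taken for the largest \<open>m \<le> n\<close> of this kind. The bound \<open>m \<le> n\<close> is harmless since
  the ultrafilter is not principal.
\<close>

theorem mcomplete_cone: "C.mcomplete"
  unfolding C.mcomplete_def
proof (intro allI impI)
  fix \<sigma> assume \<sigma>: "C.MCauchy \<sigma>"
  then have "\<forall>k. \<exists>x\<in>pre. \<sigma> k = cls x"
    unfolding C.MCauchy_def by (meson coneE range_subsetD)
  then obtain x where x: "\<And>k. x k \<in> pre" "\<And>k. \<sigma> k = cls (x k)"
    by metis
  have cauchy: "\<exists>N. \<forall>i j. N \<le> i \<longrightarrow> N \<le> j \<longrightarrow> pd (x i) (x j) < \<epsilon>" if "\<epsilon> > 0" for \<epsilon>
    using \<sigma> that unfolding C.MCauchy_def by (simp add: x cd_cls)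
  define good where "good m n \<longleftrightarrow> (\<forall>i\<in>{..m}. \<forall>j\<in>{..m}. d (x i n) (x j n) / real n \<le> pd (x i) (x j) + 1 / real (Suc m))" for m n
  have good: "eventually (good m) \<omega>" for m
    unfolding good_def
  proof (intro eventually_ball_finite ballI finite_atMost)
    fix i j
    have "eventually (\<lambda>n. d (x i n) (x j n) / real n < pd (x i) (x j) + 1 / real (Suc m)) \<omega>"
      by (rule order_tendstoD[OF pd_tendsto[OF x(1) x(1)]]) simp
    then show "eventually (\<lambda>n. d (x i n) (x j n) / real n \<le> pd (x i) (x j) + 1 / real (Suc m)) \<omega>"
      by (rule eventually_mono) simp
  qed
  \<comment> \<open>The element \<open>0\<close> only makes the maximum exist for the few \<open>n\<close> that are good for no \<open>m\<close>.\<close>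
  define k where "k n = Max (insert 0 {m\<in>{..n}. good m n})" for n
  define z where "z n = x (k n) n" for n
  have zM: "z n \<in> M" for n
    by (simp add: z_def pre_in x)
  have close: "eventually (\<lambda>n. d (x m n) (z n) / real n \<le> \<epsilon>) \<omega>"
    if \<epsilon>: "1 / real (Suc m) \<le> \<epsilon> / 2" "\<And>j. j \<ge> m \<Longrightarrow> pd (x m) (x j) \<le> \<epsilon> / 2" for m \<epsilon>
  proof -
    have "eventually (\<lambda>n. m \<le> n) \<omega>"
      using omega_le eventually_ge_at_top by (rule filter_leD)
    with good[of m] show ?thesis
    proof eventually_elim
      case (elim n)
      have "m \<le> k n"
        unfolding k_def using elim by (intro Max_ge) auto
      have "k n \<in> insert 0 {m\<in>{..n}. good m n}"
        unfolding k_def by (rule Max_in) auto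
      then have "good (k n) n"
        using \<open>m \<le> k n\<close> elim by auto
      then have "d (x m n) (z n) / real n \<le> pd (x m) (x (k n)) + 1 / real (Suc (k n))"
        using \<open>m \<le> k n\<close> unfolding good_def z_def by simp
      also have "\<dots> \<le> \<epsilon> / 2 + 1 / real (Suc m)"
        using \<epsilon>(2)[OF \<open>m \<le> k n\<close>] \<open>m \<le> k n\<close> by (intro add_mono) (auto simp: frac_le)
      finally show ?case
        using \<epsilon>(1) by simp
    qed
  qed
  have close': "\<exists>N. \<forall>m\<ge>N. eventually (\<lambda>n. d (x m n) (z n) / real n \<le> \<epsilon>) \<omega>" if "\<epsilon> > 0" for \<epsilon>
  proof -
    obtain N where N: "\<And>i j. \<lbrakk>N \<le> i; N \<le> j\<rbrakk> \<Longrightarrow> pd (x i) (x j) < \<epsilon> / 2"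
      using cauchy[of "\<epsilon> / 2"] \<open>\<epsilon> > 0\<close> by auto
    obtain N' where N': "1 / real (Suc N') < \<epsilon> / 2"
      using nat_approx_posE[of "\<epsilon> / 2"] \<open>\<epsilon> > 0\<close> by auto
    have "1 / real (Suc m) \<le> \<epsilon> / 2" if "m \<ge> N'" for m
    proof -
      have "1 / real (Suc m) \<le> 1 / real (Suc N')"
        using that by (intro divide_left_mono) auto
      then show ?thesis using N' by linarith
    qed
    then show ?thesis
      using N by (intro exI[of _ "max N N'"] allI impI close) (auto simp: less_imp_le)
  qed
  obtain N where N: "eventually (\<lambda>n. d (x N n) (z n) / real n \<le> 1) \<omega>"
    using close'[of 1] by auto
  obtain B where B: "\<And>n. d (x N n) x0 / real n \<le> B"
    using x(1)[of N] by (auto simp: pre_iff)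
  \<comment> \<open>The diagonal sequence satisfies the growth bound for almost all \<open>n\<close>, while a precone wants it
    for all: the exceptional terms are replaced by the base-point.\<close>
  define y where "y n = (if d (z n) x0 / real n \<le> B + 1 then z n else x0)" for n
  have y: "y \<in> pre"
    using zM base by (auto simp: pre_iff y_def refl intro!: exI[of _ "max 0 (B + 1)"])
  have yz: "eventually (\<lambda>n. y n = z n) \<omega>"
    using N
  proof eventually_elim
    case (elim n)
    have "d (z n) x0 / real n \<le> d (x N n) (z n) / real n + d (x N n) x0 / real n"
      using triangle[of "z n" "x N n" x0] commute[of "z n" "x N n"] zM pre_in[OF x(1)] base
      by (simp add: add_divide_distrib[symmetric] divide_right_mono)
    then show ?case
      using elim B[of n] by (simp add: y_def)
  qed
  have "\<exists>N. \<forall>m\<ge>N. \<sigma> m \<in> acone \<and> cd (\<sigma> m) (cls y) < \<epsilon>" if "\<epsilon> > 0" for \<epsilon>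
  proof -
    obtain N where N: "\<And>m. m \<ge> N \<Longrightarrow> eventually (\<lambda>n. d (x m n) (z n) / real n \<le> \<epsilon> / 2) \<omega>"
      using close'[of "\<epsilon> / 2"] \<open>\<epsilon> > 0\<close> by auto
    have "cd (\<sigma> m) (cls y) < \<epsilon>" if "m \<ge> N" for m
    proof -
      have "pd (x m) y \<le> \<epsilon> / 2"
        by (rule pd_le[OF x(1) y tendsto_const]) (use N[OF that] yz in eventually_elim, simp)
      then show ?thesis
        using \<open>\<epsilon> > 0\<close> by (simp add: x cd_cls y)
    qed
    then show ?thesis
      using x cls_in_cone by metis
  qed
  then show "\<exists>l. limitin C.mtopology \<sigma> l sequentially"
    using cls_in_cone[OF y] unfolding C.limit_metric_sequentially by blast
qed

end

text \<open>
  A non-expanding map between the spaces induces a non-expanding map between their cones, given by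
  any representative.
\<close>

lemma cone_map_cls:
  assumes "asymptotic_cone \<omega> M d x0" "asymptotic_cone \<omega> N e y0"
    and f: "f \<in> M \<rightarrow> N" "f x0 = y0" "\<And>x y. \<lbrakk>x \<in> M; y \<in> M\<rbrakk> \<Longrightarrow> e (f x) (f y) \<le> d x y"
    and x: "x \<in> precone M d x0"
  shows "f \<circ> x \<in> precone N e y0"
    and "cone_map \<omega> N e y0 f (cone_class \<omega> M d x0 x) = cone_class \<omega> N e y0 (f \<circ> x)"
    and "y \<in> precone M d x0 \<Longrightarrow> precone_dist \<omega> e (f \<circ> x) (f \<circ> y) \<le> precone_dist \<omega> d x y"
proof -
  interpret X: asymptotic_cone \<omega> M d x0 by fact
  interpret Y: asymptotic_cone \<omega> N e y0 by fact
  have f_pre: "f \<circ> x \<in> Y.pre" if "x \<in> X.pre" for x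
  proof -
    obtain C where C: "\<And>n. d (x n) x0 / real n \<le> C"
      using \<open>x \<in> X.pre\<close> by (auto simp: X.pre_iff)
    have "e (f (x n)) y0 / real n \<le> C" for n
      using f(3)[OF X.pre_in[OF that, of n] X.base] f(2) C[of n] by (auto intro: order_trans[OF divide_right_mono])
    then show ?thesis
      using f(1) X.pre_in[OF that] by (auto simp: Y.pre_iff)
  qed
  have le: "Y.pd (f \<circ> x) (f \<circ> y) \<le> X.pd x y" if "x \<in> X.pre" "y \<in> X.pre" for x y
    by (intro Y.pd_le[OF f_pre f_pre X.pd_tendsto[OF that]] always_eventually allI)
      (use f(3) X.pre_in that in \<open>auto intro!: divide_right_mono\<close>)
  show "f \<circ> x \<in> Y.pre" "y \<in> X.pre \<Longrightarrow> Y.pd (f \<circ> x) (f \<circ> y) \<le> X.pd x y"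
    using x f_pre le by auto
  have eq: "Y.cls (f \<circ> x') = Y.cls (f \<circ> x)" if "x' \<in> X.cls x" for x'
  proof -
    have x': "x' \<in> X.pre" "X.pd x x' = 0"
      using that by (auto simp: X.mem_cls)
    then have "Y.pd (f \<circ> x') (f \<circ> x) = 0"
      using le[OF x'(1) x] X.pd_commute[OF x x'(1)] Y.pd_nonneg[OF f_pre[OF x'(1)] f_pre[OF x]] by simp
    then show ?thesis
      using Y.cls_eq_iff f_pre x x'(1) by blast
  qed
  have "X.cls x \<noteq> {}"
    using X.cls_self[OF x] by blast
  then show "cone_map \<omega> N e y0 f (X.cls x) = Y.cls (f \<circ> x)"
    unfolding cone_map_def by (rule SUP_eq_const) (rule eq)
qed

section \<open>Word metrics\<close>

locale generated_group = group G for G :: "('a, 'b) monoid_scheme" (structure) +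
  fixes S :: "'a set"
  assumes generates: "generate G S = carrier G"
begin

abbreviation "letters \<equiv> S \<union> m_inv G ` S"
abbreviation "word \<equiv> \<lambda>xs. foldr (\<otimes>) xs \<one>"
abbreviation "len \<equiv> word_length G S"

lemma letters_carrier: "letters \<subseteq> carrier G"
  using generates generate.incl[of _ S G] by auto

lemma word_closed: "set xs \<subseteq> letters \<Longrightarrow> word xs \<in> carrier G"
  using letters_carrier by (induction xs) auto

lemma word_append: "\<lbrakk>set xs \<subseteq> letters; set ys \<subseteq> letters\<rbrakk> \<Longrightarrow> word (xs @ ys) = word xs \<otimes> word ys"
  using letters_carrier by (induction xs) (auto simp: word_closed m_assoc)

text \<open>
  Inverses of letters are letters, so the subgroup generated by \<open>S\<close> consists of words. Hence lengths
  are minima of nonempty sets.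
\<close>

lemma word_exists: "g \<in> carrier G \<Longrightarrow> \<exists>xs. set xs \<subseteq> letters \<and> word xs = g"
  unfolding generates[symmetric]
proof (induction rule: generate.induct)
  case one
  show ?case by (intro exI[of _ "[]"]) auto
next
  case (incl h)
  then have "h \<in> carrier G" "h \<in> letters" using letters_carrier by auto
  then show ?case by (intro exI[of _ "[h]"]) auto
next
  case (inv h)
  then have "inv h \<in> carrier G" "inv h \<in> letters" using letters_carrier by auto
  then show ?case by (intro exI[of _ "[inv h]"]) auto
next
  case (eng g h)
  then obtain xs ys where "set xs \<subseteq> letters" "word xs = g" "set ys \<subseteq> letters" "word ys = h"
    by blast
  then show ?case by (intro exI[of _ "xs @ ys"]) (auto simp: word_append[symmetric])
qed

lemma len_word:
  assumes "g \<in> carrier G" shows "\<exists>xs. length xs = len g \<and> set xs \<subseteq> letters \<and> word xs = g"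
proof -
  obtain xs where "set xs \<subseteq> letters \<and> word xs = g"
    using word_exists[OF assms] by blast
  then have "\<exists>ys. length ys = length xs \<and> set ys \<subseteq> letters \<and> word ys = g"
    by blast
  then show ?thesis
    unfolding word_length_def by (rule LeastI)
qed

lemma len_le: "set xs \<subseteq> letters \<Longrightarrow> len (word xs) \<le> length xs"
  unfolding word_length_def by (rule Least_le) blast

lemma len_one: "len \<one> = 0"
  using len_le[of "[]"] by simp

lemma len_mult:
  assumes "g \<in> carrier G" "h \<in> carrier G" shows "len (g \<otimes> h) \<le> len g + len h"
proof -
  obtain xs ys where xs: "length xs = len g" "set xs \<subseteq> letters" "word xs = g"
    and ys: "length ys = len h" "set ys \<subseteq> letters" "word ys = h"
    using len_word assms by metis
  then show ?thesis
    using len_le[of "xs @ ys"] by (simp add: word_append del: foldr_append)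
qed

lemma word_rev_inv:
  assumes "set xs \<subseteq> letters"
  shows "set (rev (map (m_inv G) xs)) \<subseteq> letters \<and> word (rev (map (m_inv G) xs)) = inv (word xs)"
  using assms
proof (induction xs)
  case (Cons x xs)
  have "inv x \<in> letters"
    using Cons.prems letters_carrier by auto
  then have "set [inv x] \<subseteq> letters" by simp
  moreover have "x \<in> carrier G" "word xs \<in> carrier G"
    using Cons.prems letters_carrier word_closed by auto
  ultimately show ?case
    using Cons word_append[of "rev (map (m_inv G) xs)" "[inv x]"] by (simp add: inv_mult_group)
qed auto

lemma len_inv:
  assumes "g \<in> carrier G" shows "len (inv g) = len g"
proof -
  have "len (inv g) \<le> len g" if "g \<in> carrier G" for g
  proof -
    obtain xs where "length xs = len g" "set xs \<subseteq> letters" "word xs = g"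
      using len_word[OF \<open>g \<in> carrier G\<close>] by blast
    then show ?thesis
      using word_rev_inv[of xs] len_le[of "rev (map (m_inv G) xs)"] by simp
  qed
  from this[OF assms] this[of "inv g"] show ?thesis
    using assms by simp
qed

lemma word_dist_one: "g \<in> carrier G \<Longrightarrow> word_dist G S \<one> g = len g"
  by (simp add: word_dist_def)

lemma word_dist_one': "g \<in> carrier G \<Longrightarrow> word_dist G S g \<one> = len g"
  by (simp add: word_dist_def len_inv)

lemma word_dist_refl: "g \<in> carrier G \<Longrightarrow> word_dist G S g g = 0"
  by (simp add: word_dist_def len_one)

lemma word_dist_left:
  assumes "k \<in> carrier G" "g \<in> carrier G" "h \<in> carrier G"
  shows "word_dist G S (k \<otimes> g) (k \<otimes> h) = word_dist G S g h"
proof -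
  have "inv (k \<otimes> g) \<otimes> (k \<otimes> h) = inv g \<otimes> h"
    using assms by (simp add: inv_mult_group m_assoc flip: m_assoc[of "inv k" k])
  then show ?thesis by (simp add: word_dist_def)
qed

lemma word_dist_commute:
  assumes "g \<in> carrier G" "h \<in> carrier G"
  shows "word_dist G S g h = word_dist G S h g"
  using len_inv[of "inv g \<otimes> h"] assms by (simp add: word_dist_def inv_mult_group)

lemma word_dist_triangle:
  assumes "g \<in> carrier G" "h \<in> carrier G" "k \<in> carrier G"
  shows "word_dist G S g k \<le> word_dist G S g h + word_dist G S h k"
proof -
  have "inv g \<otimes> k = (inv g \<otimes> h) \<otimes> (inv h \<otimes> k)"
    using assms by (simp add: m_assoc flip: m_assoc[of h "inv h"])
  then show ?thesis
    using len_mult[of "inv g \<otimes> h" "inv h \<otimes> k"] assms by (simp add: word_dist_def flip: of_nat_add)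
qed

lemma asymptotic_cone_subset:
  assumes "nonprincipal_ultrafilter \<omega>" "N \<subseteq> carrier G" "\<one> \<in> N"
  shows "asymptotic_cone \<omega> N (word_dist G S) \<one>"
proof
  fix x y z
  show "0 \<le> word_dist G S x y"
    by (simp add: word_dist_def)
  assume x: "x \<in> N"
  then show "word_dist G S x x = 0"
    using assms(2) by (intro word_dist_refl) auto
  assume y: "y \<in> N"
  show "word_dist G S x y = word_dist G S y x"
    using x y assms(2) by (intro word_dist_commute) auto
  assume z: "z \<in> N"
  show "word_dist G S x z \<le> word_dist G S x y + word_dist G S y z"
    using x y z assms(2) by (intro word_dist_triangle) auto
qed (use assms in simp_all)

text \<open>The prefixes of a shortest word for \<open>g\<close>.\<close>

lemma geodesic_chain:
  assumes "g \<in> carrier G"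
  obtains c where "\<And>i. c i \<in> carrier G" "c 0 = \<one>" "c (len g) = g"
    "\<And>i j. i \<le> j \<Longrightarrow> word_dist G S (c i) (c j) \<le> real (j - i)"
proof -
  obtain xs where xs: "length xs = len g" "set xs \<subseteq> letters" "word xs = g"
    using len_word[OF assms] by blast
  define c where "c i = word (take i xs)" for i
  have l: "set (take i ys) \<subseteq> letters" "set (drop i ys) \<subseteq> letters" if "set ys \<subseteq> letters" for i ys
    using that set_take_subset set_drop_subset by (metis order_trans)+
  have c: "c i \<in> carrier G" for i
    unfolding c_def by (rule word_closed[OF l(1)[OF xs(2)]])
  have "word_dist G S (c i) (c j) \<le> real (j - i)" if "i \<le> j" for i j
  proof -
    let ?ys = "take (j - i) (drop i xs)"
    have ys: "set ?ys \<subseteq> letters"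
      by (rule l(1)[OF l(2)[OF xs(2)]])
    have "take j xs = take i xs @ ?ys"
      using that take_add[of i "j - i" xs] by simp
    then have "c j = c i \<otimes> word ?ys"
      unfolding c_def using word_append[OF l(1)[OF xs(2)] ys] by simp
    then have "inv (c i) \<otimes> c j = word ?ys"
      using c word_closed[OF ys] by (simp flip: m_assoc)
    then show ?thesis
      using len_le[OF ys] by (simp add: word_dist_def)
  qed
  moreover have "c 0 = \<one>" "c (len g) = g"
    using xs by (simp_all add: c_def)
  ultimately show ?thesis
    using that[of c] c by blast
qed

end

text \<open>
  A letter of the image alphabet is the image of a letter, so words lift letter by letter.
\<close>

lemma (in group_hom) word_length_image:
  assumes "generated_group G S"
  shows "g \<in> carrier G \<Longrightarrow> word_length H (h ` S) (h g) \<le> word_length G S g"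
    and "h ` carrier G = carrier H \<Longrightarrow> generated_group H (h ` S)"
    and "\<lbrakk>h ` carrier G = carrier H; q \<in> carrier H\<rbrakk> \<Longrightarrow>
      \<exists>g\<in>carrier G. h g = q \<and> word_length G S g = word_length H (h ` S) q"
proof -
  interpret GS: generated_group G S by fact
  have letters: "h ` GS.letters = h ` S \<union> m_inv H ` h ` S"
    using GS.letters_carrier by (force simp: image_Un image_image)
  have hom_word: "h (GS.word xs) = foldr (\<otimes>\<^bsub>H\<^esub>) (map h xs) \<one>\<^bsub>H\<^esub>" if "set xs \<subseteq> GS.letters" for xs
    using that
  proof (induction xs)
    case (Cons x xs)
    then have "x \<in> carrier G" "GS.word xs \<in> carrier G"
      using GS.letters_carrier GS.word_closed by auto
    then show ?case using Cons by simp
  qed simp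
  have le: "word_length H (h ` S) (h g) \<le> word_length G S g" if "g \<in> carrier G" for g
  proof -
    obtain xs where xs: "length xs = GS.len g" "set xs \<subseteq> GS.letters" "GS.word xs = g"
      using GS.len_word[OF \<open>g \<in> carrier G\<close>] by blast
    have "set (map h xs) \<subseteq> h ` GS.letters"
      using xs(2) by auto
    then have "set (map h xs) \<subseteq> h ` S \<union> m_inv H ` h ` S"
      unfolding letters .
    then show ?thesis
      unfolding word_length_def[of H] using xs hom_word[OF xs(2)]
      by (intro Least_le) (metis length_map)
  qed
  show "g \<in> carrier G \<Longrightarrow> word_length H (h ` S) (h g) \<le> word_length G S g"
    by (rule le)
  assume surj: "h ` carrier G = carrier H"
  have "S \<subseteq> carrier G"
    using GS.letters_carrier by simp
  then show gen: "generated_group H (h ` S)"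
    using generate_img[of S] GS.generates surj by unfold_locales simp
  then interpret HS: generated_group H "h ` S" .
  assume "q \<in> carrier H"
  then obtain ys where ys: "length ys = HS.len q" "set ys \<subseteq> HS.letters" "HS.word ys = q"
    using HS.len_word by blast
  have "ys \<in> lists (h ` GS.letters)"
    using ys(2) letters by auto
  then obtain xs where xs: "set xs \<subseteq> GS.letters" "ys = map h xs"
    unfolding lists_image by (auto simp: in_lists_conv_set)
  have "GS.word xs \<in> carrier G" "h (GS.word xs) = q"
    using GS.word_closed[OF xs(1)] hom_word[OF xs(1)] ys(3) xs(2) by auto
  moreover have "GS.len (GS.word xs) \<le> HS.len q"
    using GS.len_le[OF xs(1)] ys(1) xs(2) by simp
  ultimately show "\<exists>g\<in>carrier G. h g = q \<and> word_length G S g = word_length H (h ` S) q"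
    using le[of "GS.word xs"] by (intro bexI[of _ "GS.word xs"]) auto
qed

context generated_group
begin

text \<open>
  In the space of scale \<open>n\<close>, walk along the prefixes of a shortest word for \<open>g n\<close> with constant
  speed. Rounding the time to a whole number of letters costs at most one letter, that is \<open>1 / n\<close>
  after rescaling, so the limit path is Lipschitz with constant the distance \<open>D\<close> to be covered.
\<close>

lemma cone_path_from_base:
  assumes \<omega>: "nonprincipal_ultrafilter \<omega>" and A: "A \<in> word_cone \<omega> G S"
  shows "\<exists>v. pathin (word_cone_top \<omega> G S) v \<and> v 0 = word_cone_base \<omega> G S \<and> v 1 = A \<and>
    v ` {0..1} \<subseteq> Metric_space.mcball (word_cone \<omega> G S) (word_cone_dist \<omega> G S) (word_cone_base \<omega> G S)
      (word_cone_dist \<omega> G S (word_cone_base \<omega> G S) A)"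
proof -
  interpret C: asymptotic_cone \<omega> "carrier G" "word_dist G S" \<one>
    by (rule asymptotic_cone_subset[OF \<omega>]) auto
  let ?d = "word_dist G S"
  obtain g where g: "g \<in> C.pre" "A = C.cls g"
    using A C.coneE unfolding word_cone_def by blast
  have "\<forall>n. \<exists>c. (\<forall>i. c i \<in> carrier G) \<and> c 0 = \<one> \<and> c (len (g n)) = g n \<and>
      (\<forall>i j. i \<le> j \<longrightarrow> ?d (c i) (c j) \<le> real (j - i))"
    using geodesic_chain[OF C.pre_in[OF g(1)]] by metis
  then obtain c where c: "\<And>n i. c n i \<in> carrier G" "\<And>n. c n 0 = \<one>" "\<And>n. c n (len (g n)) = g n"
    "\<And>n i j. i \<le> j \<Longrightarrow> ?d (c n i) (c n j) \<le> real (j - i)"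
    by metis
  define k where "k t n = nat \<lfloor>t * real (len (g n))\<rfloor>" for t n
  define w where "w t n = c n (k t n)" for t n
  define D where "D = C.pd (\<lambda>n. \<one>) g"
  have D: "((\<lambda>n. real (len (g n)) / real n) \<longlongrightarrow> D) \<omega>"
    using C.pd_tendsto[OF C.pre_base g(1)] C.pre_in[OF g(1)] by (simp add: D_def word_dist_one)
  have "D \<ge> 0"
    unfolding D_def by (rule C.pd_nonneg[OF C.pre_base g(1)])
  have w_pre: "w t \<in> C.pre" if t: "t \<in> {0..1}" for t
  proof -
    obtain B where B: "\<And>n. ?d (g n) \<one> / real n \<le> B"
      using g(1) by (auto simp: C.pre_iff)
    have "?d (w t n) \<one> / real n \<le> B" for n
    proof -
      have "t * real (len (g n)) \<le> 1 * real (len (g n))"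
        using t by (intro mult_right_mono) auto
      moreover have "real (k t n) \<le> t * real (len (g n))"
        unfolding k_def using t by (intro of_nat_floor) auto
      ultimately have "?d (w t n) \<one> \<le> ?d (g n) \<one>"
        using c(4)[of 0 "k t n" n] c(1,2) C.pre_in[OF g(1)]
        by (simp add: w_def word_dist_one word_dist_one')
      then show ?thesis
        using B[of n] by (meson divide_right_mono of_nat_0_le_iff order_trans)
    qed
    then show ?thesis
      using c(1) by (auto simp: C.pre_iff w_def)
  qed
  have lip: "C.cd (C.cls (w s)) (C.cls (w t)) \<le> D * \<bar>s - t\<bar>" if st: "s \<in> {0..1}" "t \<in> {0..1}" "s \<le> t" for s t
  proof -
    have "?d (w s n) (w t n) / real n \<le> \<bar>s - t\<bar> * (real (len (g n)) / real n) + 1 / real n" for n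
    proof -
      have "s * real (len (g n)) \<le> t * real (len (g n))"
        using st by (intro mult_right_mono) auto
      then have le: "k s n \<le> k t n"
        unfolding k_def by (intro nat_mono floor_mono)
      have "0 \<le> s * real (len (g n))" "0 \<le> t * real (len (g n))"
        using st by auto
      then have "real (k t n) \<le> t * real (len (g n))" "s * real (len (g n)) < real (k s n) + 1"
        unfolding k_def by (simp, linarith)
      then have "?d (w s n) (w t n) \<le> (t - s) * real (len (g n)) + 1"
        using c(4)[OF le, of n] le by (simp add: w_def of_nat_diff left_diff_distrib)
      then have "?d (w s n) (w t n) / real n \<le> ((t - s) * real (len (g n)) + 1) / real n"
        by (rule divide_right_mono) simp
      then show ?thesis
        using st by (simp add: add_divide_distrib)
    qed
    moreover have "((\<lambda>n. \<bar>s - t\<bar> * (real (len (g n)) / real n) + 1 / real n) \<longlongrightarrow> \<bar>s - t\<bar> * D + 0) \<omega>"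
      by (intro tendsto_intros D C.tendsto_inverse_nat)
    ultimately have "C.pd (w s) (w t) \<le> \<bar>s - t\<bar> * D + 0"
      using w_pre st by (intro C.pd_le) auto
    then show ?thesis
      using w_pre st by (simp add: C.cd_cls mult.commute)
  qed
  have lip': "C.cd (C.cls (w s)) (C.cls (w t)) \<le> D * \<bar>s - t\<bar>" if "s \<in> {0..1}" "t \<in> {0..1}" for s t
    using lip[of s t] lip[of t s] that C.C.commute[of "C.cls (w s)" "C.cls (w t)"] by (cases "s \<le> t") auto
  have w0: "w 0 = (\<lambda>n. \<one>)" and w1: "w 1 = g"
    by (auto simp: w_def k_def c)
  have "pathin C.C.mtopology (\<lambda>t. C.cls (w t))"
    unfolding C.C.pathin_iff
  proof (intro conjI allI impI)
    fix \<epsilon> :: real assume "\<epsilon> > 0"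
    \<comment> \<open>The constant \<open>D + 1\<close> instead of \<open>D\<close> avoids a division by zero when \<open>A\<close> is the base-point.\<close>
    have "C.cd (C.cls (w s)) (C.cls (w t)) < \<epsilon>" if st: "s \<in> {0..1}" "t \<in> {0..1}" "\<bar>s - t\<bar> < \<epsilon> / (D + 1)" for s t
    proof -
      have "D * \<bar>s - t\<bar> \<le> (D + 1) * \<bar>s - t\<bar>"
        by (intro mult_right_mono) auto
      also have "\<dots> < \<epsilon>"
        using st(3) \<open>D \<ge> 0\<close> by (simp add: pos_less_divide_eq mult.commute)
      finally show ?thesis
        using lip'[OF st(1,2)] by simp
    qed
    then show "\<exists>\<delta>>0. \<forall>s\<in>{0..1}. \<forall>t\<in>{0..1}. \<bar>s - t\<bar> < \<delta> \<longrightarrow> C.cd (C.cls (w s)) (C.cls (w t)) < \<epsilon>"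
      using \<open>\<epsilon> > 0\<close> \<open>D \<ge> 0\<close> by (intro exI[of _ "\<epsilon> / (D + 1)"]) auto
  qed (use w_pre C.cls_in_cone in auto)
  moreover have "C.cls (w t) \<in> C.C.mcball (C.cls (\<lambda>n. \<one>)) (C.cd (C.cls (\<lambda>n. \<one>)) (C.cls g))" if t: "t \<in> {0..1}" for t
  proof -
    have "D * \<bar>0 - t\<bar> \<le> D * 1"
      using t \<open>D \<ge> 0\<close> by (intro mult_left_mono) auto
    then have "C.cd (C.cls (\<lambda>n. \<one>)) (C.cls (w t)) \<le> D"
      using lip'[of 0 t] t by (simp add: w0)
    then show ?thesis
      using w_pre[OF t] C.pre_base g(1) C.cls_in_cone by (simp add: D_def C.cd_cls)
  qed
  ultimately show ?thesis
    unfolding word_cone_top_def word_cone_def word_cone_dist_def word_cone_base_def cone_base_def g(2)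
    using w0 w1 by (intro exI[of _ "\<lambda>t. C.cls (w t)"]) auto
qed

end

section \<open>Central quotients\<close>

locale central_quotient = generated_group G S for G :: "('a, 'b) monoid_scheme" (structure) and S +
  fixes Z :: "'a set" and \<omega> :: "nat filter"
  assumes Z: "subgroup Z G"
    and central: "\<lbrakk>z \<in> Z; g \<in> carrier G\<rbrakk> \<Longrightarrow> z \<otimes> g = g \<otimes> z"
    and ultrafilter: "nonprincipal_ultrafilter \<omega>"
begin

abbreviation "Q \<equiv> G Mod Z"
abbreviation "\<phi> \<equiv> \<lambda>g. Z #> g"
abbreviation "dG \<equiv> word_dist G S"
abbreviation "dQ \<equiv> word_dist Q (quot_gens G Z S)"
abbreviation "K \<equiv> cone_group \<omega> (G\<lparr>carrier := Z\<rparr>) dG"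

lemma Z_carrier: "z \<in> Z \<Longrightarrow> z \<in> carrier G"
  using subgroup.subset[OF Z] by auto

lemma normal_Z: "Z \<lhd> G"
  unfolding normal_inv_iff
proof (intro conjI ballI)
  fix x h assume "x \<in> carrier G" "h \<in> Z"
  then have "x \<otimes> h \<otimes> inv x = h"
    by (simp add: central[symmetric] Z_carrier m_assoc)
  then show "x \<otimes> h \<otimes> inv x \<in> Z"
    using \<open>h \<in> Z\<close> by simp
qed (rule Z)

sublocale \<phi>: group_hom G Q \<phi>
  unfolding group_hom_def group_hom_axioms_def
  using normal.factorgroup_is_group[OF normal_Z] normal.r_coset_hom_Mod[OF normal_Z] is_group by blast

lemma \<phi>_surj: "\<phi> ` carrier G = carrier Q"
  by (simp add: carrier_FactGroup)

lemma \<phi>_Z: "\<lbrakk>z \<in> Z; g \<in> carrier G\<rbrakk> \<Longrightarrow> \<phi> (z \<otimes> g) = \<phi> g"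
  using coset_mult_assoc[of Z z g] coset_join2[OF _ Z, of z] Z_carrier subgroup.subset[OF Z] by simp

lemma \<phi>_fibre: "\<lbrakk>g \<in> carrier G; h \<in> carrier G; \<phi> g = \<phi> h\<rbrakk> \<Longrightarrow> \<exists>z\<in>Z. g = z \<otimes> h"
  using rcos_self[OF _ Z, of g] by (auto simp: r_coset_def)

lemma generated_group_axiom: "generated_group G S"
  by unfold_locales

sublocale Q: generated_group Q "quot_gens G Z S"
  unfolding quot_gens_def by (rule \<phi>.word_length_image(2)[OF generated_group_axiom \<phi>_surj])

lemma dQ_le: "\<lbrakk>g \<in> carrier G; h \<in> carrier G\<rbrakk> \<Longrightarrow> dQ (\<phi> g) (\<phi> h) \<le> dG g h"
  using \<phi>.word_length_image(1)[OF generated_group_axiom, of "inv g \<otimes> h"]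
  by (simp add: word_dist_def quot_gens_def del: mult_FactGroup)

lemma dQ_lift:
  assumes g: "g \<in> carrier G" and q: "q \<in> carrier Q"
  shows "\<exists>h\<in>carrier G. \<phi> h = q \<and> dG g h = dQ (\<phi> g) q"
proof -
  have "inv\<^bsub>Q\<^esub> (\<phi> g) \<otimes>\<^bsub>Q\<^esub> q \<in> carrier Q"
    using g q by (intro \<phi>.H.m_closed \<phi>.H.inv_closed \<phi>.hom_closed)
  then obtain k where k: "k \<in> carrier G" "\<phi> k = inv\<^bsub>Q\<^esub> (\<phi> g) \<otimes>\<^bsub>Q\<^esub> q" "len k = Q.len (inv\<^bsub>Q\<^esub> (\<phi> g) \<otimes>\<^bsub>Q\<^esub> q)"
    using \<phi>.word_length_image(3)[OF generated_group_axiom \<phi>_surj] unfolding quot_gens_def by metis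
  have "\<phi> (g \<otimes> k) = \<phi> g \<otimes>\<^bsub>Q\<^esub> (inv\<^bsub>Q\<^esub> (\<phi> g) \<otimes>\<^bsub>Q\<^esub> q)"
    using g k by (simp only: \<phi>.hom_mult)
  also have "\<dots> = q"
    using g q by (metis \<phi>.H.inv_closed \<phi>.H.l_one \<phi>.H.m_assoc \<phi>.H.r_inv \<phi>.hom_closed)
  finally have "\<phi> (g \<otimes> k) = q" .
  moreover have "dG g (g \<otimes> k) = dQ (\<phi> g) q"
    using g k by (simp add: word_dist_def flip: m_assoc)
  ultimately show ?thesis
    using g k by blast
qed

text \<open>
  Centrality moves the elements of \<open>Z\<close> to the left or to the right of \<open>g\<close> at will, so left
  invariance of the word metric turns into isometry of multiplication by \<open>g\<close>.
\<close>

lemma dG_mult: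
  assumes "z \<in> Z" "z' \<in> Z" "g \<in> carrier G" "g' \<in> carrier G"
  shows "dG (z \<otimes> g) (z' \<otimes> g') \<le> dG z z' + dG g g'" and "dG (z \<otimes> g) (z' \<otimes> g) = dG z z'"
proof -
  have Z': "z \<in> carrier G" "z' \<in> carrier G"
    using assms Z_carrier by auto
  have "dG (z \<otimes> g) (z' \<otimes> g) = dG (g \<otimes> z) (g \<otimes> z')"
    using assms by (simp add: central)
  also have "\<dots> = dG z z'"
    using assms Z' by (intro word_dist_left) auto
  finally show eq: "dG (z \<otimes> g) (z' \<otimes> g) = dG z z'" .
  have "dG (z \<otimes> g) (z' \<otimes> g') \<le> dG (z \<otimes> g) (z' \<otimes> g) + dG (z' \<otimes> g) (z' \<otimes> g')"
    using assms Z' by (intro word_dist_triangle) auto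
  then show "dG (z \<otimes> g) (z' \<otimes> g') \<le> dG z z' + dG g g'"
    using eq word_dist_left[of z' g g'] assms Z' by simp
qed

sublocale CG: asymptotic_cone \<omega> "carrier G" dG \<one>
  by (rule asymptotic_cone_subset[OF ultrafilter]) auto

sublocale CZ: asymptotic_cone \<omega> Z dG \<one>
  by (rule asymptotic_cone_subset[OF ultrafilter]) (auto simp: Z_carrier subgroup.one_closed[OF Z])

sublocale CQ: asymptotic_cone \<omega> "carrier Q" dQ "\<one>\<^bsub>Q\<^esub>"
  by (rule Q.asymptotic_cone_subset[OF ultrafilter order_refl \<phi>.H.one_closed])

lemma CZ_pre_CG: "a \<in> CZ.pre \<Longrightarrow> a \<in> CG.pre"
  by (auto simp: CZ.pre_iff CG.pre_iff Z_carrier)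

lemma mult_pre:
  assumes "a \<in> CZ.pre" "x \<in> CG.pre" shows "(\<lambda>n. a n \<otimes> x n) \<in> CG.pre"
proof -
  obtain B C where BC: "\<And>n. dG (a n) \<one> / real n \<le> B" "\<And>n. dG (x n) \<one> / real n \<le> C"
    using assms by (auto simp: CG.pre_iff CZ.pre_iff)
  have in_Z: "a n \<in> Z" and in_G: "x n \<in> carrier G" for n
    using assms CZ.pre_in CG.pre_in by auto
  have "dG (a n \<otimes> x n) \<one> / real n \<le> B + C" for n
  proof -
    have "dG (a n \<otimes> x n) \<one> / real n \<le> dG (a n) \<one> / real n + dG (x n) \<one> / real n"
      using dG_mult(1)[OF in_Z CZ.base in_G one_closed, of n n]
      by (simp add: add_divide_distrib[symmetric] divide_right_mono)
    then show ?thesis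
      using BC[of n] by simp
  qed
  then show ?thesis
    using in_Z in_G Z_carrier by (auto simp: CG.pre_iff)
qed

lemma mult_pre_Z:
  assumes "a \<in> CZ.pre" "b \<in> CZ.pre" shows "(\<lambda>n. a n \<otimes> b n) \<in> CZ.pre"
  using mult_pre[OF assms(1) CZ_pre_CG[OF assms(2)]] subgroup.m_closed[OF Z] CZ.pre_in assms
  by (auto simp: CG.pre_iff CZ.pre_iff)

lemma pd_mult:
  assumes "a \<in> CZ.pre" "b \<in> CZ.pre" "x \<in> CG.pre" "y \<in> CG.pre"
  shows "CG.pd (\<lambda>n. a n \<otimes> x n) (\<lambda>n. b n \<otimes> y n) \<le> CG.pd a b + CG.pd x y"
proof (rule CG.pd_le[OF mult_pre mult_pre tendsto_add[OF CZ.pd_tendsto CG.pd_tendsto]])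
  show "eventually (\<lambda>n. dG (a n \<otimes> x n) (b n \<otimes> y n) / real n \<le> dG (a n) (b n) / real n + dG (x n) (y n) / real n) \<omega>"
    using dG_mult(1) CZ.pre_in CG.pre_in assms
    by (auto intro!: always_eventually simp: add_divide_distrib[symmetric] divide_right_mono)
qed (use assms in auto)

definition act :: "(nat \<Rightarrow> 'a) set \<Rightarrow> (nat \<Rightarrow> 'a) set \<Rightarrow> (nat \<Rightarrow> 'a) set" where
  "act A B = (\<Union>a\<in>A. \<Union>x\<in>B. CG.cls (\<lambda>n. a n \<otimes> x n))"

lemma act_cls:
  assumes "a \<in> CZ.pre" "x \<in> CG.pre"
  shows "act (CZ.cls a) (CG.cls x) = CG.cls (\<lambda>n. a n \<otimes> x n)"
  unfolding act_def
proof (rule UN2_eq_const)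
  show "a \<in> CZ.cls a" "x \<in> CG.cls x"
    using assms CZ.cls_self CG.cls_self by auto
  fix b y assume "b \<in> CZ.cls a" "y \<in> CG.cls x"
  then have b: "b \<in> CZ.pre" "CZ.pd a b = 0" and y: "y \<in> CG.pre" "CG.pd x y = 0"
    by (auto simp: CZ.mem_cls CG.mem_cls)
  have "CG.pd (\<lambda>n. b n \<otimes> y n) (\<lambda>n. a n \<otimes> x n) = 0"
    using pd_mult[of b a y x] CG.pd_nonneg[OF mult_pre mult_pre, of b y a x] assms b y
      CZ.pd_commute[of a b] CG.pd_commute[of x y] by simp
  then show "CG.cls (\<lambda>n. b n \<otimes> y n) = CG.cls (\<lambda>n. a n \<otimes> x n)"
    using CG.cls_eq_iff mult_pre assms b(1) y(1) by blast
qed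

lemma mult_K:
  assumes "a \<in> CZ.pre" "b \<in> CZ.pre"
  shows "CZ.cls a \<otimes>\<^bsub>K\<^esub> CZ.cls b = CZ.cls (\<lambda>n. a n \<otimes> b n)"
proof -
  have "(\<Union>a'\<in>CZ.cls a. \<Union>b'\<in>CZ.cls b. CZ.cls (\<lambda>n. a' n \<otimes> b' n)) = CZ.cls (\<lambda>n. a n \<otimes> b n)"
  proof (rule UN2_eq_const)
    show "a \<in> CZ.cls a" "b \<in> CZ.cls b"
      using assms CZ.cls_self by auto
    fix a' b' assume "a' \<in> CZ.cls a" "b' \<in> CZ.cls b"
    then have a': "a' \<in> CZ.pre" "CZ.pd a a' = 0" and b': "b' \<in> CZ.pre" "CZ.pd b b' = 0"
      by (auto simp: CZ.mem_cls)
    have "CZ.pd (\<lambda>n. a' n \<otimes> b' n) (\<lambda>n. a n \<otimes> b n) = 0"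
      using pd_mult[OF a'(1) assms(1) CZ_pre_CG CZ_pre_CG, of b' b] assms a' b'
        CZ.pd_nonneg[OF mult_pre_Z mult_pre_Z, of a' b' a b]
        CZ.pd_commute[of a a'] CZ.pd_commute[of b b'] by simp
    then show "CZ.cls (\<lambda>n. a' n \<otimes> b' n) = CZ.cls (\<lambda>n. a n \<otimes> b n)"
      using CZ.cls_eq_iff mult_pre_Z assms a'(1) b'(1) by blast
  qed
  then show ?thesis
    by (simp add: cone_group_def)
qed

lemma carrier_K: "carrier K = CZ.acone"
  by (simp add: cone_group_def)

lemma one_K: "\<one>\<^bsub>K\<^esub> = CZ.cls (\<lambda>n. \<one>)"
  by (simp add: cone_group_def cone_base_def)

lemma K_cases:
  assumes "A \<in> carrier K" obtains a where "a \<in> CZ.pre" "A = CZ.cls a"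
  using assms CZ.coneE unfolding carrier_K by blast

lemma comm_group_K: "comm_group K"
proof (rule comm_groupI)
  show "\<one>\<^bsub>K\<^esub> \<in> carrier K"
    by (simp add: one_K carrier_K CZ.cls_in_cone CZ.pre_base)
  fix A assume "A \<in> carrier K"
  then obtain a where a: "a \<in> CZ.pre" "A = CZ.cls a"
    by (rule K_cases)
  have aG: "a n \<in> carrier G" for n
    using CZ.pre_in[OF a(1)] Z_carrier by blast
  show "\<one>\<^bsub>K\<^esub> \<otimes>\<^bsub>K\<^esub> A = A"
    using a aG by (simp add: one_K mult_K CZ.pre_base)
  have "(\<lambda>n. inv (a n)) \<in> CZ.pre"
    using a(1) aG subgroup.m_inv_closed[OF Z] by (auto simp: CZ.pre_iff word_dist_one' len_inv)
  then show "\<exists>B\<in>carrier K. B \<otimes>\<^bsub>K\<^esub> A = \<one>\<^bsub>K\<^esub>"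
    using a aG by (intro bexI[of _ "CZ.cls (\<lambda>n. inv (a n))"]) (auto simp: one_K mult_K carrier_K CZ.cls_in_cone)
  fix B assume "B \<in> carrier K"
  then obtain b where b: "b \<in> CZ.pre" "B = CZ.cls b"
    by (rule K_cases)
  have bG: "b n \<in> carrier G" for n
    using CZ.pre_in[OF b(1)] Z_carrier by blast
  show "A \<otimes>\<^bsub>K\<^esub> B \<in> carrier K"
    using a b by (simp add: mult_K carrier_K CZ.cls_in_cone mult_pre_Z)
  show "A \<otimes>\<^bsub>K\<^esub> B = B \<otimes>\<^bsub>K\<^esub> A"
    using a b central[OF CZ.pre_in[OF a(1)] bG] by (simp add: mult_K)
  fix D assume "D \<in> carrier K"
  then obtain c where c: "c \<in> CZ.pre" "D = CZ.cls c"
    by (rule K_cases)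
  have cG: "c n \<in> carrier G" for n
    using CZ.pre_in[OF c(1)] Z_carrier by blast
  show "A \<otimes>\<^bsub>K\<^esub> B \<otimes>\<^bsub>K\<^esub> D = A \<otimes>\<^bsub>K\<^esub> (B \<otimes>\<^bsub>K\<^esub> D)"
    using a b c aG bG cG by (simp add: mult_K mult_pre_Z m_assoc)
qed

lemma proj_cls:
  assumes "x \<in> CG.pre"
  shows "\<phi> \<circ> x \<in> CQ.pre" and "cone_proj \<omega> G Z S (CG.cls x) = CQ.cls (\<phi> \<circ> x)"
    and "y \<in> CG.pre \<Longrightarrow> CQ.pd (\<phi> \<circ> x) (\<phi> \<circ> y) \<le> CG.pd x y"
proof -
  note f = cone_map_cls[OF CG.asymptotic_cone_axioms CQ.asymptotic_cone_axioms _ \<phi>.hom_one dQ_le assms]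
  have "\<phi> \<in> carrier G \<rightarrow> carrier Q"
    using \<phi>.hom_closed by blast
  from f[OF this] show "\<phi> \<circ> x \<in> CQ.pre" "cone_proj \<omega> G Z S (CG.cls x) = CQ.cls (\<phi> \<circ> x)"
    "y \<in> CG.pre \<Longrightarrow> CQ.pd (\<phi> \<circ> x) (\<phi> \<circ> y) \<le> CG.pd x y"
    unfolding cone_proj_def by blast+
qed

lemma incl_cls: "a \<in> CZ.pre \<Longrightarrow> cone_incl \<omega> G S (CZ.cls a) = CG.cls a"
  unfolding cone_incl_def
  by (subst cone_map_cls(2)[OF CZ.asymptotic_cone_axioms CG.asymptotic_cone_axioms])
     (auto simp: Z_carrier o_def)

text \<open>
  Distances in the quotient group are attained, and they are attained at all scales at once, so
  the equality passes to the cones.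
\<close>

lemma lift_sequence:
  assumes x: "x \<in> CG.pre" and q: "q \<in> CQ.pre"
  shows "\<exists>h\<in>CG.pre. \<phi> \<circ> h = q \<and> CG.pd x h = CQ.pd (\<phi> \<circ> x) q"
proof -
  have "\<forall>n. \<exists>h\<in>carrier G. \<phi> h = q n \<and> dG (x n) h = dQ (\<phi> (x n)) (q n)"
    using dQ_lift CG.pre_in[OF x] CQ.pre_in[OF q] by blast
  then obtain h where h: "\<And>n. h n \<in> carrier G" "\<And>n. \<phi> (h n) = q n" "\<And>n. dG (x n) (h n) = dQ (\<phi> (x n)) (q n)"
    by metis
  obtain B where B: "\<And>n. dG (x n) \<one> / real n \<le> B"
    using x by (auto simp: CG.pre_iff)
  obtain C where C: "\<And>n. \<bar>dQ ((\<phi> \<circ> x) n) (q n) / real n\<bar> \<le> C"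
    using CQ.pre_bound[OF proj_cls(1)[OF x] q] by blast
  have "dG (h n) \<one> / real n \<le> C + B" for n
  proof -
    have "dG (h n) \<one> / real n \<le> dQ (\<phi> (x n)) (q n) / real n + dG (x n) \<one> / real n"
      using word_dist_triangle[OF h(1) CG.pre_in[OF x] one_closed, of n n] word_dist_commute[OF h(1) CG.pre_in[OF x], of n n] h(3)[of n]
      by (simp add: add_divide_distrib[symmetric] divide_right_mono)
    then show ?thesis
      using B[of n] abs_le_D1[OF C[of n]] by simp
  qed
  then have "h \<in> CG.pre"
    using h(1) by (auto simp: CG.pre_iff)
  moreover have "\<phi> \<circ> h = q" "CG.pd x h = CQ.pd (\<phi> \<circ> x) q"
    using h by (auto simp: precone_dist_def)
  ultimately show ?thesis
    by blast
qed

text \<open>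
  Sequences whose projections are at distance zero need not lie in the same cosets. First move \<open>y\<close>,
  within its class, to a sequence over the projection of \<open>x\<close>; the quotient by \<open>x\<close> then
  lies in \<open>Z\<close>.
\<close>

lemma same_projection:
  assumes x: "x \<in> CG.pre" and y: "y \<in> CG.pre" and xy: "CQ.pd (\<phi> \<circ> y) (\<phi> \<circ> x) = 0"
  shows "\<exists>a\<in>CZ.pre. CG.cls y = act (CZ.cls a) (CG.cls x)"
proof -
  obtain h where h: "h \<in> CG.pre" "\<phi> \<circ> h = \<phi> \<circ> x" "CG.pd y h = 0"
    using lift_sequence[OF y proj_cls(1)[OF x]] xy by auto
  have hx: "h n \<in> carrier G" "x n \<in> carrier G" for n
    using CG.pre_in h(1) x by auto
  have "\<forall>n. \<exists>z\<in>Z. h n = z \<otimes> x n"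
    using \<phi>_fibre[OF hx] h(2) by (metis comp_apply)
  then obtain a where a: "\<And>n. a n \<in> Z" "\<And>n. h n = a n \<otimes> x n"
    by metis
  obtain C where C: "\<And>n. \<bar>dG (h n) (x n) / real n\<bar> \<le> C"
    using CG.pre_bound[OF h(1) x] by blast
  have "dG (a n) \<one> / real n \<le> C" for n
  proof -
    have "dG (a n) \<one> = dG (a n \<otimes> x n) (\<one> \<otimes> x n)"
      using dG_mult(2)[OF a(1) CZ.base hx(2) hx(2)] by metis
    then show ?thesis
      using abs_le_D1[OF C[of n]] hx(2) a(2) by simp
  qed
  then have "a \<in> CZ.pre"
    using a(1) by (auto simp: CZ.pre_iff)
  moreover have "h = (\<lambda>n. a n \<otimes> x n)"
    using a(2) by auto
  then have "CG.cls y = act (CZ.cls a) (CG.cls x)"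
    using act_cls[OF \<open>a \<in> CZ.pre\<close> x] CG.cls_eq_iff[OF y h(1)] h(3) by simp
  ultimately show ?thesis by blast
qed

lemma ultrametric_quotient_cones:
  assumes "ultrametric_on CZ.acone CZ.cd"
  shows "ultrametric_quotient CG.acone CG.cd CQ.acone CQ.cd K CZ.cd act (cone_proj \<omega> G Z S) (CG.cls (\<lambda>n. \<one>))"
proof -
  interpret K: comm_group K by (rule comm_group_K)
  show ?thesis
  proof
    show "CG.cls (\<lambda>n. \<one>) \<in> CG.acone"
      by (rule CG.cls_in_cone[OF CG.pre_base])
    show "CG.C.mcomplete"
      by (rule CG.mcomplete_cone)
    show "ultrametric_on (carrier K) CZ.cd"
      using assms by (simp add: carrier_K)
  next
    fix A X assume A: "A \<in> carrier K" and X: "X \<in> CG.acone"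
    obtain a where a: "a \<in> CZ.pre" "A = CZ.cls a"
      using A by (rule K_cases)
    obtain x where x: "x \<in> CG.pre" "X = CG.cls x"
      using X by (rule CG.coneE)
    have in_Z: "a n \<in> Z" "a n \<in> carrier G" and in_G: "x n \<in> carrier G" for n
      using CZ.pre_in[OF a(1)] Z_carrier CG.pre_in[OF x(1)] by auto
    show "act A X \<in> CG.acone"
      using a x by (simp add: act_cls CG.cls_in_cone mult_pre)
    have "\<phi> \<circ> (\<lambda>n. a n \<otimes> x n) = \<phi> \<circ> x"
      by (rule ext) (simp only: o_def \<phi>_Z in_Z in_G)
    then show "cone_proj \<omega> G Z S (act A X) = cone_proj \<omega> G Z S X"
      using a x by (simp add: act_cls proj_cls(2) mult_pre)
    fix Y assume "Y \<in> CG.acone"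
    then obtain y where y: "y \<in> CG.pre" "Y = CG.cls y"
      by (rule CG.coneE)
    have "dG (a n \<otimes> x n) (a n \<otimes> y n) = dG (x n) (y n)" for n
      using word_dist_left in_Z in_G CG.pre_in[OF y(1)] by blast
    then show "CG.cd (act A X) (act A Y) = CG.cd X Y"
      using a x y by (simp add: act_cls CG.cd_cls mult_pre precone_dist_def)
  next
    fix A B X assume A: "A \<in> carrier K" and B: "B \<in> carrier K" and X: "X \<in> CG.acone"
    obtain a where a: "a \<in> CZ.pre" "A = CZ.cls a"
      using A by (rule K_cases)
    obtain b where b: "b \<in> CZ.pre" "B = CZ.cls b"
      using B by (rule K_cases)
    obtain x where x: "x \<in> CG.pre" "X = CG.cls x"
      using X by (rule CG.coneE)
    have in_Z: "a n \<in> Z" "b n \<in> Z" "a n \<in> carrier G" "b n \<in> carrier G" and in_G: "x n \<in> carrier G" for n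
      using CZ.pre_in[OF a(1)] CZ.pre_in[OF b(1)] Z_carrier CG.pre_in[OF x(1)] by auto
    show "act (A \<otimes>\<^bsub>K\<^esub> B) X = act A (act B X)"
      using a b x in_Z in_G by (simp add: act_cls mult_K mult_pre mult_pre_Z m_assoc)
    have "dG (a n \<otimes> x n) (b n \<otimes> x n) = dG (a n) (b n)" for n
      using dG_mult(2) in_Z in_G by blast
    then show "CG.cd (act A X) (act B X) = CZ.cd A B"
      using a b x by (simp add: act_cls CG.cd_cls CZ.cd_cls mult_pre precone_dist_def)
  next
    fix X assume X: "X \<in> CG.acone"
    then obtain x where x: "x \<in> CG.pre" "X = CG.cls x"
      by (rule CG.coneE)
    have in_G: "x n \<in> carrier G" for n
      using CG.pre_in[OF x(1)] .
    show "act \<one>\<^bsub>K\<^esub> X = X"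
      using x in_G by (simp add: one_K act_cls CZ.pre_base)
    show "cone_proj \<omega> G Z S X \<in> CQ.acone"
      using CQ.cls_in_cone[OF proj_cls(1)[OF x(1)]] proj_cls(2)[OF x(1)] x(2) by simp
    show "\<exists>v. pathin CG.C.mtopology v \<and> v 0 = CG.cls (\<lambda>n. \<one>) \<and> v 1 = X \<and>
        v ` {0..1} \<subseteq> CG.C.mcball (CG.cls (\<lambda>n. \<one>)) (CG.cd (CG.cls (\<lambda>n. \<one>)) X)"
      using cone_path_from_base[OF ultrafilter, of X] X
      unfolding word_cone_top_def word_cone_def word_cone_dist_def word_cone_base_def cone_base_def by blast
    {
      fix W assume "W \<in> CQ.acone"
      then obtain q where q: "q \<in> CQ.pre" "W = CQ.cls q"
        by (rule CQ.coneE)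
      obtain h where "h \<in> CG.pre" "\<phi> \<circ> h = q" "CG.pd x h = CQ.pd (\<phi> \<circ> x) q"
        using lift_sequence[OF x(1) q(1)] by blast
      then show "\<exists>X'\<in>CG.acone. cone_proj \<omega> G Z S X' = W \<and> CG.cd X X' = CQ.cd (cone_proj \<omega> G Z S X) W"
        using x q by (intro bexI[of _ "CG.cls h"]) (auto simp: proj_cls CG.cd_cls CQ.cd_cls CG.cls_in_cone simp del: one_FactGroup)
    }
    fix Y assume "Y \<in> CG.acone"
    then obtain y where y: "y \<in> CG.pre" "Y = CG.cls y"
      by (rule CG.coneE)
    show "CQ.cd (cone_proj \<omega> G Z S X) (cone_proj \<omega> G Z S Y) \<le> CG.cd X Y"
      using x y by (simp add: proj_cls CG.cd_cls CQ.cd_cls del: one_FactGroup)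
    assume "cone_proj \<omega> G Z S X = cone_proj \<omega> G Z S Y"
    then have "CQ.cls (\<phi> \<circ> y) = CQ.cls (\<phi> \<circ> x)"
      using x y by (simp add: proj_cls)
    then have "CQ.pd (\<phi> \<circ> y) (\<phi> \<circ> x) = 0"
      using CQ.cls_eq_iff[OF proj_cls(1)[OF y(1)] proj_cls(1)[OF x(1)]] by blast
    then show "\<exists>A\<in>carrier K. Y = act A X"
      using same_projection[OF x(1) y(1)] x(2) y(2) CZ.cls_in_cone carrier_K by metis
  next
    fix A B assume A: "A \<in> carrier K" and B: "B \<in> carrier K"
      and AB: "act A (CG.cls (\<lambda>n. \<one>)) = act B (CG.cls (\<lambda>n. \<one>))"
    obtain a where a: "a \<in> CZ.pre" "A = CZ.cls a"
      using A by (rule K_cases)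
    obtain b where b: "b \<in> CZ.pre" "B = CZ.cls b"
      using B by (rule K_cases)
    have "a n \<in> carrier G" "b n \<in> carrier G" for n
      using CZ.pre_in[OF a(1)] CZ.pre_in[OF b(1)] Z_carrier by auto
    then have "CG.cls a = CG.cls b"
      using AB a b by (simp add: act_cls CG.pre_base)
    then show "A = B"
      using CG.cls_eq_iff[OF CZ_pre_CG[OF a(1)] CZ_pre_CG[OF b(1)]] CZ.cls_eq_iff[OF a(1) b(1)] a b by simp
  qed
qed

end

theorem theorem4p7:
  fixes G :: "('a, 'b) monoid_scheme" and T :: "'a topology"
    and Z S :: "'a set" and \<omega> :: "nat filter"
  assumes "locally_compact_group G T"
    and "compactin T S" and "generate G S = carrier G"
    and "subgroup Z G" and "closedin T Z"
    and "\<forall>z\<in>Z. \<forall>g\<in>carrier G. z \<otimes>\<^bsub>G\<^esub> g = g \<otimes>\<^bsub>G\<^esub> z"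
    and "nonprincipal_ultrafilter \<omega>"
    and "ultrametric_on (asymp_cone \<omega> Z (word_dist G S) \<one>\<^bsub>G\<^esub>) (cone_dist \<omega> Z (word_dist G S) \<one>\<^bsub>G\<^esub>)"
  shows "Lipschitz_exact
           (metric_pi1 (word_cone \<omega> G S) (word_cone_dist \<omega> G S) (word_cone_base \<omega> G S))
           (pi1_dist (word_cone \<omega> G S) (word_cone_dist \<omega> G S) (word_cone_base \<omega> G S))
           (metric_pi1 (word_cone \<omega> (G Mod Z) (quot_gens G Z S))
              (word_cone_dist \<omega> (G Mod Z) (quot_gens G Z S))
              (word_cone_base \<omega> (G Mod Z) (quot_gens G Z S)))
           (pi1_dist (word_cone \<omega> (G Mod Z) (quot_gens G Z S))
              (word_cone_dist \<omega> (G Mod Z) (quot_gens G Z S))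
              (word_cone_base \<omega> (G Mod Z) (quot_gens G Z S)))
           (cone_group \<omega> (G\<lparr>carrier := Z\<rparr>) (word_dist G S))
           (cone_dist \<omega> Z (word_dist G S) \<one>\<^bsub>G\<^esub>)
           (pi1_map (word_cone_top \<omega> (G Mod Z) (quot_gens G Z S))
              (word_cone_base \<omega> (G Mod Z) (quot_gens G Z S)) (cone_proj \<omega> G Z S))
           (mu_tilde \<omega> G Z S)"
proof -
  interpret group G
    using assms(1) by (simp add: locally_compact_group_def topological_group_def)
  interpret central_quotient G S Z \<omega>
    using assms
    by (intro central_quotient.intro generated_group.intro generated_group_axioms.intro
        central_quotient_axioms.intro is_group) auto
  interpret U: ultrametric_quotient CG.acone CG.cd CQ.acone CQ.cd K CZ.cd act "cone_proj \<omega> G Z S" "CG.cls (\<lambda>n. \<one>\<^bsub>G\<^esub>)"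
    by (rule ultrametric_quotient_cones[OF assms(8)])
  have base: "cone_proj \<omega> G Z S (CG.cls (\<lambda>n. \<one>\<^bsub>G\<^esub>)) = CQ.cls (\<lambda>n. \<one>\<^bsub>Q\<^esub>)"
    using proj_cls(2)[OF CG.pre_base] \<phi>.hom_one by (simp only: o_def)
  have incl: "cone_incl \<omega> G S A = act A (CG.cls (\<lambda>n. \<one>\<^bsub>G\<^esub>))" if "A \<in> CZ.acone" for A
  proof -
    obtain a where a: "a \<in> CZ.pre" "A = CZ.cls a"
      using \<open>A \<in> CZ.acone\<close> by (rule CZ.coneE)
    have "a n \<in> carrier G" for n
      using CZ.pre_in[OF a(1)] Z_carrier by blast
    then show ?thesis
      using a by (simp add: incl_cls act_cls CG.pre_base)
  qed
  have mu: "U.\<mu> = mu_tilde \<omega> G Z S"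
    unfolding U.\<mu>_def mu_tilde_def U.lift_def is_lift_def carrier_K fun_eq_iff
      word_cone_top_def word_cone_def word_cone_dist_def word_cone_base_def cone_base_def
    using incl by (intro allI arg_cong[where f = The] ext conj_cong refl) simp
  show ?thesis
    using U.Lipschitz_exact_fundamental_groups
    unfolding base mu word_cone_top_def word_cone_def word_cone_dist_def word_cone_base_def cone_base_def .
qed

end
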